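(* Suppose $X$ is a diffeological quasifold. Then there is a foliated manifold $(M,\mathcal{F})$ such that $X$ is diffeomorphic, as a diffeological space, to the leaf space $M/\mathcal{F}$.
   Context: Manifolds are Hausdorff and second-countable; foliations are regular. A diffeology on a set $X$ is a collection of maps (plots) from open subsets of Cartesian spaces $\mathbb{R}^k$ ($k\ge0$) into $X$, containing all locally constant maps, closed under precomposition with smooth maps between open subsets of Cartesian spaces, and containing every map that is locally a plot. A map between diffeological spaces is smooth if it sends plots to plots by composition; a diffeomorphism is a smooth bijection with smooth inverse. Manifolds carry the diffeology of all smooth maps from open subsets of Cartesian spaces. The D-topology is the finest topology making all plots continuous. Subsets carry the subset diffeology (plots with image in the subset). A quotient $X/{\sim}$ carries the quotient diffeology: plots are the maps that locally lift to plots of $X$. In particular leaf spaces $M/\mathcal{F}$ carry the quotient diffeology. A diffeological quasifold of dimension $n$ is a diffeological space $X$, second-countable in the D-topology, such that for every $x\in X$ there are a D-open neighbourhood $U$ of $x$, a countable subgroup $\Gamma\le\operatorname{Aff}(\mathbb{R}^n)$, a $\Gamma$-invariant open subset $V\subseteq\mathbb{R}^n$, and a diffeological diffeomorphism $F:U\to V/\Gamma$. *)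

theory Defs
  imports "HOL-Analysis.Analysis" "HOL-Algebra.Bij"
begin

text \<open>
  Cartesian spaces of all dimensions live in the single type \<open>nat \<Rightarrow> real\<close>: \<open>\<R> n\<close> is the library's
  \<open>Euclidean_space n\<close>, whose points are the sequences vanishing from index \<open>n\<close> on.
  Functions on an open set \<open>U\<close> are total functions of which only the values on \<open>U\<close> matter.
\<close>

abbreviation Cartesian :: "nat \<Rightarrow> (nat \<Rightarrow> real) topology" (\<open>\<R>\<close>) where
  "\<R> \<equiv> Euclidean_space"


section \<open>Smooth maps between open subsets of Cartesian spaces\<close>

text \<open>
  \<open>Ck r m U f\<close>: on the open set \<open>U\<close> of \<open>\<R> m\<close>, the real-valued function \<open>f\<close> has continuous
  partial derivatives of all orders up to \<open>r\<close>.
\<close>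

primrec Ck :: "nat \<Rightarrow> nat \<Rightarrow> (nat \<Rightarrow> real) set \<Rightarrow> ((nat \<Rightarrow> real) \<Rightarrow> real) \<Rightarrow> bool" where
  "Ck 0 m U f \<longleftrightarrow> continuous_map (subtopology (\<R> m) U) euclideanreal f"
| "Ck (Suc r) m U f \<longleftrightarrow>
     continuous_map (subtopology (\<R> m) U) euclideanreal f \<and>
     (\<forall>i<m. \<exists>g. (\<forall>x\<in>U. ((\<lambda>t. f (x(i := t))) has_real_derivative g x) (at (x i))) \<and> Ck r m U g)"

definition smooth_map ::
    "nat \<Rightarrow> (nat \<Rightarrow> real) set \<Rightarrow> nat \<Rightarrow> ((nat \<Rightarrow> real) \<Rightarrow> (nat \<Rightarrow> real)) \<Rightarrow> bool" where
  "smooth_map m U n f \<longleftrightarrow>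
     openin (\<R> m) U \<and> f \<in> U \<rightarrow> topspace (\<R> n) \<and> (\<forall>i<n. \<forall>r. Ck r m U (\<lambda>x. f x i))"


section \<open>Diffeological spaces\<close>

text \<open>\<open>D k U p\<close> says that \<open>p\<close>, restricted to the open subset \<open>U\<close> of \<open>\<R> k\<close>, is a plot.\<close>

type_synonym 'a diffeology = "nat \<Rightarrow> (nat \<Rightarrow> real) set \<Rightarrow> ((nat \<Rightarrow> real) \<Rightarrow> 'a) \<Rightarrow> bool"

locale diffeological_space =
  fixes X :: "'a set" and D :: "'a diffeology"
  assumes plot_openin: "D k U p \<Longrightarrow> openin (\<R> k) U"
    and plot_range: "D k U p \<Longrightarrow> p \<in> U \<rightarrow> X"
    and plot_cong: "\<lbrakk>D k U p; \<forall>x\<in>U. q x = p x\<rbrakk> \<Longrightarrow> D k U q"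
    and locally_constant_plot:
      "\<lbrakk>openin (\<R> k) U; p \<in> U \<rightarrow> X;
        \<forall>x\<in>U. \<exists>V. openin (\<R> k) V \<and> x \<in> V \<and> V \<subseteq> U \<and> (\<forall>y\<in>V. p y = p x)\<rbrakk> \<Longrightarrow> D k U p"
    and plot_compose:
      "\<lbrakk>D k U p; smooth_map l W k f; f \<in> W \<rightarrow> U\<rbrakk> \<Longrightarrow> D l W (p \<circ> f)"
    and plot_local:
      "\<lbrakk>openin (\<R> k) U; \<forall>x\<in>U. \<exists>V. openin (\<R> k) V \<and> x \<in> V \<and> V \<subseteq> U \<and> D k V p\<rbrakk> \<Longrightarrow> D k U p"

definition dsmooth :: "'a diffeology \<Rightarrow> 'b diffeology \<Rightarrow> ('a \<Rightarrow> 'b) \<Rightarrow> bool" where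
  "dsmooth D E f \<longleftrightarrow> (\<forall>k U p. D k U p \<longrightarrow> E k U (f \<circ> p))"

definition diffeomorphism ::
    "'a set \<Rightarrow> 'a diffeology \<Rightarrow> 'b set \<Rightarrow> 'b diffeology \<Rightarrow> ('a \<Rightarrow> 'b) \<Rightarrow> bool" where
  "diffeomorphism X D Y E f \<longleftrightarrow>
     bij_betw f X Y \<and> dsmooth D E f \<and> dsmooth E D (inv_into X f)"

definition diffeomorphic ::
    "'a set \<Rightarrow> 'a diffeology \<Rightarrow> 'b set \<Rightarrow> 'b diffeology \<Rightarrow> bool" where
  "diffeomorphic X D Y E \<longleftrightarrow> (\<exists>f. diffeomorphism X D Y E f)"

definition D_topology :: "'a set \<Rightarrow> 'a diffeology \<Rightarrow> 'a topology" where
  "D_topology X D =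
     topology (\<lambda>A. A \<subseteq> X \<and> (\<forall>k U p. D k U p \<longrightarrow> openin (\<R> k) {x\<in>U. p x \<in> A}))"

lemma openin_D_topology:
  "openin (D_topology X D) A \<longleftrightarrow>
     A \<subseteq> X \<and> (\<forall>k U p. D k U p \<longrightarrow> openin (\<R> k) {x\<in>U. p x \<in> A})"
proof -
  let ?P = "\<lambda>A. A \<subseteq> X \<and> (\<forall>k U p. D k U p \<longrightarrow> openin (\<R> k) {x\<in>U. p x \<in> A})"
  have "?P (A \<inter> B)" if "?P A" "?P B" for A B
  proof -
    have "{x\<in>U. p x \<in> A \<inter> B} = {x\<in>U. p x \<in> A} \<inter> {x\<in>U. p x \<in> B}"
      for U and p :: "(nat \<Rightarrow> real) \<Rightarrow> 'a" by blast
    with that show ?thesis by (auto intro: openin_Int)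
  qed
  moreover have "?P (\<Union>\<K>)" if "\<forall>K\<in>\<K>. ?P K" for \<K>
  proof -
    have "{x\<in>U. p x \<in> \<Union>\<K>} = (\<Union>K\<in>\<K>. {x\<in>U. p x \<in> K})"
      for U and p :: "(nat \<Rightarrow> real) \<Rightarrow> 'a" by blast
    with that show ?thesis by (auto intro!: openin_Union)
  qed
  ultimately have "istopology ?P"
    unfolding istopology_def by blast
  then show ?thesis
    unfolding D_topology_def by (simp add: topology_inverse')
qed

definition subset_diffeology :: "'a diffeology \<Rightarrow> 'a set \<Rightarrow> 'a diffeology" where
  "subset_diffeology D S k U p \<longleftrightarrow> D k U p \<and> p \<in> U \<rightarrow> S"

text \<open>The diffeology on \<open>X // r\<close>, where \<open>r\<close> is an equivalence relation on \<open>X\<close>.\<close>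

definition quotient_diffeology :: "'a diffeology \<Rightarrow> ('a \<times> 'a) set \<Rightarrow> 'a set diffeology" where
  "quotient_diffeology D r k U p \<longleftrightarrow>
     openin (\<R> k) U \<and>
     (\<forall>x\<in>U. \<exists>V q. openin (\<R> k) V \<and> x \<in> V \<and> V \<subseteq> U \<and> D k V q \<and> (\<forall>y\<in>V. p y = r `` {q y}))"

definition Cartesian_diffeology :: "nat \<Rightarrow> (nat \<Rightarrow> real) diffeology" where
  "Cartesian_diffeology n k U p \<longleftrightarrow> smooth_map k U n p"


section \<open>Diffeological quasifolds\<close>

text \<open>Elements of \<open>Aff n\<close> are undefined outside \<open>\<R> n\<close>, as is customary for \<open>BijGroup\<close>.
  Bijectivity makes the matrix \<open>A\<close> invertible.\<close>

definition Aff :: "nat \<Rightarrow> ((nat \<Rightarrow> real) \<Rightarrow> (nat \<Rightarrow> real)) monoid" where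
  "Aff n = BijGroup (topspace (\<R> n))
     \<lparr>carrier := {g \<in> Bij (topspace (\<R> n)). \<exists>A :: nat \<Rightarrow> nat \<Rightarrow> real. \<exists>b :: nat \<Rightarrow> real.
        \<forall>x \<in> topspace (\<R> n). \<forall>i<n. g x i = (\<Sum>j<n. A i j * x j) + b i}\<rparr>"

definition orbit_relation :: "('a \<Rightarrow> 'a) set \<Rightarrow> 'a set \<Rightarrow> ('a \<times> 'a) set" where
  "orbit_relation \<Gamma> V = {(x, y). x \<in> V \<and> y \<in> V \<and> (\<exists>g\<in>\<Gamma>. y = g x)}"

definition diffeological_quasifold :: "nat \<Rightarrow> 'a set \<Rightarrow> 'a diffeology \<Rightarrow> bool" where
  "diffeological_quasifold n X D \<longleftrightarrow>
     diffeological_space X D \<and>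
     second_countable (D_topology X D) \<and>
     (\<forall>x\<in>X. \<exists>U \<Gamma> V F.
        openin (D_topology X D) U \<and> x \<in> U \<and>
        subgroup \<Gamma> (Aff n) \<and> countable \<Gamma> \<and>
        openin (\<R> n) V \<and> (\<forall>g\<in>\<Gamma>. g ` V \<subseteq> V) \<and>
        diffeomorphism U (subset_diffeology D U)
          (V // orbit_relation \<Gamma> V)
          (quotient_diffeology (subset_diffeology (Cartesian_diffeology n) V) (orbit_relation \<Gamma> V))
          F)"


section \<open>Manifolds\<close>

type_synonym 'a chart = "'a set \<times> ('a \<Rightarrow> (nat \<Rightarrow> real))"

definition is_chart :: "nat \<Rightarrow> 'a topology \<Rightarrow> 'a chart \<Rightarrow> bool" where
  "is_chart m T = (\<lambda>(W, \<phi>). openin T W \<and> openin (\<R> m) (\<phi> ` W) \<and>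
     homeomorphic_map (subtopology T W) (subtopology (\<R> m) (\<phi> ` W)) \<phi>)"

definition transition :: "'a chart \<Rightarrow> 'a chart \<Rightarrow> (nat \<Rightarrow> real) \<Rightarrow> (nat \<Rightarrow> real)" where
  "transition = (\<lambda>(W, \<phi>) (W', \<phi>'). \<phi>' \<circ> inv_into W \<phi>)"

definition overlap :: "'a chart \<Rightarrow> 'a chart \<Rightarrow> (nat \<Rightarrow> real) set" where
  "overlap = (\<lambda>(W, \<phi>) (W', \<phi>'). \<phi> ` (W \<inter> W'))"

definition compatible :: "nat \<Rightarrow> 'a chart \<Rightarrow> 'a chart \<Rightarrow> bool" where
  "compatible m c c' \<longleftrightarrow>
     smooth_map m (overlap c c') m (transition c c') \<and>
     smooth_map m (overlap c' c) m (transition c' c)"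

definition smooth_atlas :: "nat \<Rightarrow> 'a topology \<Rightarrow> 'a chart set \<Rightarrow> bool" where
  "smooth_atlas m T A \<longleftrightarrow>
     (\<forall>c\<in>A. is_chart m T c) \<and> (\<Union>c\<in>A. fst c) = topspace T \<and> (\<forall>c\<in>A. \<forall>c'\<in>A. compatible m c c')"

text \<open>
  The atlas need not be maximal; it determines the smooth structure. Every second-countable
  Hausdorff manifold has at most continuum many points, so up to diffeomorphism all manifolds
  occur with point type \<open>nat \<Rightarrow> real\<close>.
\<close>

definition manifold :: "nat \<Rightarrow> 'a topology \<Rightarrow> 'a chart set \<Rightarrow> bool" where
  "manifold m T A \<longleftrightarrow> Hausdorff_space T \<and> second_countable T \<and> smooth_atlas m T A"

definition manifold_diffeology ::
    "nat \<Rightarrow> 'a topology \<Rightarrow> 'a chart set \<Rightarrow> 'a diffeology" where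
  "manifold_diffeology m T A k U p \<longleftrightarrow>
     openin (\<R> k) U \<and> continuous_map (subtopology (\<R> k) U) T p \<and>
     (\<forall>(W, \<phi>)\<in>A. smooth_map k {x\<in>U. p x \<in> W} m (\<phi> \<circ> p))"


section \<open>Foliations and leaf spaces\<close>

text \<open>
  Identify \<open>\<R> m\<close> with \<open>\<R> p \<times> \<R> (m - p)\<close>; \<open>transverse p\<close> is the projection to the second factor.
\<close>

definition transverse :: "nat \<Rightarrow> (nat \<Rightarrow> real) \<Rightarrow> (nat \<Rightarrow> real)" where
  "transverse p x = (\<lambda>i. x (p + i))"

text \<open>
  A regular foliation of dimension \<open>p\<close> of the manifold \<open>(T, A)\<close> is given by a foliation atlas \<open>\<F>\<close>:
  an atlas for the same smooth structure whose transition maps are locally of the form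
  \<open>(x, y) \<mapsto> (g x y, h y)\<close>. As with smooth structures, the atlas need not be maximal; enlarging it
  to the maximal foliation atlas does not change the leaves.
\<close>

definition foliation ::
    "nat \<Rightarrow> nat \<Rightarrow> 'a topology \<Rightarrow> 'a chart set \<Rightarrow> 'a chart set \<Rightarrow> bool" where
  "foliation p m T A \<F> \<longleftrightarrow>
     p \<le> m \<and> smooth_atlas m T \<F> \<and> (\<forall>c\<in>\<F>. \<forall>a\<in>A. compatible m c a) \<and>
     (\<forall>c\<in>\<F>. \<forall>c'\<in>\<F>. \<forall>z \<in> overlap c c'. \<exists>N h.
        openin (\<R> m) N \<and> z \<in> N \<and> N \<subseteq> overlap c c' \<and>
        (\<forall>w\<in>N. transverse p (transition c c' w) = h (transverse p w)))"

text \<open>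
  The plaques of a chart are the connected components of the level sets of its transverse
  coordinates. The leaves are the classes of the equivalence relation generated by lying in a
  common plaque.
\<close>

definition same_plaque :: "nat \<Rightarrow> 'a topology \<Rightarrow> 'a chart set \<Rightarrow> 'a \<Rightarrow> 'a \<Rightarrow> bool" where
  "same_plaque p T \<F> x y \<longleftrightarrow>
     (\<exists>(W, \<phi>)\<in>\<F>. \<exists>c.
        connected_component_of (subtopology T {z\<in>W. transverse p (\<phi> z) = c}) x y)"

definition leaf_relation :: "nat \<Rightarrow> 'a topology \<Rightarrow> 'a chart set \<Rightarrow> ('a \<times> 'a) set" where
  "leaf_relation p T \<F> = {(x, y). x \<in> topspace T \<and> (same_plaque p T \<F>)\<^sup>*\<^sup>* x y}"

definition leaf_space :: "nat \<Rightarrow> 'a topology \<Rightarrow> 'a chart set \<Rightarrow> 'a set set" where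
  "leaf_space p T \<F> = topspace T // leaf_relation p T \<F>"

definition leaf_space_diffeology ::
    "nat \<Rightarrow> nat \<Rightarrow> 'a topology \<Rightarrow> 'a chart set \<Rightarrow> 'a chart set \<Rightarrow> 'a set diffeology" where
  "leaf_space_diffeology p m T A \<F> =
     quotient_diffeology (manifold_diffeology m T A) (leaf_relation p T \<F>)"

end

theory Submission
  imports Defs
begin

text \<open>
  Let \<open>\<pi> i : V i \<rightarrow> X\<close> be countably many quasifold charts. Two points with the same image in \<open>X\<close> are
  related by a local diffeomorphism over \<open>X\<close>: lifts of the charts through each other compose to
  smooth maps that pointwise agree with elements of a countable affine group, and such a map is
  affine. Countably many local diffeomorphisms \<open>h k : A k \<rightarrow> V (dst k)\<close>, \<open>A k \<subseteq> V (src k)\<close>, suffice to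
  generate the equivalence relation.

  They are realised as the holonomy of a foliation with two-dimensional leaves. Start with the
  sheets \<open>P \<times> V i\<close>, where \<open>P\<close> is the plane minus a vertical slit above each point \<open>(k, 0)\<close>, and
  attach handles: strips around the \<open>k\<close>-th slit, times \<open>A k\<close>, whose left half is identified with
  part of the sheet \<open>src k\<close>, and whose right half with part of the sheet \<open>dst k\<close> by means of \<open>h k\<close>.
  The coordinates of \<open>P\<close> are globally defined on the result, and the points over a given
  point of the plane all lie on sheets or all lie on one handle; so the manifold is Hausdorff.
\<close>

text \<open>\<open>X\<close> may fail to be Hausdorff, and the local diffeomorphisms live only on
  open sets \<open>A k\<close>. Gluing sheets to each other along \<open>A k\<close> would in
  general destroy the Hausdorff property at the boundary of \<open>A k\<close>, and there is no
  global group action whose suspension could be taken. Slits avoid this: no sheet is ever identified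
  with another sheet. A handle fills in an open slit, touching its source from the left and its
  target from the right; limits that would be lost at the boundary of \<open>A k\<close> would have
  to lie over the slit, where sheets have no points. The end point \<open>(k, 0)\<close> stays
  missing, so that crossing the slit above it realises \<open>h k\<close>, while passing below it
  changes nothing. This is why leaves have dimension two: a line cut at a point falls apart, but a
  plane whose slits all point upwards stays connected. Affine maps matter through their rigidity: a
  smooth map that moves each point inside its orbit could a priori use different group elements at
  different points, but an affine map is determined by its restriction to any nonempty open
  set.\<close>

section \<open>Cartesian spaces as subspaces of a product; cubes as basic neighbourhoods\<close>

lemma Euclidean_space_eq: "\<R> n = top_of_set (topspace (\<R> n))"
  by (simp add: Euclidean_space_def euclidean_product_topology)

lemma openin_Euclidean_iff: "openin (\<R> n) U \<longleftrightarrow> (\<exists>S. open S \<and> U = topspace (\<R> n) \<inter> S)"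
  by (subst Euclidean_space_eq) (simp add: openin_open)

text \<open>Balls of the maximum norm. Changing the coordinates of one point of a cube one by one
  into those of another never leaves the cube, which suits arguments with partial
  derivatives.\<close>

definition cube :: "nat \<Rightarrow> (nat \<Rightarrow> real) \<Rightarrow> real \<Rightarrow> (nat \<Rightarrow> real) set" where
  "cube n c r = {x \<in> topspace (\<R> n). \<forall>i<n. \<bar>x i - c i\<bar> < r}"

lemma continuous_on_coord: "continuous_on S (\<lambda>x::nat \<Rightarrow> real. x i)"
  by (rule continuous_on_product_then_coordinatewise) (rule continuous_on_id)

lemma open_strip: "open {x::nat \<Rightarrow> real. \<bar>x i - c\<bar> < r}"
  by (intro open_Collect_less continuous_intros continuous_on_coord)

lemma openin_cube: "openin (\<R> n) (cube n c r)"
proof -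
  have "open (\<Inter>i\<in>{..<n}. {x::nat \<Rightarrow> real. \<bar>x i - c i\<bar> < r})"
    by (intro open_INT ballI open_strip) auto
  moreover have "cube n c r = topspace (\<R> n) \<inter> (\<Inter>i\<in>{..<n}. {x. \<bar>x i - c i\<bar> < r})"
    by (auto simp: cube_def)
  ultimately show ?thesis
    using openin_Euclidean_iff by blast
qed

lemma centre_in_cube: "c \<in> topspace (\<R> n) \<Longrightarrow> 0 < r \<Longrightarrow> c \<in> cube n c r"
  by (simp add: cube_def)

text \<open>A basic open set of the infinite product restricts each coordinate separately. From
  index \<open>n\<close> on all points of \<open>\<R> n\<close> have coordinate 0, so only the first
  \<open>n\<close> radii count and their minimum is positive.\<close>

lemma open_contains_cube:
  assumes "openin (\<R> n) U" "c \<in> U"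
  obtains r where "r > 0" "cube n c r \<subseteq> U"
proof -
  obtain S where S: "open S" "U = topspace (\<R> n) \<inter> S"
    using assms(1) openin_Euclidean_iff by blast
  have c0: "c i = 0" if "i \<ge> n" for i
    using that assms(2) S(2) by (auto simp: topspace_Euclidean_space)
  have "openin (product_topology (\<lambda>i. euclideanreal) UNIV) S" "c \<in> S"
    using S assms(2) by (simp_all add: euclidean_product_topology)
  then obtain X where X: "c \<in> (\<Pi>\<^sub>E i\<in>UNIV. X i)" "\<forall>i. open (X i)" "(\<Pi>\<^sub>E i\<in>UNIV. X i) \<subseteq> S"
    by (rule product_topology_open_contains_basis[elim_format]) (auto simp: PiE_iff)
  have "\<exists>r>0. \<forall>t. \<bar>t - c i\<bar> < r \<longrightarrow> t \<in> X i" for i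
    using X(1) X(2)[rule_format, of i] by (auto simp: PiE_iff open_dist dist_real_def)
  then obtain \<rho> where \<rho>: "\<And>i. \<rho> i > 0" "\<And>i t. \<bar>t - c i\<bar> < \<rho> i \<Longrightarrow> t \<in> X i"
    by metis
  \<comment> \<open>The 1 keeps the set nonempty when \<open>n = 0\<close>.\<close>
  define r where "r = Min (insert 1 (\<rho> ` {..<n}))"
  have r: "r > 0" "\<And>i. i < n \<Longrightarrow> r \<le> \<rho> i"
    by (auto simp: r_def \<rho>(1) Min_gr_iff)
  have "x \<in> U" if x: "x \<in> cube n c r" for x
  proof -
    have "x i \<in> X i" for i
    proof (cases "i < n")
      case True
      then show ?thesis using x r(2)[of i] \<rho>(2)[of "x i" i] by (force simp: cube_def)
    next
      case False
      then show ?thesis using x c0[of i] \<rho>(2)[of "c i" i] \<rho>(1)[of i]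
        by (auto simp: cube_def topspace_Euclidean_space)
    qed
    then show ?thesis
      using X(3) x S(2) by (auto simp: cube_def PiE_iff)
  qed
  then show thesis using that r(1) by blast
qed

lemma continuous_map_Euclidean_on:
  assumes "U \<subseteq> topspace (\<R> m)"
  shows "continuous_map (subtopology (\<R> m) U) euclidean f \<longleftrightarrow> continuous_on U f"
  using assms
  by (subst Euclidean_space_eq) (simp add: subtopology_subtopology Int_absorb1)

lemma openin_continuous_on:
  assumes "openin (\<R> m) U" "continuous_on U f" "open S"
  shows "openin (\<R> m) {x\<in>U. f x \<in> S}"
proof -
  have "openin (top_of_set U) (U \<inter> f -` S)"
    using assms continuous_openin_preimage_gen by blast
  then have "openin (\<R> m) (U \<inter> f -` S)"
  proof -
    obtain S0 S1 where "open S0" "U = topspace (\<R> m) \<inter> S0" "open S1" "U \<inter> f -` S = U \<inter> S1"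
      using assms(1) \<open>openin (top_of_set U) (U \<inter> f -` S)\<close> openin_Euclidean_iff openin_open by metis
    then have "open (S0 \<inter> S1)" "U \<inter> f -` S = topspace (\<R> m) \<inter> (S0 \<inter> S1)" by auto
    then show ?thesis using openin_Euclidean_iff by blast
  qed
  moreover have "U \<inter> f -` S = {x\<in>U. f x \<in> S}" by auto
  ultimately show ?thesis by simp
qed

section \<open>Calculus of iterated partial derivatives\<close>

declare Ck.simps [simp del]

lemma Ck_imp_continuous: "openin (\<R> m) U \<Longrightarrow> Ck r m U f \<Longrightarrow> continuous_on U f"
  by (cases r) (auto simp: Ck.simps continuous_map_Euclidean_on openin_subset)

lemma Ck_SucI:
  assumes "openin (\<R> m) U" "continuous_on U f"
    and "\<And>i. i < m \<Longrightarrow> \<exists>g. (\<forall>x\<in>U. ((\<lambda>t. f (x(i := t))) has_real_derivative g x) (at (x i))) \<and> Ck r m U g"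
  shows "Ck (Suc r) m U f"
  using assms by (simp add: Ck.simps continuous_map_Euclidean_on openin_subset)

lemma Ck_0I: "openin (\<R> m) U \<Longrightarrow> continuous_on U f \<Longrightarrow> Ck 0 m U f"
  by (simp add: Ck.simps continuous_map_Euclidean_on openin_subset)

lemma Ck_SucD: "Ck (Suc r) m U f \<Longrightarrow> i < m \<Longrightarrow>
    \<exists>g. (\<forall>x\<in>U. ((\<lambda>t. f (x(i := t))) has_real_derivative g x) (at (x i))) \<and> Ck r m U g"
  by (simp add: Ck.simps)

lemma eventually_upd_in:
  assumes "openin (\<R> m) U" "x \<in> U" "i < m"
  shows "eventually (\<lambda>t. x(i := t) \<in> U) (nhds (x i))"
proof -
  obtain r where r: "r > 0" "cube m x r \<subseteq> U"
    using open_contains_cube assms by blast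
  have "x(i := t) \<in> U" if "dist t (x i) < r" for t
  proof -
    have "x \<in> topspace (\<R> m)" using assms openin_subset by blast
    then have "x(i := t) \<in> cube m x r"
      using that r(1) assms(3) by (auto simp: cube_def dist_real_def topspace_Euclidean_space)
    then show ?thesis using r by blast
  qed
  then show ?thesis using r(1) eventually_nhds_metric by blast
qed

lemma partial_derivative_cong:
  assumes "openin (\<R> m) U" "x \<in> U" "i < m" "\<forall>x\<in>U. f x = g x"
    and "((\<lambda>t. f (x(i := t))) has_real_derivative d) (at (x i))"
  shows "((\<lambda>t. g (x(i := t))) has_real_derivative d) (at (x i))"
proof -
  have "eventually (\<lambda>t. f (x(i := t)) = g (x(i := t))) (nhds (x i))"
    using eventually_upd_in[OF assms(1-3)] by eventually_elim (use assms(4) in auto)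
  from DERIV_cong_ev[OF refl this refl, THEN iffD1, OF assms(5)] show ?thesis .
qed

text \<open>No induction: the partial derivatives of \<open>f\<close> on \<open>U\<close> serve for
  \<open>g\<close> unchanged.\<close>

lemma Ck_cong:
  assumes "openin (\<R> m) U" "\<forall>x\<in>U. f x = g x" "Ck r m U f"
  shows "Ck r m U g"
proof (cases r)
  case 0
  then show ?thesis using assms Ck_imp_continuous Ck_0I by (metis continuous_on_eq)
next
  case (Suc s)
  show ?thesis unfolding Suc
  proof (rule Ck_SucI[OF assms(1)])
    show "continuous_on U g"
      using assms Ck_imp_continuous by (metis continuous_on_eq)
    fix i assume i: "i < m"
    then obtain d where d: "\<forall>x\<in>U. ((\<lambda>t. f (x(i := t))) has_real_derivative d x) (at (x i))" "Ck s m U d"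
      using Ck_SucD assms(3) Suc by blast
    then show "\<exists>d. (\<forall>x\<in>U. ((\<lambda>t. g (x(i := t))) has_real_derivative d x) (at (x i))) \<and> Ck s m U d"
      using partial_derivative_cong[OF assms(1) _ i assms(2)] by blast
  qed
qed

lemma Ck_subset:
  assumes "openin (\<R> m) U" "openin (\<R> m) U'" "U' \<subseteq> U" "Ck r m U f"
  shows "Ck r m U' f"
  using assms(4)
proof (induction r arbitrary: f)
  case 0
  then show ?case using assms Ck_imp_continuous Ck_0I continuous_on_subset by metis
next
  case (Suc r)
  show ?case
  proof (rule Ck_SucI[OF assms(2)])
    show "continuous_on U' f"
      using Suc.prems assms Ck_imp_continuous continuous_on_subset by metis
    fix i assume "i < m"
    then show "\<exists>g. (\<forall>x\<in>U'. ((\<lambda>t. f (x(i := t))) has_real_derivative g x) (at (x i))) \<and> Ck r m U' g"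
    proof -
      obtain g where "\<forall>x\<in>U. ((\<lambda>t. f (x(i := t))) has_real_derivative g x) (at (x i))" "Ck r m U g"
        using Ck_SucD[OF Suc.prems \<open>i < m\<close>] by blast
      then show ?thesis using Suc.IH assms(3) by (intro exI[of _ g]) blast
    qed
  qed
qed

lemma openin_top_of_subset:
  assumes "openin (\<R> m) V" "openin (\<R> m) U" "V \<subseteq> U"
  shows "openin (top_of_set U) V"
proof -
  obtain S where S: "open S" "V = topspace (\<R> m) \<inter> S"
    using assms(1) openin_Euclidean_iff by blast
  then have "V = U \<inter> S" using assms(2,3) openin_subset by blast
  then show ?thesis using S(1) openin_open by blast
qed

lemma continuous_on_local:
  assumes "openin (\<R> m) U"
    and "\<And>x. x \<in> U \<Longrightarrow> \<exists>V. openin (\<R> m) V \<and> x \<in> V \<and> V \<subseteq> U \<and> continuous_on V f"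
  shows "continuous_on U f"
proof -
  have "openin (top_of_set U) (U \<inter> f -` S)" if S: "open S" for S
  proof (rule openin_top_of_subset[OF _ assms(1)])
    have "\<exists>T. openin (\<R> m) T \<and> x \<in> T \<and> T \<subseteq> U \<inter> f -` S" if x: "x \<in> U \<inter> f -` S" for x
    proof -
      obtain V where V: "openin (\<R> m) V" "x \<in> V" "V \<subseteq> U" "continuous_on V f"
        using assms(2) x by blast
      then show ?thesis
        using openin_continuous_on[OF V(1,4) S] x by (intro exI[of _ "{y\<in>V. f y \<in> S}"]) auto
    qed
    then show "openin (\<R> m) (U \<inter> f -` S)" by (subst openin_subopen) blast
  qed auto
  then show ?thesis by (simp add: continuous_openin_preimage_eq)
qed

lemma Ck_local:
  assumes "openin (\<R> m) U"
    and "\<And>x. x \<in> U \<Longrightarrow> \<exists>V. openin (\<R> m) V \<and> x \<in> V \<and> V \<subseteq> U \<and> Ck r m V f"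
  shows "Ck r m U f"
  using assms(2)
proof (induction r arbitrary: f)
  case (0 f)
  have "continuous_on U f"
  proof (rule continuous_on_local[OF assms(1)])
    fix x assume "x \<in> U"
    then obtain V where "openin (\<R> m) V" "x \<in> V" "V \<subseteq> U" "Ck 0 m V f" using 0 by blast
    then show "\<exists>V. openin (\<R> m) V \<and> x \<in> V \<and> V \<subseteq> U \<and> continuous_on V f"
      using Ck_imp_continuous by (intro exI[of _ V]) auto
  qed
  then show ?case using Ck_0I assms(1) by blast
next
  case (Suc r f)
  have loc: "\<exists>V. openin (\<R> m) V \<and> x \<in> V \<and> V \<subseteq> U \<and> Ck (Suc r) m V f" if "x \<in> U" for x
    using Suc.prems that .
  have cont: "continuous_on U f"
  proof (rule continuous_on_local[OF assms(1)])
    fix x assume "x \<in> U"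
    then obtain V where "openin (\<R> m) V" "x \<in> V" "V \<subseteq> U" "Ck (Suc r) m V f" using loc by blast
    then show "\<exists>V. openin (\<R> m) V \<and> x \<in> V \<and> V \<subseteq> U \<and> continuous_on V f"
      using Ck_imp_continuous by (intro exI[of _ V]) auto
  qed
  show ?case
  proof (rule Ck_SucI[OF assms(1) cont])
    fix i assume i: "i < m"
    \<comment> \<open>The derivatives supplied on different neighbourhoods are unrelated functions.
      By uniqueness of derivatives each of them agrees on its neighbourhood with this one global
      function, to which the induction hypothesis applies.\<close>
    define g where "g x = deriv (\<lambda>t. f (x(i := t))) (x i)" for x
    have key: "\<exists>V. openin (\<R> m) V \<and> x \<in> V \<and> V \<subseteq> U \<and> Ck r m V g \<and>
        ((\<lambda>t. f (x(i := t))) has_real_derivative g x) (at (x i))" if x: "x \<in> U" for x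
    proof -
      obtain V where V: "openin (\<R> m) V" "x \<in> V" "V \<subseteq> U" "Ck (Suc r) m V f" using loc x by blast
      obtain d where d: "\<forall>x\<in>V. ((\<lambda>t. f (x(i := t))) has_real_derivative d x) (at (x i))" "Ck r m V d"
        using Ck_SucD V(4) i by blast
      have eq: "\<forall>x\<in>V. d x = g x"
      proof
        fix x assume "x \<in> V"
        then show "d x = g x" using DERIV_imp_deriv d(1) unfolding g_def by (intro DERIV_imp_deriv[symmetric]) blast
      qed
      then have "((\<lambda>t. f (x(i := t))) has_real_derivative g x) (at (x i))" using d(1) V(2) by metis
      then show ?thesis using V(1-3) Ck_cong[OF V(1) eq d(2)] by (intro exI[of _ V]) auto
    qed
    have "Ck r m U g"
    proof (rule Suc.IH)
      show "\<exists>V. openin (\<R> m) V \<and> x \<in> V \<and> V \<subseteq> U \<and> Ck r m V g" if "x \<in> U" for x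
        using key[OF that] by (elim exE conjE) (intro exI conjI)
    qed
    then show "\<exists>g. (\<forall>x\<in>U. ((\<lambda>t. f (x(i := t))) has_real_derivative g x) (at (x i))) \<and> Ck r m U g"
      using key by (intro exI[of _ g]) blast
  qed
qed

lemma Ck_Suc_imp: "openin (\<R> m) U \<Longrightarrow> Ck (Suc r) m U f \<Longrightarrow> Ck r m U f"
proof (induction r arbitrary: f)
  case 0
  then show ?case using Ck_imp_continuous Ck_0I by metis
next
  case (Suc r)
  show ?case
  proof (rule Ck_SucI[OF Suc.prems(1) Ck_imp_continuous[OF Suc.prems]])
    fix i assume "i < m"
    then show "\<exists>g. (\<forall>x\<in>U. ((\<lambda>t. f (x(i := t))) has_real_derivative g x) (at (x i))) \<and> Ck r m U g"
      using Ck_SucD[OF Suc.prems(2)] Suc.IH Suc.prems(1) by blast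
  qed
qed

lemma Ck_const: "openin (\<R> m) U \<Longrightarrow> Ck r m U (\<lambda>x. c)"
proof (induction r arbitrary: c)
  case 0
  then show ?case by (simp add: Ck_0I)
next
  case (Suc r)
  show ?case
  proof (rule Ck_SucI[OF Suc.prems])
    show "\<exists>g. (\<forall>x\<in>U. ((\<lambda>t. c) has_real_derivative g x) (at (x i))) \<and> Ck r m U g" if "i < m" for i
      by (rule exI[of _ "\<lambda>x. 0"]) (use Suc in auto)
  qed auto
qed

lemma Ck_coord: "openin (\<R> m) U \<Longrightarrow> Ck r m U (\<lambda>x. x j)"
proof (induction r)
  case 0
  then show ?case by (simp add: Ck_0I continuous_on_coord)
next
  case (Suc r)
  show ?case
  proof (rule Ck_SucI[OF Suc.prems continuous_on_coord])
    show "\<exists>g. (\<forall>x\<in>U. ((\<lambda>t. (x(i := t)) j) has_real_derivative g x) (at (x i))) \<and> Ck r m U g" if "i < m" for i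
      by (rule exI[of _ "\<lambda>x. if i = j then 1 else 0"]) (use Suc in \<open>auto simp: Ck_const\<close>)
  qed
qed

lemma Ck_add:
  "openin (\<R> m) U \<Longrightarrow> Ck r m U f \<Longrightarrow> Ck r m U g \<Longrightarrow> Ck r m U (\<lambda>x. f x + g x)"
proof (induction r arbitrary: f g)
  case 0
  then show ?case by (intro Ck_0I continuous_on_add) (auto intro: Ck_imp_continuous)
next
  case (Suc r)
  show ?case
  proof (rule Ck_SucI[OF Suc.prems(1)])
    show "continuous_on U (\<lambda>x. f x + g x)"
      using Suc.prems by (intro continuous_on_add) (auto intro: Ck_imp_continuous)
    fix i assume i: "i < m"
    obtain f' where f': "\<forall>x\<in>U. ((\<lambda>t. f (x(i := t))) has_real_derivative f' x) (at (x i))" "Ck r m U f'"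
      using Ck_SucD[OF Suc.prems(2) i] by blast
    obtain g' where g': "\<forall>x\<in>U. ((\<lambda>t. g (x(i := t))) has_real_derivative g' x) (at (x i))" "Ck r m U g'"
      using Ck_SucD[OF Suc.prems(3) i] by blast
    show "\<exists>d. (\<forall>x\<in>U. ((\<lambda>t. f (x(i := t)) + g (x(i := t))) has_real_derivative d x) (at (x i))) \<and> Ck r m U d"
      by (rule exI[of _ "\<lambda>x. f' x + g' x"]) (use f' g' Suc in \<open>auto intro!: DERIV_add\<close>)
  qed
qed

lemma Ck_mult:
  "openin (\<R> m) U \<Longrightarrow> Ck r m U f \<Longrightarrow> Ck r m U g \<Longrightarrow> Ck r m U (\<lambda>x. f x * g x)"
proof (induction r arbitrary: f g)
  case 0
  then show ?case by (intro Ck_0I continuous_on_mult) (auto intro: Ck_imp_continuous)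
next
  case (Suc r)
  show ?case
  proof (rule Ck_SucI[OF Suc.prems(1)])
    show "continuous_on U (\<lambda>x. f x * g x)"
      using Suc.prems by (intro continuous_on_mult) (auto intro: Ck_imp_continuous)
    fix i assume i: "i < m"
    obtain f' where f': "\<forall>x\<in>U. ((\<lambda>t. f (x(i := t))) has_real_derivative f' x) (at (x i))" "Ck r m U f'"
      using Ck_SucD[OF Suc.prems(2) i] by blast
    obtain g' where g': "\<forall>x\<in>U. ((\<lambda>t. g (x(i := t))) has_real_derivative g' x) (at (x i))" "Ck r m U g'"
      using Ck_SucD[OF Suc.prems(3) i] by blast
    have "((\<lambda>t. f (x(i := t)) * g (x(i := t))) has_real_derivative f x * g' x + g x * f' x) (at (x i))"
      if "x \<in> U" for x
    proof -
      have "((\<lambda>t. f (x(i := t)) * g (x(i := t))) has_real_derivative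
          f' x * g (x(i := x i)) + g' x * f (x(i := x i))) (at (x i))"
        using that f' g' by (intro DERIV_mult) auto
      then show ?thesis by (simp add: algebra_simps)
    qed
    \<comment> \<open>The product rule brings back \<open>f\<close> and \<open>g\<close> themselves,
      here at the lower order \<open>r\<close>.\<close>
    moreover have "Ck r m U (\<lambda>x. f x * g' x + g x * f' x)"
      using Suc f' g' by (intro Ck_add) (auto intro: Ck_Suc_imp)
    ultimately
    show "\<exists>d. (\<forall>x\<in>U. ((\<lambda>t. f (x(i := t)) * g (x(i := t))) has_real_derivative d x) (at (x i))) \<and> Ck r m U d"
      by (intro exI[of _ "\<lambda>x. f x * g' x + g x * f' x"]) simp
  qed
qed

lemma Ck_sum:
  fixes k :: nat
  assumes "openin (\<R> m) U" "\<And>j. j < k \<Longrightarrow> Ck r m U (f j)"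
  shows "Ck r m U (\<lambda>x. \<Sum>j<k. f j x)"
  using assms(2)
proof (induct k)
  case 0
  then show ?case using Ck_const[OF assms(1)] by simp
next
  case (Suc k)
  then have "Ck r m U (\<lambda>x. (\<Sum>j<k. f j x) + f k x)" by (intro Ck_add assms(1)) auto
  then show ?case by simp
qed

section \<open>The chain rule for functions with continuous partial derivatives\<close>

text \<open>The increment of \<open>h\<close> may vanish, so it is never divided by. The bound is
  divided by \<open>t - t0\<close> instead, and the difference quotient of \<open>h\<close>
  eventually stays below \<open>|d| + 1\<close>.\<close>

lemma DERIV_of_linear_bound:
  fixes F h :: "real \<Rightarrow> real"
  assumes h: "(h has_real_derivative d) (at t0)" and F0: "F t0 = 0"
    and bd: "\<And>e. e > 0 \<Longrightarrow> eventually (\<lambda>t. \<bar>F t - a * (h t - h t0)\<bar> \<le> e * \<bar>h t - h t0\<bar>) (at t0)"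
  shows "(F has_real_derivative a * d) (at t0)"
proof -
  let ?Q = "\<lambda>t. (h t - h t0) / (t - t0)"
  have Q: "(?Q \<longlongrightarrow> d) (at t0)" using h by (simp add: has_field_derivative_iff)
  have "((\<lambda>t. F t / (t - t0) - a * ?Q t) \<longlongrightarrow> 0) (at t0)"
  proof (rule tendstoI)
    fix e :: real assume e: "e > 0"
    define e' where "e' = e / (\<bar>d\<bar> + 1)"
    have e': "e' > 0" using e by (simp add: e'_def add_nonneg_pos)
    have "((\<lambda>t. \<bar>?Q t\<bar>) \<longlongrightarrow> \<bar>d\<bar>) (at t0)" using Q by (rule tendsto_rabs)
    then have "eventually (\<lambda>t. \<bar>?Q t\<bar> < \<bar>d\<bar> + 1) (at t0)" by (rule order_tendstoD) simp
    moreover have "eventually (\<lambda>t. t \<noteq> t0) (at t0)" by (simp add: eventually_at_filter)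
    ultimately show "eventually (\<lambda>t. dist (F t / (t - t0) - a * ?Q t) 0 < e) (at t0)"
      using bd[OF e']
    proof eventually_elim
      case (elim t)
      have "\<bar>F t / (t - t0) - a * ?Q t\<bar> = \<bar>F t - a * (h t - h t0)\<bar> / \<bar>t - t0\<bar>"
        by (simp add: diff_divide_distrib right_diff_distrib flip: abs_divide)
      also have "\<dots> \<le> e' * \<bar>h t - h t0\<bar> / \<bar>t - t0\<bar>"
        using elim by (simp add: divide_right_mono)
      also have "\<dots> = e' * \<bar>?Q t\<bar>" by (simp add: abs_divide)
      also have "\<dots> < e' * (\<bar>d\<bar> + 1)" using elim(1) e' by (rule mult_strict_left_mono)
      also have "\<dots> = e" by (simp add: e'_def add_nonneg_eq_0_iff)
      finally show ?case by simp
    qed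
  qed
  then have "((\<lambda>t. (F t / (t - t0) - a * ?Q t) + a * ?Q t) \<longlongrightarrow> 0 + a * d) (at t0)"
    by (intro tendsto_add tendsto_mult tendsto_const Q)
  then show ?thesis using F0 by (simp add: has_field_derivative_iff)
qed

text \<open>The coordinates of the curve are switched on one at a time. Stage \<open>l\<close>
  changes \<open>f\<close> only in direction \<open>l\<close>, where the mean value theorem and the
  continuity of \<open>G l\<close> apply; the stages telescope. Since \<open>y t\<close> lies in
  \<open>\<R> k\<close>, its coordinates from \<open>k\<close> on vanish and the last stage is
  \<open>y t\<close> itself.\<close>

lemma chain_rule_curve:
  assumes V: "openin (\<R> k) V" and y0: "y t0 \<in> V"
    and yt: "eventually (\<lambda>t. y t \<in> topspace (\<R> k)) (nhds t0)"
    and G: "\<And>j x. j < k \<Longrightarrow> x \<in> V \<Longrightarrow> ((\<lambda>t. f (x(j := t))) has_real_derivative G j x) (at (x j))"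
    and Gc: "\<And>j. j < k \<Longrightarrow> continuous_on V (G j)"
    and d: "\<And>j. j < k \<Longrightarrow> ((\<lambda>t. y t j) has_real_derivative d j) (at t0)"
  shows "((\<lambda>t. f (y t)) has_real_derivative (\<Sum>j<k. G j (y t0) * d j)) (at t0)"
proof -
  define c where "c = y t0"
  define z where "z l t = (\<lambda>j. if j < l then y t j else c j)" for l t
  have ctop: "c \<in> topspace (\<R> k)" using V y0 openin_subset c_def by blast
  have near: "eventually (\<lambda>t. \<forall>j<k. \<bar>y t j - c j\<bar> < r) (nhds t0)" if "r > 0" for r
  proof -
    have "eventually (\<lambda>t. \<forall>j\<in>{..<k}. \<bar>y t j - c j\<bar> < r) (nhds t0)"
    proof (subst eventually_ball_finite_distrib)
      show "\<forall>j\<in>{..<k}. eventually (\<lambda>t. \<bar>y t j - c j\<bar> < r) (nhds t0)"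
      proof
        fix j assume "j \<in> {..<k}"
        then have "isCont (\<lambda>t. y t j) t0" using d DERIV_isCont by blast
        then have "((\<lambda>t. y t j) \<longlongrightarrow> c j) (at t0)"
          unfolding c_def isCont_def .
        then have "eventually (\<lambda>t. \<bar>y t j - c j\<bar> < r) (at t0)"
          using that by (auto dest!: tendstoD simp: dist_real_def)
        then show "eventually (\<lambda>t. \<bar>y t j - c j\<bar> < r) (nhds t0)"
          using that by (simp add: eventually_nhds_conv_at c_def)
      qed
    qed simp
    then show ?thesis by (rule eventually_mono) simp
  qed
  have step: "((\<lambda>t. f (z (Suc l) t) - f (z l t)) has_real_derivative G l c * d l) (at t0)" if l: "l < k" for l
  proof (rule DERIV_of_linear_bound[OF d[OF l]])
    have "z (Suc l) t0 = z l t0" by (auto simp: z_def c_def)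
    then show "f (z (Suc l) t0) - f (z l t0) = 0" by simp
    fix e :: real assume e: "e > 0"
    have "openin (\<R> k) {x\<in>V. G l x \<in> ball (G l c) e}"
      by (rule openin_continuous_on[OF V Gc[OF l]]) simp
    then obtain r where r: "r > 0" "cube k c r \<subseteq> {x\<in>V. G l x \<in> ball (G l c) e}"
      using open_contains_cube[of k "{x\<in>V. G l x \<in> ball (G l c) e}" c] e y0 c_def by auto
    have "eventually (\<lambda>t. \<bar>f (z (Suc l) t) - f (z l t) - G l c * (y t l - y t0 l)\<bar> \<le> e * \<bar>y t l - y t0 l\<bar>) (nhds t0)"
      using near[OF r(1)] yt
    proof eventually_elim
      case (elim t)
      define q where "q s = f ((z l t)(l := s))" for s
      have incube: "(z l t)(l := s) \<in> cube k c r" if "\<bar>s - c l\<bar> < r" for s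
        using that elim ctop l r(1) by (auto simp: cube_def z_def topspace_Euclidean_space)
      have q': "(q has_real_derivative G l ((z l t)(l := s))) (at s)" if "\<bar>s - c l\<bar> < r" for s
      proof -
        have "(z l t)(l := s) \<in> V" using incube[OF that] r(2) by blast
        then show ?thesis using G[OF l, of "(z l t)(l := s)"] by (simp add: q_def[abs_def])
      qed
      have Gb: "\<bar>G l ((z l t)(l := s)) - G l c\<bar> \<le> e" if "\<bar>s - c l\<bar> < r" for s
        using incube[OF that] r(2) by (force simp: dist_real_def)
      have z1: "z (Suc l) t = (z l t)(l := y t l)" and z2: "(z l t)(l := c l) = z l t"
        by (auto simp: z_def fun_eq_iff less_Suc_eq)
      have yl: "\<bar>y t l - c l\<bar> < r" using elim l by blast
      \<comment> \<open>The mean value theorem wants its end points in order; if they coincide, both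
        sides are 0 and \<open>c l\<close> serves.\<close>
      have "\<exists>\<xi>. \<bar>\<xi> - c l\<bar> < r \<and> q (y t l) - q (c l) = (y t l - c l) * G l ((z l t)(l := \<xi>))"
      proof (cases "y t l" "c l" rule: linorder_cases)
        case less
        then obtain \<xi> where "y t l < \<xi>" "\<xi> < c l" "q (c l) - q (y t l) = (c l - y t l) * G l ((z l t)(l := \<xi>))"
          using MVT2[of "y t l" "c l" q "\<lambda>s. G l ((z l t)(l := s))"] q' yl by force
        then show ?thesis using yl by (intro exI[of _ \<xi>]) (auto simp: algebra_simps)
      next
        case equal
        then show ?thesis using r by (intro exI[of _ "c l"]) auto
      next
        case greater
        then obtain \<xi> where "c l < \<xi>" "\<xi> < y t l" "q (y t l) - q (c l) = (y t l - c l) * G l ((z l t)(l := \<xi>))"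
          using MVT2[of "c l" "y t l" q "\<lambda>s. G l ((z l t)(l := s))"] q' yl by force
        then show ?thesis using yl by (intro exI[of _ \<xi>]) auto
      qed
      then obtain \<xi> where \<xi>: "\<bar>\<xi> - c l\<bar> < r" "q (y t l) - q (c l) = (y t l - c l) * G l ((z l t)(l := \<xi>))"
        by blast
      have "f (z (Suc l) t) - f (z l t) = q (y t l) - q (c l)"
        using z1 z2 by (simp add: q_def)
      then have "f (z (Suc l) t) - f (z l t) - G l c * (y t l - y t0 l)
          = (G l ((z l t)(l := \<xi>)) - G l c) * (y t l - c l)"
        using \<xi>(2) by (simp add: c_def algebra_simps)
      then show ?case using Gb[OF \<xi>(1)] by (simp add: abs_mult mult_right_mono c_def)
    qed
    then show "eventually (\<lambda>t. \<bar>f (z (Suc l) t) - f (z l t) - G l c * (y t l - y t0 l)\<bar> \<le> e * \<bar>y t l - y t0 l\<bar>) (at t0)"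
      by (simp add: eventually_nhds_conv_at)
  qed
  have "((\<lambda>t. (\<Sum>l<k. f (z (Suc l) t) - f (z l t)) + f c) has_real_derivative (\<Sum>l<k. G l c * d l) + 0) (at t0)"
    using step by (intro DERIV_add DERIV_sum DERIV_const) auto
  moreover have "eventually (\<lambda>t. (\<Sum>l<k. f (z (Suc l) t) - f (z l t)) + f c = f (y t)) (nhds t0)"
    using yt
  proof eventually_elim
    case (elim t)
    have "z k t = y t" using elim ctop by (auto simp: z_def topspace_Euclidean_space fun_eq_iff)
    moreover have "z 0 t = c" by (simp add: z_def)
    ultimately show ?case using sum_lessThan_telescope[of "\<lambda>l. f (z l t)" k] by simp
  qed
  ultimately have "((\<lambda>t. f (y t)) has_real_derivative (\<Sum>l<k. G l c * d l) + 0) (at t0)"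
    using DERIV_cong_ev[OF refl _ refl, THEN iffD1] by fastforce
  then show ?thesis by (simp add: c_def)
qed

text \<open>Induction on \<open>r\<close> with \<open>f\<close> arbitrary: a partial derivative of
  the composite is a sum of products of a partial derivative of \<open>f\<close>, composed with the
  same \<open>g\<close>, and a partial derivative of \<open>g\<close>.\<close>

lemma Ck_compose:
  assumes "openin (\<R> m) U" "openin (\<R> k) V" "g \<in> U \<rightarrow> V"
    and "\<And>j. j < k \<Longrightarrow> Ck r m U (\<lambda>x. g x j)" "Ck r k V f"
  shows "Ck r m U (\<lambda>x. f (g x))"
  using assms(4,5)
proof (induction r arbitrary: f)
  case (0 f)
  have "continuous_on U (\<lambda>x. g x j)" for j
  proof (cases "j < k")
    case True
    then show ?thesis using 0(1) assms(1) Ck_imp_continuous by blast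
  next
    case False
    then have "g x j = 0" if "x \<in> U" for x
      using that assms(2,3) openin_subset by (fastforce simp: topspace_Euclidean_space)
    then show ?thesis using continuous_on_eq[of U "\<lambda>x. 0"] by auto
  qed
  then have "continuous_on U g" by (rule continuous_on_coordinatewise_then_product)
  moreover have "continuous_on V f" using 0 assms Ck_imp_continuous by blast
  ultimately show ?case
    using assms(1,3) by (intro Ck_0I continuous_on_compose2[of V f U g]) auto
next
  case (Suc r f)
  have g0: "Ck r m U (\<lambda>x. g x j)" if "j < k" for j
    using Ck_Suc_imp[OF assms(1) Suc.prems(1)[OF that]] .
  have "Ck r m U (\<lambda>x. f (g x))"
    using Suc.IH[OF g0 Ck_Suc_imp[OF assms(2) Suc.prems(2)]] by blast
  then have cont: "continuous_on U (\<lambda>x. f (g x))"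
    using assms(1) Ck_imp_continuous by blast
  obtain G where G: "\<And>j. j < k \<Longrightarrow> (\<forall>x\<in>V. ((\<lambda>t. f (x(j := t))) has_real_derivative G j x) (at (x j))) \<and> Ck r k V (G j)"
    using Ck_SucD[OF Suc.prems(2)] by metis
  show ?case
  proof (rule Ck_SucI[OF assms(1) cont])
    fix i assume i: "i < m"
    obtain d where d: "\<And>j. j < k \<Longrightarrow> (\<forall>x\<in>U. ((\<lambda>t. g (x(i := t)) j) has_real_derivative d j x) (at (x i))) \<and> Ck r m U (d j)"
      using Ck_SucD[OF Suc.prems(1) i] by metis
    have "((\<lambda>t. f (g (x(i := t)))) has_real_derivative (\<Sum>j<k. G j (g x) * d j x)) (at (x i))" if x: "x \<in> U" for x
    proof -
      have "((\<lambda>t. f (g (x(i := t)))) has_real_derivative (\<Sum>j<k. G j (g (x(i := x i))) * d j x)) (at (x i))"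
      proof (rule chain_rule_curve[OF assms(2)])
        show "g (x(i := x i)) \<in> V" using x assms(3) by auto
        show "eventually (\<lambda>t. g (x(i := t)) \<in> topspace (\<R> k)) (nhds (x i))"
          using eventually_upd_in[OF assms(1) x i]
          by eventually_elim (use assms(2,3) openin_subset in blast)
        show "\<And>j. j < k \<Longrightarrow> continuous_on V (G j)"
          using G Ck_imp_continuous assms(2) by blast
      qed (use G d x in \<open>auto simp del: fun_upd_apply\<close>)
      then show ?thesis by simp
    qed
    moreover have "Ck r m U (\<lambda>x. \<Sum>j<k. G j (g x) * d j x)"
      using Suc.IH[OF g0] G d by (intro Ck_sum Ck_mult assms(1)) auto
    ultimately show "\<exists>d. (\<forall>x\<in>U. ((\<lambda>t. f (g (x(i := t)))) has_real_derivative d x) (at (x i))) \<and> Ck r m U d"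
      by (intro exI[of _ "\<lambda>x. \<Sum>j<k. G j (g x) * d j x"]) simp
  qed
qed

section \<open>Smooth maps\<close>

lemma smooth_map_openin: "smooth_map m U n f \<Longrightarrow> openin (\<R> m) U"
  by (simp add: smooth_map_def)

lemma smooth_map_range: "smooth_map m U n f \<Longrightarrow> x \<in> U \<Longrightarrow> f x \<in> topspace (\<R> n)"
  by (auto simp: smooth_map_def)

lemma smooth_map_cong:
  assumes "smooth_map m U n f" "\<And>x. x \<in> U \<Longrightarrow> g x = f x"
  shows "smooth_map m U n g"
  unfolding smooth_map_def
proof (intro conjI allI impI)
  show "openin (\<R> m) U" "g \<in> U \<rightarrow> topspace (\<R> n)"
    using assms by (auto simp: smooth_map_def)
  fix i r assume "i < n"
  then have "Ck r m U (\<lambda>x. f x i)" using assms(1) by (simp add: smooth_map_def)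
  then show "Ck r m U (\<lambda>x. g x i)"
    by (rule Ck_cong[rotated 2]) (use assms smooth_map_openin in auto)
qed

lemma smooth_map_subset:
  assumes "smooth_map m U n f" "openin (\<R> m) U'" "U' \<subseteq> U"
  shows "smooth_map m U' n f"
  using assms Ck_subset[of m U U'] unfolding smooth_map_def by blast

lemma smooth_map_local:
  assumes "openin (\<R> m) U"
    and "\<And>x. x \<in> U \<Longrightarrow> \<exists>V. openin (\<R> m) V \<and> x \<in> V \<and> V \<subseteq> U \<and> smooth_map m V n f"
  shows "smooth_map m U n f"
  unfolding smooth_map_def
proof (intro conjI allI impI)
  show "f \<in> U \<rightarrow> topspace (\<R> n)"
    using assms(2) smooth_map_range by blast
  fix i r assume i: "i < n"
  show "Ck r m U (\<lambda>x. f x i)"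
  proof (rule Ck_local[OF assms(1)])
    fix x assume "x \<in> U"
    then obtain V where "openin (\<R> m) V" "x \<in> V" "V \<subseteq> U" "smooth_map m V n f"
      using assms(2) by blast
    then show "\<exists>V. openin (\<R> m) V \<and> x \<in> V \<and> V \<subseteq> U \<and> Ck r m V (\<lambda>x. f x i)"
      using i by (intro exI[of _ V]) (auto simp: smooth_map_def)
  qed
qed (rule assms(1))

lemma smooth_map_comp:
  assumes "smooth_map m U k g" "smooth_map k V n f" "g \<in> U \<rightarrow> V"
  shows "smooth_map m U n (\<lambda>x. f (g x))"
  unfolding smooth_map_def
proof (intro conjI allI impI)
  show "openin (\<R> m) U" "(\<lambda>x. f (g x)) \<in> U \<rightarrow> topspace (\<R> n)"
    using assms by (auto simp: smooth_map_def)
  fix i r assume "i < n"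
  then show "Ck r m U (\<lambda>x. f (g x) i)"
    using Ck_compose[of m U k V g r "\<lambda>x. f x i"] assms by (auto simp: smooth_map_def)
qed

lemma smooth_map_id: "openin (\<R> m) U \<Longrightarrow> smooth_map m U m (\<lambda>x. x)"
  using openin_subset by (fastforce simp: smooth_map_def Ck_coord)

lemma smooth_map_continuous_on:
  assumes "smooth_map m U n f"
  shows "continuous_on U f"
proof (rule continuous_on_coordinatewise_then_product)
  fix j
  show "continuous_on U (\<lambda>x. f x j)"
  proof (cases "j < n")
    case True
    then have "Ck 0 m U (\<lambda>x. f x j)" using assms by (simp add: smooth_map_def)
    then show ?thesis using Ck_imp_continuous assms smooth_map_openin by blast
  next
    case False
    then have "f x j = 0" if "x \<in> U" for x
      using smooth_map_range[OF assms that] by (simp add: topspace_Euclidean_space)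
    then show ?thesis using continuous_on_eq[of U "\<lambda>x. 0"] by auto
  qed
qed

lemma smooth_map_preimage:
  assumes "smooth_map m U n f" "openin (\<R> n) V"
  shows "openin (\<R> m) {x\<in>U. f x \<in> V}"
proof -
  obtain S where S: "open S" "V = topspace (\<R> n) \<inter> S"
    using assms(2) openin_Euclidean_iff by blast
  have "openin (\<R> m) {x\<in>U. f x \<in> S}"
    using openin_continuous_on[OF smooth_map_openin[OF assms(1)] smooth_map_continuous_on[OF assms(1)] S(1)] .
  moreover have "{x\<in>U. f x \<in> S} = {x\<in>U. f x \<in> V}"
    using S(2) smooth_map_range[OF assms(1)] by auto
  ultimately show ?thesis by simp
qed

lemma smooth_map_continuous_map:
  assumes "smooth_map m U n f"
  shows "continuous_map (subtopology (\<R> m) U) (\<R> n) f"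
proof -
  have U: "U \<subseteq> topspace (\<R> m)" using assms smooth_map_openin openin_subset by blast
  then show ?thesis
    using smooth_map_range[OF assms] smooth_map_continuous_on[OF assms]
    by (auto simp: cm_Euclidean_space_iff_continuous_on Int_absorb1)
qed

section \<open>Affine maps\<close>

text \<open>The condition on elements of \<open>Aff n\<close> freed from bijectivity and from the
  convention about values outside \<open>\<R> n\<close>.\<close>

definition affine_map :: "nat \<Rightarrow> ((nat \<Rightarrow> real) \<Rightarrow> (nat \<Rightarrow> real)) \<Rightarrow> bool" where
  "affine_map n g \<longleftrightarrow> g \<in> topspace (\<R> n) \<rightarrow> topspace (\<R> n) \<and>
     (\<exists>A :: nat \<Rightarrow> nat \<Rightarrow> real. \<exists>b :: nat \<Rightarrow> real.
        \<forall>x \<in> topspace (\<R> n). \<forall>i<n. g x i = (\<Sum>j<n. A i j * x j) + b i)"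

lemma smooth_map_affine:
  assumes "affine_map n g"
  shows "smooth_map n (topspace (\<R> n)) n g"
proof -
  obtain A :: "nat \<Rightarrow> nat \<Rightarrow> real" and b :: "nat \<Rightarrow> real"
    where Ab: "\<And>x i. x \<in> topspace (\<R> n) \<Longrightarrow> i < n \<Longrightarrow> g x i = (\<Sum>j<n. A i j * x j) + b i"
    using assms unfolding affine_map_def by blast
  show ?thesis
    unfolding smooth_map_def
  proof (intro conjI allI impI)
    show "g \<in> topspace (\<R> n) \<rightarrow> topspace (\<R> n)" using assms by (simp add: affine_map_def)
    fix i r assume i: "i < n"
    have "Ck r n (topspace (\<R> n)) (\<lambda>x. (\<Sum>j<n. A i j * x j) + b i)"
      by (intro Ck_add Ck_sum Ck_mult Ck_const Ck_coord) auto
    then show "Ck r n (topspace (\<R> n)) (\<lambda>x. g x i)"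
      by (rule Ck_cong[rotated 2]) (use i Ab in auto)
  qed auto
qed

section \<open>Smooth maps that agree pointwise with members of a countable affine family\<close>

text \<open>From \<open>x\<close> to \<open>y\<close> one coordinate is changed at a time; along
  each such segment, which stays in the cube, \<open>F\<close> has derivative 0.\<close>

lemma constant_on_cube:
  assumes "\<And>i x. i < n \<Longrightarrow> x \<in> cube n c r \<Longrightarrow> ((\<lambda>t. F (x(i := t))) has_real_derivative 0) (at (x i))"
    and x: "x \<in> cube n c r" and y: "y \<in> cube n c r"
  shows "F x = F y"
proof -
  define z where "z l = (\<lambda>j. if j < l then y j else x j)" for l
  have zl: "F (z l) = F x" if "l \<le> n" for l
    using that
  proof (induction l)
    case 0
    then show ?case by (simp add: z_def)
  next
    case (Suc l)
    let ?I = "{s. \<bar>s - c l\<bar> < r}"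
    have cvx: "convex ?I"
    proof -
      have "?I = ball (c l) r" by (auto simp: dist_real_def)
      then show ?thesis by simp
    qed
    have cube: "(z l)(l := s) \<in> cube n c r" if "s \<in> ?I" for s
      using that x y Suc.prems by (auto simp: cube_def z_def topspace_Euclidean_space)
    have "\<exists>C. \<forall>s\<in>?I. F ((z l)(l := s)) = C"
    proof (rule has_field_derivative_zero_constant[OF cvx])
      fix s assume "s \<in> ?I"
      then have "((\<lambda>t. F (((z l)(l := s))(l := t))) has_real_derivative 0) (at (((z l)(l := s)) l))"
        using Suc.prems by (intro assms(1) cube) auto
      then show "((\<lambda>s. F ((z l)(l := s))) has_real_derivative 0) (at s within ?I)"
        by (simp add: has_field_derivative_at_within)
    qed
    moreover have "x l \<in> ?I" "y l \<in> ?I" using x y Suc.prems by (auto simp: cube_def)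
    ultimately have "F ((z l)(l := y l)) = F ((z l)(l := x l))" by force
    moreover have "(z l)(l := y l) = z (Suc l)" "(z l)(l := x l) = z l"
      by (auto simp: z_def fun_eq_iff less_Suc_eq)
    ultimately show ?case using Suc by simp
  qed
  have "z n = y"
    using x y by (auto simp: z_def cube_def topspace_Euclidean_space fun_eq_iff)
  then show ?thesis using zl[of n] by simp
qed

text \<open>The sets where \<open>f\<close> agrees with a given \<open>\<gamma>\<close> are closed
  in \<open>W\<close>, countable in number and cover it. As an open subset of a Euclidean space,
  \<open>W\<close> is completely metrizable, so by Baire one of them has interior.\<close>

lemma Baire_pointwise:
  fixes f :: "(nat \<Rightarrow> real) \<Rightarrow> nat \<Rightarrow> real"
  assumes W: "openin (\<R> n) W" "W \<noteq> {}" and \<Gamma>: "countable \<Gamma>"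
    and f: "continuous_on W f" and g: "\<And>\<gamma>. \<gamma> \<in> \<Gamma> \<Longrightarrow> continuous_on W \<gamma>"
    and ex: "\<And>z. z \<in> W \<Longrightarrow> \<exists>\<gamma>\<in>\<Gamma>. f z = \<gamma> z"
  obtains \<gamma> W' where "\<gamma> \<in> \<Gamma>" "openin (\<R> n) W'" "W' \<noteq> {}" "W' \<subseteq> W" "\<And>z. z \<in> W' \<Longrightarrow> f z = \<gamma> z"
proof -
  let ?X = "subtopology (\<R> n) W"
  let ?E = "\<lambda>\<gamma>. {z\<in>W. f z = \<gamma> z}"
  have Wt: "topspace ?X = W" using openin_subset[OF W(1)] by auto
  have cm: "continuous_map ?X euclidean h \<longleftrightarrow> continuous_on W h" for h :: "(nat \<Rightarrow> real) \<Rightarrow> nat \<Rightarrow> real"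
    using continuous_map_Euclidean_on openin_subset[OF W(1)] by blast
  have "closedin ?X (?E \<gamma>)" if "\<gamma> \<in> \<Gamma>" for \<gamma>
  proof -
    have "closedin ?X {x \<in> topspace ?X. f x = \<gamma> x}"
      by (rule closedin_continuous_maps_eq[where Y = euclidean]) (use f g[OF that] cm in auto)
    then show ?thesis by (simp only: Wt)
  qed
  moreover have "?X interior_of \<Union>(?E ` \<Gamma>) \<noteq> {}"
  proof -
    have "\<Union>(?E ` \<Gamma>) = topspace ?X" using ex Wt by auto
    then show ?thesis using W Wt by (metis interior_of_topspace)
  qed
  ultimately obtain \<gamma> where \<gamma>: "\<gamma> \<in> \<Gamma>" "?X interior_of (?E \<gamma>) \<noteq> {}"
    using Baire_category_alt[of ?X "?E ` \<Gamma>"] \<Gamma> W(1)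
      completely_metrizable_space_openin[OF completely_metrizable_Euclidean_space] by auto
  have "openin ?X (?X interior_of (?E \<gamma>))" by simp
  then have "openin (\<R> n) (?X interior_of (?E \<gamma>))"
    using W(1) openin_open_subtopology by blast
  moreover have "?X interior_of (?E \<gamma>) \<subseteq> ?E \<gamma>" by (rule interior_of_subset)
  ultimately show thesis using that \<gamma> by blast
qed

text \<open>
  By Baire, \<open>f\<close> is affine near the points of a dense open set; so its second partial derivatives,
  being continuous, vanish everywhere.
\<close>

lemma smooth_locally_in_affine_family:
  assumes f: "smooth_map n (cube n c r) n f" and c: "c \<in> topspace (\<R> n)" "r > 0"
    and \<Gamma>: "countable \<Gamma>" "\<And>\<gamma>. \<gamma> \<in> \<Gamma> \<Longrightarrow> affine_map n \<gamma>"
    and ex: "\<And>z. z \<in> cube n c r \<Longrightarrow> \<exists>\<gamma>\<in>\<Gamma>. f z = \<gamma> z"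
  shows "\<exists>\<gamma>\<in>\<Gamma>. \<forall>z\<in>cube n c r. f z = \<gamma> z"
proof -
  let ?Q = "cube n c r"
  have Q: "openin (\<R> n) ?Q" "?Q \<noteq> {}" "?Q \<subseteq> topspace (\<R> n)"
    using openin_cube centre_in_cube[OF c] by (auto simp: cube_def)
  have cont: "continuous_on W h" if "h = f \<or> h \<in> \<Gamma>" "W \<subseteq> ?Q" for h W
    using that smooth_map_continuous_on[OF f] smooth_map_continuous_on[OF smooth_map_affine[OF \<Gamma>(2)]] Q(3)
    by (metis continuous_on_subset)
  \<comment> \<open>Available for every nonempty open part of the cube: this is the density of the
    points near which \<open>f\<close> coincides with a single member of the family.\<close>
  have dense: "\<exists>\<gamma>\<in>\<Gamma>. \<exists>W'. openin (\<R> n) W' \<and> W' \<noteq> {} \<and> W' \<subseteq> W \<and> (\<forall>z\<in>W'. f z = \<gamma> z)"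
    if W: "openin (\<R> n) W" "W \<noteq> {}" "W \<subseteq> ?Q" for W
    by (rule Baire_pointwise[OF W(1,2) \<Gamma>(1), of f]) (use W cont ex in blast)+
  \<comment> \<open>The candidate is read off on one open set. It turns out to be right everywhere,
    because the first derivatives of \<open>f\<close> are constant on the cube.\<close>
  obtain \<gamma> W0 where W0: "\<gamma> \<in> \<Gamma>" "openin (\<R> n) W0" "W0 \<noteq> {}" "W0 \<subseteq> ?Q" "\<And>z. z \<in> W0 \<Longrightarrow> f z = \<gamma> z"
    using dense[OF Q(1,2)] by blast
  have "f z k = \<gamma> z k" if z: "z \<in> ?Q" and k: "k < n" for z k
  proof -
    have aff: "\<exists>a b. \<forall>x\<in>topspace (\<R> n). \<delta> x k = (\<Sum>j<n. a j * x j) + b" if "\<delta> \<in> \<Gamma>" for \<delta>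
      using \<Gamma>(2)[OF that] k unfolding affine_map_def by blast
    then obtain a b where ab: "\<And>\<delta> x. \<delta> \<in> \<Gamma> \<Longrightarrow> x \<in> topspace (\<R> n) \<Longrightarrow> \<delta> x k = (\<Sum>j<n. a \<delta> j * x j) + b \<delta>"
      by metis
    have dlin: "((\<lambda>t. \<Sum>j<n. a \<delta> j * (x(i := t)) j) has_real_derivative a \<delta> i) (at s)" if "i < n" for \<delta> x i s
    proof -
      have "((\<lambda>t. \<Sum>j<n. a \<delta> j * (x(i := t)) j) has_real_derivative (\<Sum>j<n. a \<delta> j * (if j = i then 1 else 0))) (at s)"
      proof (rule DERIV_sum)
        show "((\<lambda>t. a \<delta> j * (x(i := t)) j) has_real_derivative a \<delta> j * (if j = i then 1 else 0)) (at s)" for j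
          by (rule DERIV_cmult) (auto intro: derivative_eq_intros)
      qed
      then show ?thesis using that by (simp add: if_distrib cong: if_cong)
    qed
    have daff: "((\<lambda>t. \<delta> (x(i := t)) k) has_real_derivative a \<delta> i) (at (x i))"
      if \<delta>: "\<delta> \<in> \<Gamma>" and x: "x \<in> topspace (\<R> n)" and i: "i < n" for \<delta> x i
    proof (rule partial_derivative_cong[OF openin_topspace x i])
      show "\<forall>x\<in>topspace (\<R> n). (\<Sum>j<n. a \<delta> j * x j) + b \<delta> = \<delta> x k" using ab[OF \<delta>] by simp
      show "((\<lambda>t. (\<Sum>j<n. a \<delta> j * (x(i := t)) j) + b \<delta>) has_real_derivative a \<delta> i) (at (x i))"
        using DERIV_add[OF dlin[OF i] DERIV_const] by simp
    qed
    have C2: "Ck (Suc (Suc 0)) n ?Q (\<lambda>x. f x k)" using f k by (simp add: smooth_map_def)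
    have first: "((\<lambda>t. f (x(i := t)) k) has_real_derivative a \<gamma> i) (at (x i))" if i: "i < n" and x: "x \<in> ?Q" for i x
    proof -
      obtain g where g: "\<forall>x\<in>?Q. ((\<lambda>t. f (x(i := t)) k) has_real_derivative g x) (at (x i))" "Ck (Suc 0) n ?Q g"
        using Ck_SucD[OF C2 i] by blast
      have gW: "g x = a \<delta> i" if "openin (\<R> n) W" "W \<subseteq> ?Q" "\<delta> \<in> \<Gamma>" "\<forall>z\<in>W. f z = \<delta> z" "x \<in> W" for x W \<delta>
      proof -
        have "((\<lambda>t. f (x(i := t)) k) has_real_derivative a \<delta> i) (at (x i))"
          using partial_derivative_cong[OF that(1,5) i, of "\<lambda>x. \<delta> x k" "\<lambda>x. f x k"] daff[OF that(3) _ i] that Q(3)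
          by auto
        then show ?thesis using g(1) that DERIV_unique by blast
      qed
      have "((\<lambda>t. g (x(j := t))) has_real_derivative 0) (at (x j))" if j: "j < n" and x: "x \<in> ?Q" for j x
      proof -
        obtain h where h: "\<forall>x\<in>?Q. ((\<lambda>t. g (x(j := t))) has_real_derivative h x) (at (x j))" "Ck 0 n ?Q h"
          using Ck_SucD[OF g(2) j] by blast
        have "openin (\<R> n) {x\<in>?Q. h x \<in> - {0}}"
          by (rule openin_continuous_on[OF Q(1) Ck_imp_continuous[OF Q(1) h(2)]]) auto
        \<comment> \<open>\<open>h\<close> is a second derivative of \<open>f\<close>. On an open
          set where \<open>f\<close> equals some \<open>\<delta>\<close>, the first derivative
          \<open>g\<close> is the constant \<open>a \<delta> i\<close>, which forces
          \<open>h = 0\<close> there.\<close>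
        moreover have no: "\<not> (\<exists>\<delta>\<in>\<Gamma>. \<exists>W'. openin (\<R> n) W' \<and> W' \<noteq> {} \<and> W' \<subseteq> {x\<in>?Q. h x \<in> - {0}} \<and> (\<forall>z\<in>W'. f z = \<delta> z))"
        proof safe
          fix \<delta> W' x assume *: "\<delta> \<in> \<Gamma>" "openin (\<R> n) W'" "W' \<subseteq> {x\<in>?Q. h x \<in> - {0}}" "\<forall>z\<in>W'. f z = \<delta> z" "x \<in> W'"
          have "a \<delta> i = g y" if "y \<in> W'" for y
          proof -
            have "W' \<subseteq> ?Q" using *(3) by blast
            then show ?thesis using gW[OF *(2) _ *(1,4) that] by simp
          qed
          then have "((\<lambda>t. g (x(j := t))) has_real_derivative 0) (at (x j))"
            using partial_derivative_cong[OF *(2,5) j, of "\<lambda>_. a \<delta> i" g 0] DERIV_const by blast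
          moreover have "((\<lambda>t. g (x(j := t))) has_real_derivative h x) (at (x j))" "h x \<noteq> 0"
            using h(1) * by auto
          ultimately show "x \<in> {}" using DERIV_unique by blast
        qed
        ultimately have "{x\<in>?Q. h x \<in> - {0}} = {}"
          using dense[of "{x\<in>?Q. h x \<in> - {0}}"] by (metis (no_types, lifting) mem_Collect_eq subsetI)
        then have "h x = 0" using x by auto
        then show ?thesis using h(1) x by metis
      qed
      then have "g x = g w" if "w \<in> ?Q" for w
        using constant_on_cube[of n c r g x w] x that by blast
      moreover obtain w where "w \<in> W0" using W0(3) by blast
      ultimately have "g x = a \<gamma> i" using gW[OF W0(2,4,1)] W0(4,5) by auto
      then show ?thesis using g(1) x by metis
    qed
    obtain w where w: "w \<in> W0" using W0(3) by blast
    \<comment> \<open>Both functions have the same first derivatives on the cube, so their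
      difference is constant, and it vanishes at \<open>w\<close>.\<close>
    have "f z k - \<gamma> z k = f w k - \<gamma> w k"
    proof (rule constant_on_cube[of n c r "\<lambda>x. f x k - \<gamma> x k" z w])
      show "((\<lambda>t. f (x(i := t)) k - \<gamma> (x(i := t)) k) has_real_derivative 0) (at (x i))"
        if "i < n" "x \<in> ?Q" for i x
      proof -
        have "x \<in> topspace (\<R> n)" using that(2) Q(3) by blast
        from DERIV_diff[OF first[OF that] daff[OF W0(1) this that(1)]] show ?thesis by simp
      qed
    qed (use z w W0(4) in auto)
    then show ?thesis using W0(5)[OF w] by simp
  qed
  moreover have "f z k = \<gamma> z k" if "z \<in> ?Q" "\<not> k < n" for z k
  proof -
    have "\<gamma> z \<in> topspace (\<R> n)" using \<Gamma>(2)[OF W0(1)] that(1) Q(3) by (auto simp: affine_map_def)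
    then show ?thesis using smooth_map_range[OF f that(1)] that(2) by (simp add: topspace_Euclidean_space)
  qed
  ultimately have "\<forall>z\<in>?Q. f z = \<gamma> z" by (metis ext)
  then show ?thesis using W0(1) by blast
qed

lemma Euclidean_countable_basis:
  obtains \<B> where "countable \<B>" "\<And>B. B \<in> \<B> \<Longrightarrow> openin (\<R> n) B"
    "\<And>U x. openin (\<R> n) U \<Longrightarrow> x \<in> U \<Longrightarrow> \<exists>B\<in>\<B>. x \<in> B \<and> B \<subseteq> U"
proof -
  obtain \<A> :: "(nat \<Rightarrow> real) set set" where \<A>: "countable \<A>" "topological_basis \<A>"
    using ex_countable_basis by blast
  show thesis
  proof (rule that[of "(\<inter>) (topspace (\<R> n)) ` \<A>"])
    show "\<exists>B\<in>(\<inter>) (topspace (\<R> n)) ` \<A>. x \<in> B \<and> B \<subseteq> U" if U: "openin (\<R> n) U" "x \<in> U" for U x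
    proof -
      obtain S where S: "open S" "U = topspace (\<R> n) \<inter> S" using U(1) openin_Euclidean_iff by blast
      then obtain B where "B \<in> \<A>" "x \<in> B" "B \<subseteq> S"
        using topological_basisE[OF \<A>(2) S(1), of x] U(2) by blast
      then show ?thesis using S(2) U(2) by auto
    qed
  qed (use \<A> topological_basis_open openin_Euclidean_iff in blast)+
qed

section \<open>Subgroups of the affine group\<close>

lemma affine_map_compose:
  assumes "affine_map n g" "affine_map n h"
  shows "affine_map n (compose (topspace (\<R> n)) g h)"
proof -
  obtain A :: "nat \<Rightarrow> nat \<Rightarrow> real" and b :: "nat \<Rightarrow> real"
    where A: "\<And>x i. x \<in> topspace (\<R> n) \<Longrightarrow> i < n \<Longrightarrow> g x i = (\<Sum>j<n. A i j * x j) + b i"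
    using assms(1) unfolding affine_map_def by blast
  obtain B :: "nat \<Rightarrow> nat \<Rightarrow> real" and c :: "nat \<Rightarrow> real"
    where B: "\<And>x i. x \<in> topspace (\<R> n) \<Longrightarrow> i < n \<Longrightarrow> h x i = (\<Sum>j<n. B i j * x j) + c i"
    using assms(2) unfolding affine_map_def by blast
  have h: "h x \<in> topspace (\<R> n)" if "x \<in> topspace (\<R> n)" for x
    using assms(2) that by (auto simp: affine_map_def)
  have "g (h x) i = (\<Sum>k<n. (\<Sum>j<n. A i j * B j k) * x k) + ((\<Sum>j<n. A i j * c j) + b i)"
    if x: "x \<in> topspace (\<R> n)" and i: "i < n" for x i
  proof -
    have "g (h x) i = (\<Sum>j<n. A i j * ((\<Sum>k<n. B j k * x k) + c j)) + b i"
      using A[OF h[OF x] i] B[OF x] by simp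
    also have "(\<Sum>j<n. A i j * ((\<Sum>k<n. B j k * x k) + c j))
        = (\<Sum>j<n. \<Sum>k<n. A i j * B j k * x k) + (\<Sum>j<n. A i j * c j)"
      by (simp add: distrib_left sum.distrib sum_distrib_left mult.assoc)
    also have "(\<Sum>j<n. \<Sum>k<n. A i j * B j k * x k) = (\<Sum>k<n. (\<Sum>j<n. A i j * B j k) * x k)"
      by (subst sum.swap) (simp add: sum_distrib_right)
    finally show ?thesis by simp
  qed
  then have "\<forall>x\<in>topspace (\<R> n). \<forall>i<n. compose (topspace (\<R> n)) g h x i
      = (\<Sum>k<n. (\<Sum>j<n. A i j * B j k) * x k) + ((\<Sum>j<n. A i j * c j) + b i)"
    by (simp add: compose_def)
  then have "\<exists>C d. \<forall>x\<in>topspace (\<R> n). \<forall>i<n. compose (topspace (\<R> n)) g h x i = (\<Sum>k<n. C i k * x k) + d i"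
    by (rule_tac exI[of _ "\<lambda>i k. \<Sum>j<n. A i j * B j k"], rule_tac exI[of _ "\<lambda>i. (\<Sum>j<n. A i j * c j) + b i"])
  moreover have "compose (topspace (\<R> n)) g h \<in> topspace (\<R> n) \<rightarrow> topspace (\<R> n)"
    using assms(1) h by (auto simp: compose_def affine_map_def)
  ultimately show ?thesis unfolding affine_map_def by blast
qed

text \<open>No matrix is inverted. The inverse \<open>h\<close> must be the affine map with the
  values of \<open>h\<close> at the origin and at the unit vectors; applying \<open>g\<close> to
  that map returns \<open>y\<close>, and injectivity of \<open>g\<close> concludes.\<close>

lemma affine_map_inverse:
  assumes g: "affine_map n g" and bij: "bij_betw g (topspace (\<R> n)) (topspace (\<R> n))"
  shows "affine_map n (\<lambda>x\<in>topspace (\<R> n). inv_into (topspace (\<R> n)) g x)"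
proof -
  let ?S = "topspace (\<R> n)"
  define h where "h = inv_into ?S g"
  obtain A :: "nat \<Rightarrow> nat \<Rightarrow> real" and b :: "nat \<Rightarrow> real"
    where A: "\<And>x i. x \<in> ?S \<Longrightarrow> i < n \<Longrightarrow> g x i = (\<Sum>j<n. A i j * x j) + b i"
    using g unfolding affine_map_def by blast
  have h: "h y \<in> ?S" "g (h y) = y" if "y \<in> ?S" for y
    using that bij unfolding h_def by (auto simp: bij_betw_def inv_into_into f_inv_into_f)
  have hg: "h (g x) = x" if "x \<in> ?S" for x
    using that bij unfolding h_def by (auto simp: bij_betw_def)
  define e where "e j = (\<lambda>i::nat. if i = j then 1 else 0 :: real)" for j :: nat
  have e: "e j \<in> ?S" if "j < n" for j using that by (auto simp: e_def topspace_Euclidean_space)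
  define c0 where "c0 = (\<lambda>i::nat. 0::real)"
  have c0: "c0 \<in> ?S" by (simp add: c0_def topspace_Euclidean_space)
  have formula: "h y = (\<lambda>i. h c0 i + (\<Sum>j<n. y j * (h (e j) i - h c0 i)))" (is "_ = ?u") if y: "y \<in> ?S" for y
  proof -
    have u: "?u \<in> ?S" using h(1)[OF c0] h(1)[OF e] by (auto simp: topspace_Euclidean_space)
    have "g ?u i = y i" if i: "i < n" for i
    proof -
      \<comment> \<open>The equation \<open>g (h z) = z\<close>, solved for the linear part; it
        evaluates every sum below without knowledge of \<open>A\<close>.\<close>
      have lin: "(\<Sum>k<n. A i k * h z k) = z i - b i" if "z \<in> ?S" for z
        using A[OF h(1)[OF that] i] h(2)[OF that] by simp
      have "g ?u i = (\<Sum>k<n. A i k * (h c0 k + (\<Sum>j<n. y j * (h (e j) k - h c0 k)))) + b i"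
        using A[OF u i] by simp
      also have "(\<Sum>k<n. A i k * (h c0 k + (\<Sum>j<n. y j * (h (e j) k - h c0 k))))
          = (\<Sum>k<n. A i k * h c0 k) + (\<Sum>k<n. \<Sum>j<n. y j * (A i k * h (e j) k - A i k * h c0 k))"
        by (simp add: algebra_simps sum.distrib sum_distrib_left)
      also have "(\<Sum>k<n. \<Sum>j<n. y j * (A i k * h (e j) k - A i k * h c0 k))
          = (\<Sum>j<n. y j * ((\<Sum>k<n. A i k * h (e j) k) - (\<Sum>k<n. A i k * h c0 k)))"
        by (subst sum.swap) (simp add: sum_distrib_left sum_subtractf right_diff_distrib)
      also have "\<dots> = (\<Sum>j<n. y j * e j i)"
        using lin[OF e] lin[OF c0] by (simp add: c0_def)
      also have "\<dots> = y i" using i by (simp add: e_def if_distrib cong: if_cong)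
      finally show ?thesis using lin[OF c0] by (simp add: c0_def)
    qed
    moreover have "g ?u i = y i" if "\<not> i < n" for i
      using that y g u by (auto simp: affine_map_def topspace_Euclidean_space Pi_iff)
    ultimately have "g ?u i = y i" for i by blast
    then have "g ?u = y" by (rule ext)
    then show ?thesis using hg[OF u] by simp
  qed
  have "\<forall>x\<in>?S. \<forall>i<n. (\<lambda>x\<in>?S. h x) x i = (\<Sum>j<n. (h (e j) i - h c0 i) * x j) + h c0 i"
    using formula by (simp add: mult.commute)
  then have "\<exists>C d. \<forall>x\<in>?S. \<forall>i<n. (\<lambda>x\<in>?S. h x) x i = (\<Sum>j<n. C i j * x j) + d i"
    by (rule_tac exI[of _ "\<lambda>i j. h (e j) i - h c0 i"], rule_tac exI[of _ "h c0"])
  then show ?thesis using h(1) unfolding affine_map_def h_def[symmetric] by simp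
qed

lemma carrier_Aff: "carrier (Aff n) = {g \<in> Bij (topspace (\<R> n)). affine_map n g}"
  unfolding Aff_def affine_map_def using Bij_imp_funcset by auto

lemma group_Aff: "group (Aff n)"
proof -
  let ?S = "topspace (\<R> n)"
  let ?C = "{g \<in> Bij ?S. affine_map n g}"
  have "subgroup ?C (BijGroup ?S)"
  proof
    show "?C \<subseteq> carrier (BijGroup ?S)" by (auto simp: BijGroup_def)
    show "x \<otimes>\<^bsub>BijGroup ?S\<^esub> y \<in> ?C" if "x \<in> ?C" "y \<in> ?C" for x y
      using that by (simp add: BijGroup_def compose_Bij affine_map_compose)
    have "affine_map n (\<lambda>x\<in>?S. x)"
    proof -
      have "(\<lambda>x\<in>?S. x) x i = (\<Sum>j<n. (if j = i then 1 else 0) * x j) + 0" if "x \<in> ?S" "i < n" for x i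
        using that by (simp add: if_distrib[of "\<lambda>c. c * _"] cong: if_cong)
      then show ?thesis
        unfolding affine_map_def
        by (intro conjI exI[of _ "\<lambda>i j. if j = i then 1 else 0"] exI[of _ "\<lambda>i. 0"]) auto
    qed
    then show "\<one>\<^bsub>BijGroup ?S\<^esub> \<in> ?C" by (simp add: BijGroup_def id_Bij)
    show "inv\<^bsub>BijGroup ?S\<^esub> x \<in> ?C" if "x \<in> ?C" for x
      using that affine_map_inverse[of n x] restrict_inv_into_Bij[of x ?S]
      by (simp add: inv_BijGroup Bij_def)
  qed
  then have "group (BijGroup ?S \<lparr>carrier := ?C\<rparr>)"
    by (rule group.subgroup_imp_group[OF group_BijGroup])
  moreover have "BijGroup ?S \<lparr>carrier := ?C\<rparr> = Aff n"
    using carrier_Aff[of n] unfolding Aff_def by simp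
  ultimately show ?thesis by simp
qed

text \<open>The group axioms as pointwise statements on \<open>\<R> n\<close>, the only place where
  elements of \<open>Aff n\<close> have meaningful values.\<close>

lemma subgroup_Aff:
  assumes "subgroup \<Gamma> (Aff n)"
  shows "\<And>g. g \<in> \<Gamma> \<Longrightarrow> affine_map n g"
    and "\<And>g h. g \<in> \<Gamma> \<Longrightarrow> h \<in> \<Gamma> \<Longrightarrow> \<exists>k\<in>\<Gamma>. \<forall>x\<in>topspace (\<R> n). k x = g (h x)"
    and "\<exists>e\<in>\<Gamma>. \<forall>x\<in>topspace (\<R> n). e x = x"
    and "\<And>g. g \<in> \<Gamma> \<Longrightarrow> \<exists>h\<in>\<Gamma>. \<forall>x\<in>topspace (\<R> n). h (g x) = x \<and> g (h x) = x"
proof -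
  let ?S = "topspace (\<R> n)"
  interpret G: group "Aff n" by (rule group_Aff)
  have \<Gamma>: "\<Gamma> \<subseteq> carrier (Aff n)" using assms by (rule subgroup.subset)
  then show "affine_map n g" if "g \<in> \<Gamma>" for g using that carrier_Aff by blast
  have mult: "(g \<otimes>\<^bsub>Aff n\<^esub> h) x = g (h x)" if "g \<in> \<Gamma>" "h \<in> \<Gamma>" "x \<in> ?S" for g h x
  proof -
    have "g \<in> Bij ?S" "h \<in> Bij ?S" using that \<Gamma> carrier_Aff by auto
    then show ?thesis using that(3) by (simp add: Aff_def BijGroup_def compose_def)
  qed
  have one: "\<one>\<^bsub>Aff n\<^esub> x = x" if "x \<in> ?S" for x
    using that by (simp add: Aff_def BijGroup_def)
  show "\<exists>k\<in>\<Gamma>. \<forall>x\<in>?S. k x = g (h x)" if "g \<in> \<Gamma>" "h \<in> \<Gamma>" for g h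
    using mult[OF that] subgroup.m_closed[OF assms that] by blast
  show "\<exists>e\<in>\<Gamma>. \<forall>x\<in>?S. e x = x"
    using one subgroup.one_closed[OF assms] by blast
  show "\<exists>h\<in>\<Gamma>. \<forall>x\<in>?S. h (g x) = x \<and> g (h x) = x" if g: "g \<in> \<Gamma>" for g
  proof -
    have i: "inv\<^bsub>Aff n\<^esub> g \<in> \<Gamma>" by (rule subgroup.m_inv_closed[OF assms g])
    have "inv\<^bsub>Aff n\<^esub> g \<otimes>\<^bsub>Aff n\<^esub> g = \<one>\<^bsub>Aff n\<^esub>" "g \<otimes>\<^bsub>Aff n\<^esub> inv\<^bsub>Aff n\<^esub> g = \<one>\<^bsub>Aff n\<^esub>"
      using g \<Gamma> G.l_inv G.r_inv by blast+
    then show ?thesis using mult[OF i g] mult[OF g i] one i by (metis (no_types))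
  qed
qed

section \<open>Quasifold charts\<close>

text \<open>A chart seen from above: \<open>\<pi>\<close> is the projection of \<open>V\<close> to
  \<open>V/\<Gamma>\<close> followed by the inverse of the given diffeomorphism. Its fibres are the
  orbits in \<open>V\<close>, and the last clause says that it is a subduction onto
  \<open>U\<close>, so plots lift locally.\<close>

definition quasifold_chart ::
    "nat \<Rightarrow> 'a set \<Rightarrow> 'a diffeology \<Rightarrow> 'a set \<Rightarrow> (nat \<Rightarrow> real) set \<Rightarrow>
      ((nat \<Rightarrow> real) \<Rightarrow> (nat \<Rightarrow> real)) set \<Rightarrow> ((nat \<Rightarrow> real) \<Rightarrow> 'a) \<Rightarrow> bool" where
  "quasifold_chart n X D U V \<Gamma> \<pi> \<longleftrightarrow>
     openin (D_topology X D) U \<and> openin (\<R> n) V \<and> countable \<Gamma> \<and>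
     (\<forall>g\<in>\<Gamma>. affine_map n g \<and> g ` V \<subseteq> V \<and> (\<exists>h\<in>\<Gamma>. \<forall>x\<in>topspace (\<R> n). h (g x) = x \<and> g (h x) = x)) \<and>
     D n V \<pi> \<and> \<pi> ` V = U \<and>
     (\<forall>v\<in>V. \<forall>w\<in>V. \<pi> v = \<pi> w \<longleftrightarrow> (\<exists>g\<in>\<Gamma>. w = g v)) \<and>
     (\<forall>k W p. D k W p \<and> p \<in> W \<rightarrow> U \<longrightarrow>
       (\<forall>x\<in>W. \<exists>W' q. openin (\<R> k) W' \<and> x \<in> W' \<and> W' \<subseteq> W \<and> smooth_map k W' n q \<and> q \<in> W' \<rightarrow> V \<and>
         (\<forall>y\<in>W'. p y = \<pi> (q y))))"

text \<open>The projection \<open>V \<rightarrow> V/\<Gamma>\<close> is a plot of the quotient,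
  lifted by the identity, so composing it with the smooth inverse of \<open>F\<close> gives a plot.
  Conversely a plot \<open>p\<close> in \<open>U\<close> is lifted by lifting
  \<open>F \<circ> p\<close>, a plot of the quotient.\<close>

lemma quasifold_chart_of_diffeomorphism:
  assumes D: "diffeological_space X D" and U: "openin (D_topology X D) U"
    and \<Gamma>: "subgroup \<Gamma> (Aff n)" "countable \<Gamma>"
    and V: "openin (\<R> n) V" "\<And>g. g \<in> \<Gamma> \<Longrightarrow> g ` V \<subseteq> V"
    and F: "diffeomorphism U (subset_diffeology D U) (V // orbit_relation \<Gamma> V)
      (quotient_diffeology (subset_diffeology (Cartesian_diffeology n) V) (orbit_relation \<Gamma> V)) F"
  shows "\<exists>\<pi>. quasifold_chart n X D U V \<Gamma> \<pi>"
proof -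
  let ?r = "orbit_relation \<Gamma> V"
  let ?E = "quotient_diffeology (subset_diffeology (Cartesian_diffeology n) V) ?r"
  define \<pi> where "\<pi> v = inv_into U F (?r `` {v})" for v
  have VS: "V \<subseteq> topspace (\<R> n)" using V(1) openin_subset by blast
  have bij: "bij_betw F U (V // ?r)"
    and F1: "dsmooth (subset_diffeology D U) ?E F" and F2: "dsmooth ?E (subset_diffeology D U) (inv_into U F)"
    using F by (auto simp: diffeomorphism_def)
  have cls: "?r `` {v} = {w\<in>V. \<exists>g\<in>\<Gamma>. w = g v}" if "v \<in> V" for v
    using that by (auto simp: orbit_relation_def)
  have eq: "?r `` {v} = ?r `` {w} \<longleftrightarrow> (\<exists>g\<in>\<Gamma>. w = g v)" if v: "v \<in> V" and w: "w \<in> V" for v w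
  proof
    assume "?r `` {v} = ?r `` {w}"
    moreover have "w \<in> ?r `` {w}"
    proof -
      obtain e where e: "e \<in> \<Gamma>" "\<forall>x\<in>topspace (\<R> n). e x = x" using subgroup_Aff(3)[OF \<Gamma>(1)] by blast
      then have "w = e w" using w VS by auto
      then show ?thesis using cls[OF w] w e(1) by blast
    qed
    ultimately show "\<exists>g\<in>\<Gamma>. w = g v" using cls[OF v] by blast
  next
    assume "\<exists>g\<in>\<Gamma>. w = g v"
    then obtain g where g: "g \<in> \<Gamma>" "w = g v" by blast
    obtain h where h: "h \<in> \<Gamma>" "\<forall>x\<in>topspace (\<R> n). h (g x) = x"
      using subgroup_Aff(4)[OF \<Gamma>(1) g(1)] by blast
    have "(\<exists>k\<in>\<Gamma>. u = k v) \<longleftrightarrow> (\<exists>k\<in>\<Gamma>. u = k w)" for u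
    proof
      assume "\<exists>k\<in>\<Gamma>. u = k v"
      then obtain k where k: "k \<in> \<Gamma>" "u = k v" by blast
      obtain l where l: "l \<in> \<Gamma>" "\<forall>x\<in>topspace (\<R> n). l x = k (h x)"
        using subgroup_Aff(2)[OF \<Gamma>(1) k(1) h(1)] by blast
      have "l w = k (h w)" "h w = v" using l(2) h(2) g(2) v w VS by auto
      then show "\<exists>k\<in>\<Gamma>. u = k w" using k l(1) by (intro bexI[of _ l]) auto
    next
      assume "\<exists>k\<in>\<Gamma>. u = k w"
      then obtain k where k: "k \<in> \<Gamma>" "u = k w" by blast
      obtain l where l: "l \<in> \<Gamma>" "\<forall>x\<in>topspace (\<R> n). l x = k (g x)"
        using subgroup_Aff(2)[OF \<Gamma>(1) k(1) g(1)] by blast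
      have "l v = k w" using l(2) g(2) v VS by auto
      then show "\<exists>k\<in>\<Gamma>. u = k v" using k l(1) by (intro bexI[of _ l]) auto
    qed
    then show "?r `` {v} = ?r `` {w}" using cls v w by simp
  qed
  have "?E n V (\<lambda>v. ?r `` {v})"
    unfolding quotient_diffeology_def subset_diffeology_def Cartesian_diffeology_def
  proof (intro conjI ballI)
    fix v assume "v \<in> V"
    then show "\<exists>W q. openin (\<R> n) W \<and> v \<in> W \<and> W \<subseteq> V \<and> (smooth_map n W n q \<and> q \<in> W \<rightarrow> V) \<and>
        (\<forall>y\<in>W. ?r `` {y} = ?r `` {q y})"
      using V(1) smooth_map_id[OF V(1)] by (intro exI[of _ V] exI[of _ "\<lambda>x. x"]) auto
  qed (rule V(1))
  then have "subset_diffeology D U n V (inv_into U F \<circ> (\<lambda>v. ?r `` {v}))"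
    using F2 unfolding dsmooth_def by blast
  then have plot: "D n V \<pi>"
    by (simp add: subset_diffeology_def \<pi>_def[abs_def] comp_def)
  have quo: "?r `` {v} \<in> V // ?r" if "v \<in> V" for v
    using that by (auto simp: quotient_def)
  have "\<pi> v = \<pi> w \<longleftrightarrow> ?r `` {v} = ?r `` {w}" if "v \<in> V" "w \<in> V" for v w
    unfolding \<pi>_def using quo[OF that(1)] quo[OF that(2)] bij inv_into_injective
    by (metis bij_betw_imp_surj_on)
  then have fib: "\<forall>v\<in>V. \<forall>w\<in>V. \<pi> v = \<pi> w \<longleftrightarrow> (\<exists>g\<in>\<Gamma>. w = g v)" using eq by blast
  have img: "\<pi> ` V = U"
  proof -
    have "\<pi> ` V = inv_into U F ` (V // ?r)"
      by (auto simp: \<pi>_def quotient_def image_iff)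
    then show ?thesis using bij_betw_inv_into[OF bij] by (simp add: bij_betw_def)
  qed
  have lift: "\<exists>W' q. openin (\<R> k) W' \<and> x \<in> W' \<and> W' \<subseteq> W \<and> smooth_map k W' n q \<and> q \<in> W' \<rightarrow> V \<and> (\<forall>y\<in>W'. p y = \<pi> (q y))"
    if p: "D k W p" "p \<in> W \<rightarrow> U" and x: "x \<in> W" for k W p x
  proof -
    have "?E k W (F \<circ> p)" using p F1 by (simp add: dsmooth_def subset_diffeology_def)
    then obtain W' q where W': "openin (\<R> k) W'" "x \<in> W'" "W' \<subseteq> W" "smooth_map k W' n q" "q \<in> W' \<rightarrow> V"
      "\<forall>y\<in>W'. (F \<circ> p) y = ?r `` {q y}"
      using x unfolding quotient_diffeology_def subset_diffeology_def Cartesian_diffeology_def by blast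
    have "p y = \<pi> (q y)" if "y \<in> W'" for y
    proof -
      have "p y \<in> U" using that W'(3) p(2) by auto
      then have "inv_into U F (F (p y)) = p y" using bij by (simp add: bij_betw_def)
      then show ?thesis using W'(6) that by (simp add: \<pi>_def)
    qed
    then show ?thesis using W' by blast
  qed
  have "quasifold_chart n X D U V \<Gamma> \<pi>"
    unfolding quasifold_chart_def
  proof (intro conjI U V(1) \<Gamma>(2) plot img fib ballI allI impI; (elim conjE)?)
    fix g assume g: "g \<in> \<Gamma>"
    show "affine_map n g" "g ` V \<subseteq> V" "\<exists>h\<in>\<Gamma>. \<forall>x\<in>topspace (\<R> n). h (g x) = x \<and> g (h x) = x"
      using subgroup_Aff(1,4)[OF \<Gamma>(1) g] V(2)[OF g] by auto
  next
    fix k W p x assume "x \<in> W" "D k W p" "p \<in> W \<rightarrow> U"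
    then show "\<exists>W' q. openin (\<R> k) W' \<and> x \<in> W' \<and> W' \<subseteq> W \<and> smooth_map k W' n q \<and> q \<in> W' \<rightarrow> V \<and> (\<forall>y\<in>W'. p y = \<pi> (q y))"
      by (intro lift)
  qed
  then show ?thesis by blast
qed

text \<open>Filler that allows the charts to be indexed by all natural numbers, however few there
  are.\<close>

lemma quasifold_chart_empty:
  assumes "diffeological_space X D"
  shows "quasifold_chart n X D {} {} {} \<pi>"
  using diffeological_space.locally_constant_plot[OF assms, of n "{}" \<pi>] by (auto simp: quasifold_chart_def)

section \<open>Diffeological spaces with countably many quasifold charts\<close>

locale charted_quasifold = diffeological_space X D for X :: "'a set" and D :: "'a diffeology" +
  fixes n :: nat and V :: "nat \<Rightarrow> (nat \<Rightarrow> real) set"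
    and \<Gamma> :: "nat \<Rightarrow> ((nat \<Rightarrow> real) \<Rightarrow> (nat \<Rightarrow> real)) set"
    and \<pi> :: "nat \<Rightarrow> (nat \<Rightarrow> real) \<Rightarrow> 'a"
  assumes chart: "quasifold_chart n X D (\<pi> i ` V i) (V i) (\<Gamma> i) (\<pi> i)"
    and cover: "X = (\<Union>i. \<pi> i ` V i)"

text \<open>Second countability of the D-topology gives the Lindelof property, hence countably many
  chart domains that cover \<open>X\<close>. The countability of the atlas of the manifold rests on
  this.\<close>

lemma quasifold_imp_charted:
  assumes "diffeological_quasifold n X D"
  shows "\<exists>V \<Gamma> \<pi>. charted_quasifold X D n V \<Gamma> \<pi>"
proof -
  have D: "diffeological_space X D" and sc: "second_countable (D_topology X D)"
    using assms by (auto simp: diffeological_quasifold_def)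
  have top: "topspace (D_topology X D) = X"
  proof -
    have "{x\<in>U. p x \<in> X} = U" if "D k U p" for k U p
      using diffeological_space.plot_range[OF D that] by auto
    then have "openin (D_topology X D) X"
      using diffeological_space.plot_openin[OF D] by (simp add: openin_D_topology)
    then show ?thesis
      using openin_subset openin_topspace[of "D_topology X D"] openin_D_topology[of X D] by blast
  qed
  define \<U> where "\<U> = {U. \<exists>V \<Gamma> \<pi>. quasifold_chart n X D U V \<Gamma> \<pi>}"
  have cov: "\<exists>U\<in>\<U>. x \<in> U" if "x \<in> X" for x
  proof -
    have "\<exists>U \<Gamma> V F. openin (D_topology X D) U \<and> x \<in> U \<and> subgroup \<Gamma> (Aff n) \<and> countable \<Gamma> \<and>
        openin (\<R> n) V \<and> (\<forall>g\<in>\<Gamma>. g ` V \<subseteq> V) \<and>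
        diffeomorphism U (subset_diffeology D U) (V // orbit_relation \<Gamma> V)
          (quotient_diffeology (subset_diffeology (Cartesian_diffeology n) V) (orbit_relation \<Gamma> V)) F"
      using assms unfolding diffeological_quasifold_def by (elim conjE) (erule bspec[OF _ that])
    then show ?thesis
    proof (elim exE conjE)
      fix U \<Gamma> V F
      assume "openin (D_topology X D) U" "x \<in> U" "subgroup \<Gamma> (Aff n)" "countable \<Gamma>" "openin (\<R> n) V"
        "\<forall>g\<in>\<Gamma>. g ` V \<subseteq> V" "diffeomorphism U (subset_diffeology D U) (V // orbit_relation \<Gamma> V)
          (quotient_diffeology (subset_diffeology (Cartesian_diffeology n) V) (orbit_relation \<Gamma> V)) F"
      then have "\<exists>\<pi>. quasifold_chart n X D U V \<Gamma> \<pi>"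
        by (intro quasifold_chart_of_diffeomorphism[OF D]) auto
      then show ?thesis using \<open>x \<in> U\<close> by (intro bexI[of _ U]) (auto simp: \<U>_def)
    qed
  qed
  have op: "openin (D_topology X D) U" if "U \<in> \<U>" for U
    using that by (auto simp: quasifold_chart_def \<U>_def)
  have "U \<subseteq> X" if "U \<in> \<U>" for U
    using openin_subset[OF op[OF that]] top by simp
  then have "\<Union>\<U> = topspace (D_topology X D)"
    using top cov by auto
  then have "\<exists>\<V>. countable \<V> \<and> \<V> \<subseteq> \<U> \<and> \<Union>\<V> = topspace (D_topology X D)"
    using Lindelof_spaceD[OF second_countable_imp_Lindelof_space[OF sc], of \<U>] op by blast
  then obtain \<V> where \<V>: "countable \<V>" "\<V> \<subseteq> \<U>" "\<Union>\<V> = X"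
    using top by auto
  \<comment> \<open>The empty domain makes the enumerated set nonempty even when \<open>X\<close> is
    empty.\<close>
  define U where "U = from_nat_into (insert {} \<V>)"
  have rng: "range U = insert {} \<V>"
    unfolding U_def using \<V>(1) by (intro range_from_nat_into) auto
  have "\<exists>V \<Gamma> \<pi>. quasifold_chart n X D (U i) V \<Gamma> \<pi>" for i
  proof (cases "U i = {}")
    case True
    have "quasifold_chart n X D (U i) {} {} (\<lambda>_. undefined)"
      unfolding True by (rule quasifold_chart_empty[OF D])
    then show ?thesis by blast
  next
    case False
    have "U i \<in> insert {} \<V>" using rng by blast
    then have "U i \<in> \<U>" using False \<V>(2) by blast
    then show ?thesis by (simp add: \<U>_def)
  qed
  then obtain V \<Gamma> \<pi> where *: "\<And>i. quasifold_chart n X D (U i) (V i) (\<Gamma> i) (\<pi> i)"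
    by metis
  have img: "\<pi> i ` V i = U i" for i using * by (simp add: quasifold_chart_def)
  have "charted_quasifold X D n V \<Gamma> \<pi>"
  proof (intro charted_quasifold.intro charted_quasifold_axioms.intro D)
    show "quasifold_chart n X D (\<pi> i ` V i) (V i) (\<Gamma> i) (\<pi> i)" for i using * img by simp
    have "(\<Union>i. U i) = X" using rng \<V>(3) by auto
    then show "X = (\<Union>i. \<pi> i ` V i)" using img by simp
  qed
  then show ?thesis by blast
qed

context charted_quasifold
begin

lemma V_open: "openin (\<R> n) (V i)" and \<Gamma>_countable: "countable (\<Gamma> i)"
  and \<pi>_plot: "D n (V i) (\<pi> i)"
  using chart[of i] by (simp_all add: quasifold_chart_def)

lemma V_top: "v \<in> V i \<Longrightarrow> v \<in> topspace (\<R> n)"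
  using V_open openin_subset by blast

lemma \<Gamma>_affine: "g \<in> \<Gamma> i \<Longrightarrow> affine_map n g"
  and \<Gamma>_V: "g \<in> \<Gamma> i \<Longrightarrow> v \<in> V i \<Longrightarrow> g v \<in> V i"
  and \<Gamma>_inverse: "g \<in> \<Gamma> i \<Longrightarrow> \<exists>h\<in>\<Gamma> i. \<forall>x\<in>topspace (\<R> n). h (g x) = x \<and> g (h x) = x"
  using chart[of i] by (auto simp: quasifold_chart_def)

lemma \<pi>_eq_iff: "v \<in> V i \<Longrightarrow> w \<in> V i \<Longrightarrow> \<pi> i v = \<pi> i w \<longleftrightarrow> (\<exists>g\<in>\<Gamma> i. w = g v)"
  using chart[of i] unfolding quasifold_chart_def by blast

section \<open>Lifting plots through charts, and local diffeomorphisms over \<open>X\<close>\<close>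

lemma restrict_plot:
  assumes "D k U p" "openin (\<R> k) U'" "U' \<subseteq> U"
  shows "D k U' p"
  using plot_compose[OF assms(1) smooth_map_id[OF assms(2)]] assms(3) by (auto simp: comp_def)

text \<open>A plot need not stay inside the chart domain; since the domain is D-open, its preimage
  is open and the plot may be restricted to it before lifting.\<close>

lemma plot_lift:
  assumes p: "D k U p" and x: "x \<in> U" "p x \<in> \<pi> i ` V i"
  obtains W q where "openin (\<R> k) W" "x \<in> W" "W \<subseteq> U" "smooth_map k W n q" "q \<in> W \<rightarrow> V i"
    "\<And>y. y \<in> W \<Longrightarrow> p y = \<pi> i (q y)"
proof -
  let ?U = "{y\<in>U. p y \<in> \<pi> i ` V i}"
  have "openin (D_topology X D) (\<pi> i ` V i)"
    using chart[of i] by (simp add: quasifold_chart_def)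
  then have "openin (\<R> k) ?U" using p unfolding openin_D_topology by blast
  then have "D k ?U p" using restrict_plot[OF p] by blast
  moreover have "p \<in> ?U \<rightarrow> \<pi> i ` V i" "x \<in> ?U" using x by auto
  moreover have "\<forall>k W p. D k W p \<and> p \<in> W \<rightarrow> \<pi> i ` V i \<longrightarrow>
       (\<forall>x\<in>W. \<exists>W' q. openin (\<R> k) W' \<and> x \<in> W' \<and> W' \<subseteq> W \<and> smooth_map k W' n q \<and> q \<in> W' \<rightarrow> V i \<and>
         (\<forall>y\<in>W'. p y = \<pi> i (q y)))"
    using chart[of i] unfolding quasifold_chart_def by (elim conjE)
  ultimately have "\<exists>W' q. openin (\<R> k) W' \<and> x \<in> W' \<and> W' \<subseteq> ?U \<and> smooth_map k W' n q \<and> q \<in> W' \<rightarrow> V i \<and>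
         (\<forall>y\<in>W'. p y = \<pi> i (q y))" by (elim allE[of _ k] allE[of _ ?U] allE[of _ p]) blast
  then obtain W q where "openin (\<R> k) W" "x \<in> W" "W \<subseteq> ?U" "smooth_map k W n q" "q \<in> W \<rightarrow> V i"
    "\<forall>y\<in>W. p y = \<pi> i (q y)" by (elim exE conjE)
  then show thesis using that by blast
qed

definition local_diffeo ::
    "nat \<Rightarrow> nat \<Rightarrow> (nat \<Rightarrow> real) set \<Rightarrow> ((nat \<Rightarrow> real) \<Rightarrow> nat \<Rightarrow> real) \<Rightarrow> ((nat \<Rightarrow> real) \<Rightarrow> nat \<Rightarrow> real) \<Rightarrow> bool" where
  "local_diffeo i j A h g \<longleftrightarrow> A \<subseteq> V i \<and> smooth_map n A n h \<and> h ` A \<subseteq> V j \<and> smooth_map n (h ` A) n g \<and>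
     (\<forall>a\<in>A. g (h a) = a \<and> \<pi> j (h a) = \<pi> i a)"

text \<open>The image of the smaller set is its preimage under the smooth inverse \<open>g\<close>,
  hence open.\<close>

lemma local_diffeo_subset:
  assumes h: "local_diffeo i j A h g" and A': "openin (\<R> n) A'" "A' \<subseteq> A"
  shows "local_diffeo i j A' h g"
proof -
  have g: "smooth_map n (h ` A) n g" using h by (simp add: local_diffeo_def)
  have "h ` A' = {b\<in>h ` A. g b \<in> A'}"
    using h A'(2) by (force simp: local_diffeo_def)
  then have "openin (\<R> n) (h ` A')" using smooth_map_preimage[OF g A'(1)] by simp
  moreover have "h ` A' \<subseteq> h ` A" using A'(2) by blast
  ultimately show ?thesis
    using h A' smooth_map_subset[of n A n h A'] smooth_map_subset[OF g, of "h ` A'"]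
    unfolding local_diffeo_def by blast
qed

lemma local_diffeo_\<Gamma>:
  assumes g: "g \<in> \<Gamma> i"
  obtains g' where "local_diffeo i i (V i) g g'"
proof -
  obtain h where h: "h \<in> \<Gamma> i" "\<forall>x\<in>topspace (\<R> n). h (g x) = x \<and> g (h x) = x"
    using \<Gamma>_inverse[OF g] by blast
  have img: "g ` V i = V i"
    using \<Gamma>_V[OF g] \<Gamma>_V[OF h(1)] h(2) V_top by (force simp: image_iff)
  have sm: "smooth_map n (V i) n k" if "k \<in> \<Gamma> i" for k
    using smooth_map_subset[OF smooth_map_affine[OF \<Gamma>_affine[OF that]] V_open] V_top by blast
  have "\<pi> i (g a) = \<pi> i a" if "a \<in> V i" for a
    using \<pi>_eq_iff[OF that \<Gamma>_V[OF g that]] g by auto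
  then have "local_diffeo i i (V i) g h"
    unfolding local_diffeo_def using img sm[OF g] sm[OF h(1)] h(2) V_top by auto
  then show thesis using that by blast
qed

text \<open>
  Lifts \<open>h\<close> of \<open>\<pi> i\<close> through \<open>\<pi> j\<close> and \<open>k\<close> of \<open>\<pi> j\<close> through \<open>\<pi> i\<close> compose, in either order, to maps
  that pointwise belong to the affine group, hence to affine maps; so \<open>k\<close>, corrected by a group
  element, is a local inverse of \<open>h\<close>.
\<close>

lemma local_diffeo_exists:
  assumes v: "v \<in> V i" and w: "\<pi> i v \<in> \<pi> j ` V j"
  obtains A h g where "v \<in> A" "local_diffeo i j A h g"
proof -
  obtain W0 h where h: "openin (\<R> n) W0" "v \<in> W0" "W0 \<subseteq> V i" "smooth_map n W0 n h" "h \<in> W0 \<rightarrow> V j"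
    "\<And>y. y \<in> W0 \<Longrightarrow> \<pi> i y = \<pi> j (h y)"
    using plot_lift[OF \<pi>_plot v w] by blast
  define y0 where "y0 = h v"
  have y0: "y0 \<in> V j" using h(2,5) unfolding y0_def by auto
  have "\<pi> j y0 = \<pi> i v" using h(2,6) by (simp add: y0_def)
  then have y0': "\<pi> j y0 \<in> \<pi> i ` V i" using v by simp
  obtain W1 k0 where k0: "openin (\<R> n) W1" "y0 \<in> W1" "W1 \<subseteq> V j" "smooth_map n W1 n k0" "k0 \<in> W1 \<rightarrow> V i"
    "\<And>y. y \<in> W1 \<Longrightarrow> \<pi> j y = \<pi> i (k0 y)"
    using plot_lift[OF \<pi>_plot y0 y0'] by blast
  have "openin (\<R> n) {a\<in>W0. h a \<in> W1}" by (rule smooth_map_preimage[OF h(4) k0(1)])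
  then obtain r where r: "r > 0" "cube n v r \<subseteq> {a\<in>W0. h a \<in> W1}"
    using open_contains_cube[of n _ v] h(2) k0(2) y0_def by (metis (no_types, lifting) mem_Collect_eq)
  let ?Q = "cube n v r"
  have vQ: "v \<in> ?Q" using centre_in_cube V_top[OF v] r(1) by blast
  have hQ: "smooth_map n ?Q n h" using smooth_map_subset[OF h(4) openin_cube] r(2) by blast
  have "smooth_map n ?Q n (\<lambda>a. k0 (h a))" using smooth_map_comp[OF hQ k0(4)] r(2) by auto
  moreover have "\<exists>\<gamma>\<in>\<Gamma> i. k0 (h a) = \<gamma> a" if "a \<in> ?Q" for a
  proof -
    have a: "a \<in> W0" "h a \<in> W1" using that r(2) by auto
    then have "\<pi> i a = \<pi> i (k0 (h a))" using h(6) k0(6) by simp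
    then show ?thesis using \<pi>_eq_iff[of a i "k0 (h a)"] a h(3) k0(5) by auto
  qed
  ultimately obtain \<gamma>1 where \<gamma>1: "\<gamma>1 \<in> \<Gamma> i" "\<And>a. a \<in> ?Q \<Longrightarrow> k0 (h a) = \<gamma>1 a"
    using smooth_locally_in_affine_family[of n v r "\<lambda>a. k0 (h a)" "\<Gamma> i"] V_top[OF v] r(1) \<Gamma>_countable \<Gamma>_affine
    by blast
  obtain \<gamma>1' where \<gamma>1': "\<gamma>1' \<in> \<Gamma> i" "\<And>x. x \<in> topspace (\<R> n) \<Longrightarrow> \<gamma>1' (\<gamma>1 x) = x"
    using \<Gamma>_inverse[OF \<gamma>1(1)] by blast
  \<comment> \<open>The composite \<open>k0 \<circ> h\<close> is a single group element
    \<open>\<gamma>1\<close> on the cube; undoing it makes \<open>k\<close> a left inverse of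
    \<open>h\<close> without moving points out of the fibres of \<open>\<pi> i\<close>.\<close>
  define k where "k y = \<gamma>1' (k0 y)" for y
  have ksm: "smooth_map n W1 n k"
    unfolding k_def using k0(5) V_top
    by (intro smooth_map_comp[OF k0(4) smooth_map_affine[OF \<Gamma>_affine[OF \<gamma>1'(1)]]]) auto
  have kV: "k y \<in> V i" if "y \<in> W1" for y
    unfolding k_def using \<Gamma>_V[OF \<gamma>1'(1)] k0(5) that by auto
  have k\<pi>: "\<pi> i (k y) = \<pi> j y" if "y \<in> W1" for y
  proof -
    have "k0 y \<in> V i" using that k0(5) by auto
    then have "\<pi> i (k0 y) = \<pi> i (k y)"
      using \<pi>_eq_iff[of "k0 y" i "k y"] kV[OF that] \<gamma>1'(1) k_def by blast
    then show ?thesis using k0(6)[OF that] by simp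
  qed
  have kh: "k (h a) = a" if "a \<in> ?Q" for a
    using \<gamma>1(2)[OF that] \<gamma>1'(2)[of a] that unfolding k_def by (auto simp: cube_def)
  have ky0: "k y0 = v" using kh[OF vQ] y0_def by simp
  have "openin (\<R> n) {b\<in>W1. k b \<in> ?Q}" by (rule smooth_map_preimage[OF ksm openin_cube])
  moreover have "y0 \<in> {b\<in>W1. k b \<in> ?Q}" using k0(2) ky0 vQ by simp
  ultimately obtain s where s: "s > 0" "cube n y0 s \<subseteq> {b\<in>W1. k b \<in> ?Q}"
    using open_contains_cube by blast
  let ?R = "cube n y0 s"
  have yR: "y0 \<in> ?R" using centre_in_cube V_top[OF y0] s(1) by blast
  have kR: "smooth_map n ?R n k" using smooth_map_subset[OF ksm openin_cube] s(2) by blast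
  have hkR: "smooth_map n ?R n (\<lambda>b. h (k b))" using smooth_map_comp[OF kR hQ] s(2) by auto
  moreover have "\<exists>\<gamma>\<in>\<Gamma> j. h (k b) = \<gamma> b" if "b \<in> ?R" for b
  proof -
    have b: "b \<in> W1" "k b \<in> W0" using that s(2) r(2) by auto
    then have "\<pi> j b = \<pi> j (h (k b))" using h(6)[OF b(2)] k\<pi>[OF b(1)] by simp
    then show ?thesis using \<pi>_eq_iff[of b j "h (k b)"] b k0(3) h(5) by auto
  qed
  ultimately obtain \<gamma>2 where \<gamma>2: "\<gamma>2 \<in> \<Gamma> j" "\<And>b. b \<in> ?R \<Longrightarrow> h (k b) = \<gamma>2 b"
    using smooth_locally_in_affine_family[of n y0 s "\<lambda>b. h (k b)" "\<Gamma> j"] V_top[OF y0] s(1) \<Gamma>_countable \<Gamma>_affine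
    by blast
  obtain \<gamma>2' where \<gamma>2': "\<And>x. x \<in> topspace (\<R> n) \<Longrightarrow> \<gamma>2' (\<gamma>2 x) = x"
    using \<Gamma>_inverse[OF \<gamma>2(1)] by blast
  \<comment> \<open>On \<open>?R\<close> the map \<open>h \<circ> k\<close> is a group element
    \<open>\<gamma>2\<close>, and it is idempotent because \<open>k \<circ> h\<close> is the
    identity. Requiring that \<open>h (k b)\<close> lie in \<open>?R\<close> allows
    \<open>\<gamma>2\<close> to be applied twice; an idempotent injective map is the
    identity.\<close>
  define N where "N = {b\<in>?R. h (k b) \<in> ?R}"
  have N: "openin (\<R> n) N" unfolding N_def by (rule smooth_map_preimage[OF hkR openin_cube])
  have yN: "y0 \<in> N" using yR ky0 y0_def by (simp add: N_def)
  have hk: "h (k b) = b" if "b \<in> N" for b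
  proof -
    have b: "b \<in> ?R" "h (k b) \<in> ?R" "k b \<in> ?Q" using that s(2) by (auto simp: N_def)
    have "\<gamma>2 (\<gamma>2 b) = h (k (h (k b)))" using \<gamma>2(2)[OF b(1)] \<gamma>2(2)[OF b(2)] by simp
    also have "\<dots> = \<gamma>2 b" using kh[OF b(3)] \<gamma>2(2)[OF b(1)] by simp
    finally have "\<gamma>2' (\<gamma>2 (\<gamma>2 b)) = \<gamma>2' (\<gamma>2 b)" by simp
    moreover have "b \<in> topspace (\<R> n)" "\<gamma>2 b \<in> topspace (\<R> n)"
      using b \<gamma>2(2)[OF b(1)] by (auto simp: cube_def)
    ultimately show ?thesis using \<gamma>2' \<gamma>2(2)[OF b(1)] by simp
  qed
  \<comment> \<open>The preimage of \<open>N\<close> is taken so that the image of the domain is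
    exactly the open set \<open>N\<close>.\<close>
  define A where "A = {a\<in>?Q. h a \<in> N}"
  have A: "openin (\<R> n) A" unfolding A_def by (rule smooth_map_preimage[OF hQ N])
  have "h ` A = N"
  proof
    show "N \<subseteq> h ` A"
    proof
      fix b assume b: "b \<in> N"
      then have "k b \<in> ?Q" using s(2) by (auto simp: N_def)
      then show "b \<in> h ` A" using hk[OF b] b by (force simp: A_def)
    qed
  qed (auto simp: A_def)
  moreover have "N \<subseteq> W1" "A \<subseteq> ?Q" "N \<subseteq> V j" using s(2) k0(3) by (auto simp: N_def A_def)
  ultimately have "local_diffeo i j A h k"
    unfolding local_diffeo_def
    using smooth_map_subset[OF hQ A] smooth_map_subset[OF ksm N] kh h(3,6) r(2) by auto
  moreover have "v \<in> A" using vQ yN y0_def by (simp add: A_def)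
  ultimately show thesis using that by blast
qed

text \<open>Local diffeomorphisms over \<open>X\<close> may be uncountably many. One is chosen for
  each pair of charts and each basic open set that carries one, and the elements of all
  \<open>\<Gamma> j\<close> are added. An identification of \<open>v\<close> with \<open>w\<close>
  then takes two steps: the chosen map on a basic neighbourhood of \<open>v\<close> reaches some
  point in the orbit of \<open>w\<close>, and a group element carries that point to
  \<open>w\<close>.\<close>

lemma countable_local_diffeos:
  obtains src dst A h g where
    "\<And>k :: nat. local_diffeo (src k) (dst k) (A k) (h k) (g k)"
    "\<And>i j v w. v \<in> V i \<Longrightarrow> w \<in> V j \<Longrightarrow> \<pi> i v = \<pi> j w \<Longrightarrow>
      \<exists>k l. src k = i \<and> dst k = j \<and> v \<in> A k \<and> src l = j \<and> dst l = j \<and> h k v \<in> A l \<and> h l (h k v) = w"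
proof -
  obtain \<B> where \<B>: "countable \<B>" "\<And>B. B \<in> \<B> \<Longrightarrow> openin (\<R> n) B"
    "\<And>U x. openin (\<R> n) U \<Longrightarrow> x \<in> U \<Longrightarrow> \<exists>B\<in>\<B>. x \<in> B \<and> B \<subseteq> U"
    using Euclidean_countable_basis by blast
  define P where "P = (\<lambda>(i, j, A, h, g). local_diffeo i j A h g)"
  define c1 where "c1 = (\<lambda>(i, j, A). (i, j, A, SOME hg. local_diffeo i j A (fst hg) (snd hg)))"
  define c2 where "c2 = (\<lambda>(i, \<gamma>). (i, i, V i, \<gamma>, SOME g. local_diffeo i i (V i) \<gamma> g))"
  define K1 where "K1 = {(i, j, A). A \<in> \<B> \<and> (\<exists>h g. local_diffeo i j A h g)}"
  \<comment> \<open>The map with empty domain keeps \<open>K\<close> nonempty, as its enumeration by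
    all natural numbers requires.\<close>
  define K where "K = insert (0, 0, {}, \<lambda>x. x, \<lambda>x. x) (c1 ` K1 \<union> c2 ` (SIGMA i:UNIV. \<Gamma> i))"
  have "countable K1"
  proof -
    have "K1 \<subseteq> UNIV \<times> UNIV \<times> \<B>" by (auto simp: K1_def)
    then show ?thesis by (rule countable_subset) (use \<B>(1) in auto)
  qed
  then have K: "countable K" "K \<noteq> {}" using \<Gamma>_countable by (auto simp: K_def)
  have c1: "P (c1 (i, j, A))" if "(i, j, A) \<in> K1" for i j A
  proof -
    have "\<exists>hg. local_diffeo i j A (fst hg) (snd hg)" using that by (auto simp: K1_def)
    then have "local_diffeo i j A (fst (SOME hg. local_diffeo i j A (fst hg) (snd hg)))
        (snd (SOME hg. local_diffeo i j A (fst hg) (snd hg)))" by (rule someI_ex)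
    then show ?thesis by (simp add: P_def c1_def split_beta)
  qed
  have c2: "P (c2 (i, \<gamma>))" if "\<gamma> \<in> \<Gamma> i" for i \<gamma>
  proof -
    have "\<exists>g. local_diffeo i i (V i) \<gamma> g" using local_diffeo_\<Gamma>[OF that] by blast
    then have "local_diffeo i i (V i) \<gamma> (SOME g. local_diffeo i i (V i) \<gamma> g)" by (rule someI_ex)
    then show ?thesis by (simp add: P_def c2_def)
  qed
  have "P (0, 0, {}, \<lambda>x. x, \<lambda>x. x)"
    by (auto simp: P_def local_diffeo_def smooth_map_id)
  then have PK: "P t" if "t \<in> K" for t using that c1 c2 by (auto simp: K_def)
  define f where "f = from_nat_into K"
  have rng: "range f = K" unfolding f_def by (rule range_from_nat_into[OF K(2,1)])
  define src where "src k = fst (f k)" for k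
  define dst where "dst k = fst (snd (f k))" for k
  define A where "A k = fst (snd (snd (f k)))" for k
  define h where "h k = fst (snd (snd (snd (f k))))" for k
  define g where "g k = snd (snd (snd (snd (f k))))" for k
  note defs = src_def dst_def A_def h_def g_def
  have 1: "local_diffeo (src k) (dst k) (A k) (h k) (g k)" for k
  proof -
    have "P (f k)" using PK rng by blast
    then show ?thesis by (simp add: P_def defs split_beta)
  qed
  have 2: "\<exists>k l. src k = i \<and> dst k = j \<and> v \<in> A k \<and> src l = j \<and> dst l = j \<and> h k v \<in> A l \<and> h l (h k v) = w"
    if v: "v \<in> V i" and w: "w \<in> V j" and vw: "\<pi> i v = \<pi> j w" for i j v w
  proof -
    obtain A0 h0 g0 where A0: "v \<in> A0" "local_diffeo i j A0 h0 g0"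
      using local_diffeo_exists[OF v, of j] w vw by blast
    then have "openin (\<R> n) A0" using smooth_map_openin by (auto simp: local_diffeo_def)
    then obtain B where B: "B \<in> \<B>" "v \<in> B" "B \<subseteq> A0" using \<B>(3) A0(1) by blast
    then have "local_diffeo i j B h0 g0" using local_diffeo_subset[OF A0(2) \<B>(2)] by blast
    then have "(i, j, B) \<in> K1" using B(1) by (auto simp: K1_def)
    then have "c1 (i, j, B) \<in> K" by (simp add: K_def)
    then obtain k where k: "f k = c1 (i, j, B)" using rng by (metis rangeE)
    then have sk: "src k = i" "dst k = j" "A k = B" by (simp_all add: defs c1_def)
    then have "h k v \<in> V j" "\<pi> j (h k v) = \<pi> i v"
      using 1[of k] B(2) by (auto simp: local_diffeo_def)
    then obtain \<gamma> where \<gamma>: "\<gamma> \<in> \<Gamma> j" "w = \<gamma> (h k v)" using \<pi>_eq_iff[of "h k v" j w] w vw by auto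
    then have "c2 (j, \<gamma>) \<in> K" by (auto simp: K_def)
    then obtain l where l: "f l = c2 (j, \<gamma>)" using rng by (metis rangeE)
    then have sl: "src l = j" "dst l = j" "A l = V j" "h l = \<gamma>" by (simp_all add: defs c2_def)
    show ?thesis
      by (rule exI[of _ k], rule exI[of _ l]) (use sk sl B(2) \<open>h k v \<in> V j\<close> \<gamma>(2) in auto)
  qed
  from 1 2 show thesis by (rule that)
qed

end

section \<open>Foliated manifolds glued from open subsets of Cartesian spaces\<close>

text \<open>The parametrizations \<open>\<psi> c\<close> take values in one common type, and points
  are identified exactly when their images are equal; so there is no cocycle condition to verify.
  Separation of points is left to the application.\<close>

locale foliated_gluing =
  fixes m p :: nat and \<Omega> :: "'c::countable \<Rightarrow> (nat \<Rightarrow> real) set" and \<psi> :: "'c \<Rightarrow> (nat \<Rightarrow> real) \<Rightarrow> 'b"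
  assumes p_le_m: "p \<le> m" and \<Omega>_open: "openin (\<R> m) (\<Omega> c)" and \<psi>_inj: "inj_on (\<psi> c) (\<Omega> c)"
    and change: "\<lbrakk>z \<in> \<Omega> c; \<psi> c z \<in> \<psi> c' ` \<Omega> c'\<rbrakk> \<Longrightarrow>
      \<exists>N f k. openin (\<R> m) N \<and> z \<in> N \<and> N \<subseteq> \<Omega> c \<and> smooth_map m N m f \<and>
        (\<forall>w\<in>N. f w \<in> \<Omega> c' \<and> \<psi> c' (f w) = \<psi> c w \<and> transverse p (f w) = k (transverse p w))"
begin

definition carrier_set :: "'b set" where
  "carrier_set = (\<Union>c. \<psi> c ` \<Omega> c)"

definition glued_topology :: "'b topology" where
  "glued_topology = topology (\<lambda>A. A \<subseteq> carrier_set \<and> (\<forall>c. openin (\<R> m) {w\<in>\<Omega> c. \<psi> c w \<in> A}))"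

definition coordinates :: "'c \<Rightarrow> 'b chart" where
  "coordinates c = (\<psi> c ` \<Omega> c, inv_into (\<Omega> c) (\<psi> c))"

definition glued_atlas :: "'b chart set" where
  "glued_atlas = range coordinates"

lemma openin_glued: "openin glued_topology A \<longleftrightarrow> A \<subseteq> carrier_set \<and> (\<forall>c. openin (\<R> m) {w\<in>\<Omega> c. \<psi> c w \<in> A})"
proof -
  let ?P = "\<lambda>A. A \<subseteq> carrier_set \<and> (\<forall>c. openin (\<R> m) {w\<in>\<Omega> c. \<psi> c w \<in> A})"
  have "?P (A \<inter> B)" if "?P A" "?P B" for A B
  proof -
    have "{w\<in>\<Omega> c. \<psi> c w \<in> A \<inter> B} = {w\<in>\<Omega> c. \<psi> c w \<in> A} \<inter> {w\<in>\<Omega> c. \<psi> c w \<in> B}" for c by blast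
    with that show ?thesis by (auto intro: openin_Int)
  qed
  moreover have "?P (\<Union>\<K>)" if "\<forall>K\<in>\<K>. ?P K" for \<K>
  proof -
    have "{w\<in>\<Omega> c. \<psi> c w \<in> \<Union>\<K>} = (\<Union>K\<in>\<K>. {w\<in>\<Omega> c. \<psi> c w \<in> K})" for c by blast
    with that show ?thesis by (auto intro!: openin_Union)
  qed
  ultimately have "istopology ?P" unfolding istopology_def by blast
  then show ?thesis unfolding glued_topology_def by (simp add: topology_inverse')
qed

lemma topspace_glued: "topspace glued_topology = carrier_set"
proof -
  have "{w\<in>\<Omega> c. \<psi> c w \<in> carrier_set} = \<Omega> c" for c by (auto simp: carrier_set_def)
  then have "openin glued_topology carrier_set" using \<Omega>_open by (simp add: openin_glued)
  moreover have "topspace glued_topology \<subseteq> carrier_set" using openin_topspace openin_glued by blast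
  ultimately show ?thesis using openin_subset by blast
qed

lemma coord_\<psi>: "w \<in> \<Omega> c \<Longrightarrow> inv_into (\<Omega> c) (\<psi> c) (\<psi> c w) = w"
  using \<psi>_inj by simp

text \<open>Openness has to be tested in every other domain \<open>\<Omega> c'\<close>. There the
  set is locally the preimage of \<open>U\<close> under a smooth change of coordinates, and
  injectivity of \<open>\<psi> c\<close> ensures that this change hits \<open>U\<close> at the right
  points.\<close>

lemma openin_glued_image:
  assumes "openin (\<R> m) U" "U \<subseteq> \<Omega> c"
  shows "openin glued_topology (\<psi> c ` U)"
  unfolding openin_glued
proof (intro conjI allI)
  show "\<psi> c ` U \<subseteq> carrier_set" using assms(2) by (auto simp: carrier_set_def)
  fix c'
  have "\<exists>T. openin (\<R> m) T \<and> z \<in> T \<and> T \<subseteq> {w\<in>\<Omega> c'. \<psi> c' w \<in> \<psi> c ` U}"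
    if z: "z \<in> {w\<in>\<Omega> c'. \<psi> c' w \<in> \<psi> c ` U}" for z
  proof -
    have z': "z \<in> \<Omega> c'" "\<psi> c' z \<in> \<psi> c ` \<Omega> c" using z assms(2) by auto
    obtain N f where N: "openin (\<R> m) N" "z \<in> N" "N \<subseteq> \<Omega> c'" "smooth_map m N m f"
      "\<And>w. w \<in> N \<Longrightarrow> f w \<in> \<Omega> c \<and> \<psi> c (f w) = \<psi> c' w"
      using change[OF z'] by blast
    have "openin (\<R> m) {w\<in>N. f w \<in> U}" by (rule smooth_map_preimage[OF N(4) assms(1)])
    moreover have "f z \<in> U"
    proof -
      obtain u where u: "u \<in> U" "\<psi> c' z = \<psi> c u" using z by auto
      then have "\<psi> c (f z) = \<psi> c u" using N(5)[OF N(2)] by simp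
      then show ?thesis using u assms(2) N(5)[OF N(2)] \<psi>_inj[of c] by (metis inj_onD subsetD)
    qed
    moreover have "\<psi> c' w \<in> \<psi> c ` U" if "w \<in> N" "f w \<in> U" for w
      using N(5)[OF that(1)] that(2) by (metis imageI)
    ultimately show ?thesis using N(2,3) by (intro exI[of _ "{w\<in>N. f w \<in> U}"]) auto
  qed
  then show "openin (\<R> m) {w\<in>\<Omega> c'. \<psi> c' w \<in> \<psi> c ` U}" by (subst openin_subopen) blast
qed

lemma continuous_map_\<psi>: "continuous_map (subtopology (\<R> m) (\<Omega> c)) glued_topology (\<psi> c)"
proof -
  have "topspace (subtopology (\<R> m) (\<Omega> c)) = \<Omega> c" using \<Omega>_open openin_subset by fastforce
  moreover have "openin (subtopology (\<R> m) (\<Omega> c)) {x\<in>\<Omega> c. \<psi> c x \<in> U}" if "openin glued_topology U" for U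
    using that openin_open_subtopology[OF \<Omega>_open[of c]] by (auto simp: openin_glued)
  ultimately show ?thesis
    by (auto simp: continuous_map_def topspace_glued carrier_set_def)
qed

lemma homeomorphic_map_coord:
  "homeomorphic_map (subtopology glued_topology (\<psi> c ` \<Omega> c)) (subtopology (\<R> m) (\<Omega> c)) (inv_into (\<Omega> c) (\<psi> c))"
proof (rule homeomorphic_maps_imp_map)
  let ?\<phi> = "inv_into (\<Omega> c) (\<psi> c)"
  have W: "openin glued_topology (\<psi> c ` \<Omega> c)" using openin_glued_image \<Omega>_open by blast
  have t1: "topspace (subtopology (\<R> m) (\<Omega> c)) = \<Omega> c" using \<Omega>_open openin_subset by fastforce
  have t2: "topspace (subtopology glued_topology (\<psi> c ` \<Omega> c)) = \<psi> c ` \<Omega> c" using W openin_subset by fastforce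
  show "homeomorphic_maps (subtopology glued_topology (\<psi> c ` \<Omega> c)) (subtopology (\<R> m) (\<Omega> c)) ?\<phi> (\<psi> c)"
    unfolding homeomorphic_maps_def t1 t2
  proof (intro conjI ballI)
    show "continuous_map (subtopology glued_topology (\<psi> c ` \<Omega> c)) (subtopology (\<R> m) (\<Omega> c)) ?\<phi>"
      unfolding continuous_map_def t1 t2
    proof (intro conjI allI impI)
      show "?\<phi> \<in> \<psi> c ` \<Omega> c \<rightarrow> \<Omega> c" using coord_\<psi> by auto
      fix U assume "openin (subtopology (\<R> m) (\<Omega> c)) U"
      then have U: "openin (\<R> m) U" "U \<subseteq> \<Omega> c" using openin_open_subtopology[OF \<Omega>_open] by auto
      have "{x \<in> \<psi> c ` \<Omega> c. ?\<phi> x \<in> U} = \<psi> c ` U" using coord_\<psi> U(2) by force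
      then show "openin (subtopology glued_topology (\<psi> c ` \<Omega> c)) {x \<in> \<psi> c ` \<Omega> c. ?\<phi> x \<in> U}"
        using openin_glued_image[OF U] U(2) openin_open_subtopology[OF W] by (simp add: image_mono)
    qed
    show "continuous_map (subtopology (\<R> m) (\<Omega> c)) (subtopology glued_topology (\<psi> c ` \<Omega> c)) (\<psi> c)"
      using continuous_map_\<psi> t1 by (auto simp: continuous_map_in_subtopology)
  qed (use coord_\<psi> in auto)
qed

lemma is_chart_coordinates: "is_chart m glued_topology (coordinates c)"
proof -
  have "inv_into (\<Omega> c) (\<psi> c) ` \<psi> c ` \<Omega> c = \<Omega> c" using coord_\<psi> by force
  then show ?thesis
    using homeomorphic_map_coord openin_glued_image[of "\<Omega> c" c] \<Omega>_open
    by (simp add: is_chart_def coordinates_def)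
qed

lemma overlap_coordinates:
  "overlap (coordinates c) (coordinates c') = {w\<in>\<Omega> c. \<psi> c w \<in> \<psi> c' ` \<Omega> c'}"
  unfolding overlap_def coordinates_def using coord_\<psi> by force

lemma transition_coordinates:
  assumes "w \<in> \<Omega> c" "u \<in> \<Omega> c'" "\<psi> c' u = \<psi> c w"
  shows "transition (coordinates c) (coordinates c') w = u"
proof -
  have "inv_into (\<psi> c ` \<Omega> c) (inv_into (\<Omega> c) (\<psi> c)) w = \<psi> c w"
    by (rule inv_into_f_eq) (use assms(1) coord_\<psi> in \<open>auto simp: inj_on_inv_into\<close>)
  then show ?thesis
    using coord_\<psi>[OF assms(2)] assms(3) by (simp add: transition_def coordinates_def)
qed

lemma change_coordinates:
  assumes "z \<in> overlap (coordinates c) (coordinates c')"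
  obtains N k where "openin (\<R> m) N" "z \<in> N" "N \<subseteq> overlap (coordinates c) (coordinates c')"
    "smooth_map m N m (transition (coordinates c) (coordinates c'))"
    "\<And>w. w \<in> N \<Longrightarrow> transverse p (transition (coordinates c) (coordinates c') w) = k (transverse p w)"
proof -
  have z: "z \<in> \<Omega> c" "\<psi> c z \<in> \<psi> c' ` \<Omega> c'" using assms overlap_coordinates by auto
  obtain N f k where N: "openin (\<R> m) N" "z \<in> N" "N \<subseteq> \<Omega> c" "smooth_map m N m f"
    "\<And>w. w \<in> N \<Longrightarrow> f w \<in> \<Omega> c' \<and> \<psi> c' (f w) = \<psi> c w \<and> transverse p (f w) = k (transverse p w)"
    using change[OF z] by blast
  have tr: "transition (coordinates c) (coordinates c') w = f w" if "w \<in> N" for w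
    using transition_coordinates[of w c "f w" c'] N(3) N(5)[OF that] that by blast
  show thesis
  proof (rule that[OF N(1,2)])
    show "N \<subseteq> overlap (coordinates c) (coordinates c')"
      unfolding overlap_coordinates using N(3,5) by (force simp: image_iff)
    show "smooth_map m N m (transition (coordinates c) (coordinates c'))"
      using smooth_map_cong[OF N(4)] tr by blast
    show "\<And>w. w \<in> N \<Longrightarrow> transverse p (transition (coordinates c) (coordinates c') w) = k (transverse p w)"
      using tr N(5) by simp
  qed
qed

lemma smooth_transition:
  "smooth_map m (overlap (coordinates c) (coordinates c')) m (transition (coordinates c) (coordinates c'))"
proof -
  have loc: "\<exists>N. openin (\<R> m) N \<and> z \<in> N \<and> N \<subseteq> overlap (coordinates c) (coordinates c') \<and>
      smooth_map m N m (transition (coordinates c) (coordinates c'))"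
    if "z \<in> overlap (coordinates c) (coordinates c')" for z
    using change_coordinates[OF that] by metis
  then have "openin (\<R> m) (overlap (coordinates c) (coordinates c'))"
    by (subst openin_subopen) blast
  then show ?thesis using loc by (rule smooth_map_local)
qed

lemma smooth_atlas_glued: "smooth_atlas m glued_topology glued_atlas"
  unfolding smooth_atlas_def glued_atlas_def compatible_def
  using is_chart_coordinates smooth_transition
  by (auto simp: topspace_glued carrier_set_def coordinates_def)

lemma foliation_glued: "foliation p m glued_topology glued_atlas glued_atlas"
proof -
  have "compatible m (coordinates c) (coordinates c')" for c c'
    by (simp add: compatible_def smooth_transition)
  moreover have "\<exists>N h. openin (\<R> m) N \<and> z \<in> N \<and> N \<subseteq> overlap (coordinates c) (coordinates c') \<and>
      (\<forall>w\<in>N. transverse p (transition (coordinates c) (coordinates c') w) = h (transverse p w))"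
    if z: "z \<in> overlap (coordinates c) (coordinates c')" for z c c'
  proof -
    obtain N k where "openin (\<R> m) N" "z \<in> N" "N \<subseteq> overlap (coordinates c) (coordinates c')"
      "\<And>w. w \<in> N \<Longrightarrow> transverse p (transition (coordinates c) (coordinates c') w) = k (transverse p w)"
      using change_coordinates[OF z] by metis
    then show ?thesis by blast
  qed
  ultimately show ?thesis
    unfolding foliation_def using p_le_m smooth_atlas_glued by (auto simp: glued_atlas_def)
qed

text \<open>The index type is countable, and a countable basis is transported by each
  parametrization.\<close>

lemma second_countable_glued: "second_countable glued_topology"
proof -
  obtain \<B> where \<B>: "countable \<B>" "\<And>B. B \<in> \<B> \<Longrightarrow> openin (\<R> m) B"
    "\<And>U x. openin (\<R> m) U \<Longrightarrow> x \<in> U \<Longrightarrow> \<exists>B\<in>\<B>. x \<in> B \<and> B \<subseteq> U"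
    using Euclidean_countable_basis[of m] by blast
  let ?\<C> = "(\<lambda>(c, B). \<psi> c ` B) ` {(c, B). B \<in> \<B> \<and> B \<subseteq> \<Omega> c}"
  have "countable {(c, B). B \<in> \<B> \<and> B \<subseteq> \<Omega> c}"
    by (rule countable_subset[of _ "UNIV \<times> \<B>"]) (use \<B>(1) in auto)
  then have "countable ?\<C>" by blast
  moreover have "openin glued_topology C" if "C \<in> ?\<C>" for C
    using that \<B>(2) openin_glued_image by auto
  moreover have "\<exists>C\<in>?\<C>. x \<in> C \<and> C \<subseteq> A" if A: "openin glued_topology A" and x: "x \<in> A" for A x
  proof -
    have "x \<in> carrier_set" using A x openin_glued by blast
    then obtain c w where w: "w \<in> \<Omega> c" "x = \<psi> c w" by (auto simp: carrier_set_def)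
    have "openin (\<R> m) {w\<in>\<Omega> c. \<psi> c w \<in> A}" using A openin_glued by blast
    moreover have "w \<in> {w\<in>\<Omega> c. \<psi> c w \<in> A}" using w x by simp
    ultimately obtain B where B: "B \<in> \<B>" "w \<in> B" "B \<subseteq> {w\<in>\<Omega> c. \<psi> c w \<in> A}" using \<B>(3) by blast
    then have "\<psi> c ` B \<in> ?\<C>" by force
    moreover have "x \<in> \<psi> c ` B" "\<psi> c ` B \<subseteq> A" using B w by auto
    ultimately show ?thesis by blast
  qed
  ultimately show ?thesis
    unfolding second_countable_def by (intro exI[of _ ?\<C>] conjI ballI allI impI) (simp_all only:)
qed

text \<open>Coordinate domains are open in the glued space, so separation inside one of them is
  separation in the whole. Only points without a common domain remain for the Hausdorff
  property.\<close>

lemma separated_in_chart: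
  assumes "x \<in> \<psi> c ` \<Omega> c" "y \<in> \<psi> c ` \<Omega> c" "x \<noteq> y"
  shows "\<exists>A B. openin glued_topology A \<and> openin glued_topology B \<and> x \<in> A \<and> y \<in> B \<and> disjnt A B"
proof -
  obtain w u where wu: "w \<in> \<Omega> c" "x = \<psi> c w" "u \<in> \<Omega> c" "y = \<psi> c u" using assms by blast
  have "w \<noteq> u" using wu assms(3) by blast
  moreover have "w \<in> topspace (\<R> m)" "u \<in> topspace (\<R> m)"
    using wu(1,3) openin_subset[OF \<Omega>_open] by auto
  ultimately obtain U V where UV: "openin (\<R> m) U" "openin (\<R> m) V" "w \<in> U" "u \<in> V" "disjnt U V"
    using Hausdorff_Euclidean_space[of m] unfolding Hausdorff_space_def by metis
  have "disjnt (\<psi> c ` (\<Omega> c \<inter> U)) (\<psi> c ` (\<Omega> c \<inter> V))"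
    using \<psi>_inj[of c] UV(5) by (auto simp: disjnt_iff inj_on_def)
  moreover have "openin glued_topology (\<psi> c ` (\<Omega> c \<inter> U))" "openin glued_topology (\<psi> c ` (\<Omega> c \<inter> V))"
    using UV \<Omega>_open by (auto intro!: openin_glued_image)
  ultimately show ?thesis using wu UV(3,4) by blast
qed

section \<open>Plots and plaques of a glued manifold\<close>

lemma manifold_plot:
  assumes r: "smooth_map k U m r" "r \<in> U \<rightarrow> \<Omega> c"
  shows "manifold_diffeology m glued_topology glued_atlas k U (\<lambda>y. \<psi> c (r y))"
proof -
  have U: "openin (\<R> k) U" using r(1) by (rule smooth_map_openin)
  have "continuous_map (subtopology (\<R> k) U) (subtopology (\<R> m) (\<Omega> c)) r"
    using smooth_map_continuous_map[OF r(1)] r(2) by (auto simp: continuous_map_in_subtopology)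
  then have cont: "continuous_map (subtopology (\<R> k) U) glued_topology (\<lambda>y. \<psi> c (r y))"
    using continuous_map_compose[OF _ continuous_map_\<psi>] by (simp add: comp_def)
  have "smooth_map k {x\<in>U. \<psi> c (r x) \<in> \<psi> c' ` \<Omega> c'} m (inv_into (\<Omega> c') (\<psi> c') \<circ> (\<lambda>y. \<psi> c (r y)))" for c'
  proof -
    have O: "{x\<in>U. \<psi> c (r x) \<in> \<psi> c' ` \<Omega> c'} = {x\<in>U. r x \<in> overlap (coordinates c) (coordinates c')}"
      using r(2) by (auto simp: overlap_coordinates)
    let ?O = "{x\<in>U. r x \<in> overlap (coordinates c) (coordinates c')}"
    have "openin (\<R> k) ?O"
      by (rule smooth_map_preimage[OF r(1) smooth_map_openin[OF smooth_transition]])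
    then have "smooth_map k ?O m r" using smooth_map_subset[OF r(1)] by blast
    then have sm: "smooth_map k ?O m (\<lambda>x. transition (coordinates c) (coordinates c') (r x))"
      by (rule smooth_map_comp[OF _ smooth_transition]) auto
    have tr: "transition (coordinates c) (coordinates c') (r x) = inv_into (\<Omega> c') (\<psi> c') (\<psi> c (r x))"
      if "x \<in> ?O" for x
    proof -
      have "r x \<in> \<Omega> c" "\<psi> c (r x) \<in> \<psi> c' ` \<Omega> c'" using that r(2) by (auto simp: overlap_coordinates)
      then show ?thesis
        using transition_coordinates[of "r x" c "inv_into (\<Omega> c') (\<psi> c') (\<psi> c (r x))" c']
        by (simp add: inv_into_into f_inv_into_f)
    qed
    have "smooth_map k ?O m (inv_into (\<Omega> c') (\<psi> c') \<circ> (\<lambda>y. \<psi> c (r y)))"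
      by (rule smooth_map_cong[OF sm]) (use tr in simp)
    then show ?thesis using O by simp
  qed
  then show ?thesis
    unfolding manifold_diffeology_def glued_atlas_def coordinates_def using U cont by auto
qed

text \<open>Counterpart of \<open>manifold_plot\<close>: the plots of the manifold are locally the
  parametrizations composed with smooth maps, so the quotient diffeology can be handled inside the
  domains \<open>\<Omega> c\<close>.\<close>

lemma manifold_plot_lift:
  assumes q: "manifold_diffeology m glued_topology glued_atlas k U q" and x: "x \<in> U"
  obtains W c r where "openin (\<R> k) W" "x \<in> W" "W \<subseteq> U" "smooth_map k W m r" "r \<in> W \<rightarrow> \<Omega> c"
    "\<And>y. y \<in> W \<Longrightarrow> q y = \<psi> c (r y)"
proof -
  have U: "openin (\<R> k) U" and cont: "continuous_map (subtopology (\<R> k) U) glued_topology q"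
    and sm: "\<And>c. smooth_map k {x\<in>U. q x \<in> \<psi> c ` \<Omega> c} m (inv_into (\<Omega> c) (\<psi> c) \<circ> q)"
    using q unfolding manifold_diffeology_def glued_atlas_def coordinates_def by auto
  have "x \<in> topspace (subtopology (\<R> k) U)" using x U openin_subset by fastforce
  then have "q x \<in> carrier_set" using cont topspace_glued by (auto simp: continuous_map_def)
  then obtain c where c: "q x \<in> \<psi> c ` \<Omega> c" by (auto simp: carrier_set_def)
  show thesis
  proof (rule that[of "{x\<in>U. q x \<in> \<psi> c ` \<Omega> c}" "inv_into (\<Omega> c) (\<psi> c) \<circ> q" c])
    show "openin (\<R> k) {x\<in>U. q x \<in> \<psi> c ` \<Omega> c}" using sm by (rule smooth_map_openin)
    show "inv_into (\<Omega> c) (\<psi> c) \<circ> q \<in> {x\<in>U. q x \<in> \<psi> c ` \<Omega> c} \<rightarrow> \<Omega> c"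
      by (auto simp: coord_\<psi>)
    show "q y = \<psi> c ((inv_into (\<Omega> c) (\<psi> c) \<circ> q) y)" if "y \<in> {x\<in>U. q x \<in> \<psi> c ` \<Omega> c}" for y
      using that by (auto simp: f_inv_into_f)
  qed (use x c sm in auto)
qed

text \<open>A connected part of a level set lies inside one component, so no component ever has to
  be determined.\<close>

lemma same_plaque_glued:
  assumes C: "connected C" "C \<subseteq> \<Omega> c" "\<And>w. w \<in> C \<Longrightarrow> transverse p w = d" and xy: "x \<in> \<psi> c ` C" "y \<in> \<psi> c ` C"
  shows "same_plaque p glued_topology glued_atlas x y"
proof -
  have Ct: "C \<subseteq> topspace (\<R> m)" using C(2) \<Omega>_open openin_subset by blast
  then have "connectedin (\<R> m) C"
    using C(1) by (subst Euclidean_space_eq) (simp add: connectedin_subtopology)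
  then have "connectedin (subtopology (\<R> m) (\<Omega> c)) C" using C(2) by (simp add: connectedin_subtopology)
  then have "connectedin glued_topology (\<psi> c ` C)"
    by (rule connectedin_continuous_map_image[OF continuous_map_\<psi>])
  moreover have "\<psi> c ` C \<subseteq> {z\<in>\<psi> c ` \<Omega> c. transverse p (inv_into (\<Omega> c) (\<psi> c) z) = d}"
    using C(2,3) coord_\<psi> by (auto simp: subset_iff)
  ultimately have "connected_component_of (subtopology glued_topology
      {z\<in>\<psi> c ` \<Omega> c. transverse p (inv_into (\<Omega> c) (\<psi> c) z) = d}) x y"
    using xy unfolding connected_component_of_def by (auto simp: connectedin_subtopology)
  then show ?thesis
    unfolding same_plaque_def glued_atlas_def coordinates_def by auto
qed

text \<open>This is what makes functions of the transverse coordinates constant along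
  plaques.\<close>

lemma same_plaque_gluedD:
  assumes "same_plaque p glued_topology glued_atlas x y"
  obtains c w u where "w \<in> \<Omega> c" "u \<in> \<Omega> c" "x = \<psi> c w" "y = \<psi> c u" "transverse p w = transverse p u"
proof -
  obtain c d where cc: "connected_component_of (subtopology glued_topology
      {z\<in>\<psi> c ` \<Omega> c. transverse p (inv_into (\<Omega> c) (\<psi> c) z) = d}) x y"
    using assms unfolding same_plaque_def glued_atlas_def coordinates_def by auto
  have "x \<in> {z\<in>\<psi> c ` \<Omega> c. transverse p (inv_into (\<Omega> c) (\<psi> c) z) = d}"
    "y \<in> {z\<in>\<psi> c ` \<Omega> c. transverse p (inv_into (\<Omega> c) (\<psi> c) z) = d}"
    using connected_component_in_topspace[OF cc] by auto
  then show thesis using that coord_\<psi> by auto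
qed

lemma same_plaque_glued_sym:
  "same_plaque p glued_topology glued_atlas x y \<Longrightarrow> same_plaque p glued_topology glued_atlas y x"
  unfolding same_plaque_def using connected_component_of_sym by fastforce

end

section \<open>The foliation of a charted quasifold\<close>

definition leaf_point :: "real \<Rightarrow> real \<Rightarrow> (nat \<Rightarrow> real) \<Rightarrow> nat \<Rightarrow> real" where
  "leaf_point s t v = case_nat s (case_nat t v)"

lemma leaf_point_simps [simp]:
  "leaf_point s t v 0 = s" "leaf_point s t v (Suc 0) = t" "transverse 2 (leaf_point s t v) = v"
  by (simp_all add: leaf_point_def transverse_def)

lemma leaf_point_eta: "leaf_point (w 0) (w (Suc 0)) (transverse 2 w) = w"
  by (auto simp: leaf_point_def transverse_def fun_eq_iff split: nat.splits)

lemma leaf_point_in_topspace [simp]: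
  "leaf_point s t v \<in> topspace (\<R> (Suc (Suc n))) \<longleftrightarrow> v \<in> topspace (\<R> n)"
proof -
  have "(\<forall>i\<ge>Suc (Suc n). leaf_point s t v i = 0) \<longleftrightarrow> (\<forall>i\<ge>n. v i = 0)"
  proof safe
    fix i assume "\<forall>i\<ge>Suc (Suc n). leaf_point s t v i = 0" "i \<ge> n"
    then have "leaf_point s t v (Suc (Suc i)) = 0" by simp
    then show "v i = 0" by (simp add: leaf_point_def)
  next
    fix i assume *: "\<forall>i\<ge>n. v i = 0" "Suc (Suc n) \<le> i"
    then obtain j where "i = Suc (Suc j)" "n \<le> j" by (metis Suc_le_D Suc_le_mono)
    then show "leaf_point s t v i = 0" using * by (simp add: leaf_point_def)
  qed
  then show ?thesis by (simp add: topspace_Euclidean_space)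
qed

lemma transverse_in_topspace: "w \<in> topspace (\<R> (Suc (Suc n))) \<Longrightarrow> transverse 2 w \<in> topspace (\<R> n)"
  using leaf_point_in_topspace[of "w 0" "w (Suc 0)" "transverse 2 w" n] by (simp only: leaf_point_eta)

lemma smooth_map_transverse:
  assumes "openin (\<R> (Suc (Suc n))) U"
  shows "smooth_map (Suc (Suc n)) U n (transverse 2)"
  unfolding smooth_map_def
proof (intro conjI allI impI)
  show "transverse 2 \<in> U \<rightarrow> topspace (\<R> n)"
    using assms openin_subset transverse_in_topspace by blast
  show "Ck r (Suc (Suc n)) U (\<lambda>x. transverse 2 x i)" for i r
    unfolding transverse_def by (rule Ck_coord[OF assms])
qed (rule assms)

lemma smooth_map_leaf_point:
  assumes "\<And>r. Ck r k U a" "\<And>r. Ck r k U b" "smooth_map k U n q"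
  shows "smooth_map k U (Suc (Suc n)) (\<lambda>y. leaf_point (a y) (b y) (q y))"
  unfolding smooth_map_def
proof (intro conjI allI impI)
  show "openin (\<R> k) U" using assms(3) by (rule smooth_map_openin)
  show "(\<lambda>y. leaf_point (a y) (b y) (q y)) \<in> U \<rightarrow> topspace (\<R> (Suc (Suc n)))"
    using smooth_map_range[OF assms(3)] by simp
  fix i r assume i: "i < Suc (Suc n)"
  consider "i = 0" | "i = Suc 0" | j where "i = Suc (Suc j)" by (metis not0_implies_Suc)
  then show "Ck r k U (\<lambda>y. leaf_point (a y) (b y) (q y) i)"
  proof cases
    case 3
    then have "Ck r k U (\<lambda>y. q y j)" using assms(3) i by (simp add: smooth_map_def)
    then show ?thesis using 3 by (simp add: leaf_point_def)
  qed (use assms in simp_all)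
qed

lemma smooth_map_on_transverse:
  assumes "openin (\<R> (Suc (Suc n))) U" "smooth_map n B n f" "\<And>w. w \<in> U \<Longrightarrow> transverse 2 w \<in> B"
  shows "smooth_map (Suc (Suc n)) U (Suc (Suc n)) (\<lambda>w. leaf_point (w 0) (w (Suc 0)) (f (transverse 2 w)))"
proof -
  have "smooth_map (Suc (Suc n)) U n (\<lambda>w. f (transverse 2 w))"
    by (rule smooth_map_comp[OF smooth_map_transverse[OF assms(1)] assms(2)]) (use assms(3) in auto)
  then show ?thesis by (rule smooth_map_leaf_point[OF Ck_coord[OF assms(1)] Ck_coord[OF assms(1)]])
qed

lemma openin_coord_less:
  assumes "openin (\<R> m) U"
  shows "openin (\<R> m) {w\<in>U. w i < c}" "openin (\<R> m) {w\<in>U. c < w i}"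
  using openin_continuous_on[OF assms continuous_on_coord open_lessThan[of c]]
    openin_continuous_on[OF assms continuous_on_coord open_greaterThan[of c]] by auto

lemma openin_transverse:
  assumes "openin (\<R> (Suc (Suc n))) U" "openin (\<R> n) B"
  shows "openin (\<R> (Suc (Suc n))) {w\<in>U. transverse 2 w \<in> B}"
  by (rule smooth_map_preimage[OF smooth_map_transverse[OF assms(1)] assms(2)])

lemma continuous_on_leaf_point: "continuous_on S (\<lambda>(s, t). leaf_point s t v)"
proof (rule continuous_on_coordinatewise_then_product)
  fix i
  consider "i = 0" | "i = Suc 0" | j where "i = Suc (Suc j)" by (metis not0_implies_Suc)
  then show "continuous_on S (\<lambda>x. (case x of (s, t) \<Rightarrow> leaf_point s t v) i)"
    by cases (auto simp: split_beta leaf_point_def intro!: continuous_intros)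
qed

section \<open>The slit plane and the strips around its slits\<close>

text \<open>The slit over \<open>k\<close> is the closed ray upwards from \<open>(k, 0)\<close>. The
  end point is removed from the sheets and is not restored by the handle, which requires
  \<open>0 < t\<close>.\<close>

definition off_slits :: "real \<Rightarrow> real \<Rightarrow> bool" where
  "off_slits s t \<longleftrightarrow> s \<notin> \<nat> \<or> t < 0"

text \<open>Half-width 1/2 makes strips around distinct natural numbers disjoint, so at most one
  handle lies over a given point of the plane.\<close>

definition near_slit :: "nat \<Rightarrow> real \<Rightarrow> real \<Rightarrow> bool" where
  "near_slit k s t \<longleftrightarrow> real k - 1 / 2 < s \<and> s < real k + 1 / 2 \<and> 0 < t"

lemma near_slit_unique:
  assumes "near_slit k s t" "near_slit l s t"
  shows "k = l"
proof (rule ccontr)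
  assume "k \<noteq> l"
  then have "real k + 1 \<le> real l \<or> real l + 1 \<le> real k" by linarith
  then show False using assms unfolding near_slit_def by linarith
qed

lemma near_slit_Nats: "near_slit k s t \<Longrightarrow> s \<in> \<nat> \<Longrightarrow> s = real k"
proof (elim Nats_cases)
  fix l assume k: "near_slit k s t" "s = real l"
  then have "near_slit l s t" by (simp add: near_slit_def)
  then show "s = real k" using near_slit_unique[of k s t l] k by blast
qed

lemma near_slit_off:
  assumes "near_slit k s t"
  shows "off_slits s t \<longleftrightarrow> s \<noteq> real k"
proof -
  have "off_slits s t \<longleftrightarrow> s \<notin> \<nat>" using assms by (simp add: off_slits_def near_slit_def)
  also have "\<dots> \<longleftrightarrow> s \<noteq> real k" using near_slit_Nats[OF assms] of_nat_in_Nats by blast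
  finally show ?thesis .
qed

text \<open>The lower half plane is connected and meets every vertical line with abscissa outside
  \<open>\<nat>\<close>; their union is the slit plane.\<close>

lemma connected_off_slits: "connected {(s, t). off_slits s t}"
proof -
  let ?L = "\<lambda>s::real. {s} \<times> (UNIV :: real set)"
  have "connected (UNIV \<times> {..<0::real} \<union> (\<Union>s\<in>-\<nat>. ?L s) :: (real \<times> real) set)"
  proof (rule connected_Un_UN)
    show "connected (UNIV \<times> {..<0::real} :: (real \<times> real) set)"
      by (intro connected_Times connected_UNIV) auto
    show "\<And>x. x \<in> ?L ` (- \<nat>) \<Longrightarrow> connected x" by (auto intro!: connected_Times)
    show "(UNIV \<times> {..<0::real}) \<inter> x \<noteq> {}" if x: "x \<in> ?L ` (- \<nat>)" for x
    proof -
      obtain s where "x = ?L s" using x by blast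
      then have "(s, -1) \<in> (UNIV \<times> {..<0::real}) \<inter> x" by simp
      then show ?thesis by blast
    qed
  qed
  moreover have "(UNIV \<times> {..<0::real} \<union> (\<Union>s\<in>-\<nat>. ?L s)) = {(s, t). off_slits s t}"
    by (auto simp: off_slits_def)
  ultimately show ?thesis by simp
qed

lemma connected_near_slit: "connected {(s, t). near_slit k s t}"
proof -
  have "{(s, t). near_slit k s t} = {real k - 1 / 2<..<real k + 1 / 2} \<times> {0<..}"
    by (auto simp: near_slit_def)
  then show ?thesis by (simp add: connected_Times)
qed

section \<open>Sheets and handles\<close>

locale holonomy_handles = charted_quasifold X D n V \<Gamma> \<pi>
  for X :: "'a set" and D n V \<Gamma> \<pi> +
  fixes src dst :: "nat \<Rightarrow> nat" and A :: "nat \<Rightarrow> (nat \<Rightarrow> real) set"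
    and h g :: "nat \<Rightarrow> (nat \<Rightarrow> real) \<Rightarrow> nat \<Rightarrow> real"
  assumes handle: "local_diffeo (src k) (dst k) (A k) (h k) (g k)"
    and generate: "\<lbrakk>v \<in> V i; w \<in> V j; \<pi> i v = \<pi> j w\<rbrakk> \<Longrightarrow>
      \<exists>k l. src k = i \<and> dst k = j \<and> v \<in> A k \<and> src l = j \<and> dst l = j \<and> h k v \<in> A l \<and> h l (h k v) = w"
begin

lemma A_open: "openin (\<R> n) (A k)" and hA_open: "openin (\<R> n) (h k ` A k)"
  and h_smooth: "smooth_map n (A k) n (h k)" and g_smooth: "smooth_map n (h k ` A k) n (g k)"
  using handle[of k] by (auto simp: local_diffeo_def smooth_map_openin)

lemma A_V: "a \<in> A k \<Longrightarrow> a \<in> V (src k)" and h_V: "a \<in> A k \<Longrightarrow> h k a \<in> V (dst k)"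
  and g_h: "a \<in> A k \<Longrightarrow> g k (h k a) = a" and \<pi>_h: "a \<in> A k \<Longrightarrow> \<pi> (dst k) (h k a) = \<pi> (src k) a"
  using handle[of k] by (auto simp: local_diffeo_def)

fun piece :: "nat + nat \<Rightarrow> (nat \<Rightarrow> real) set" where
  "piece (Inl i) = {w \<in> topspace (\<R> (Suc (Suc n))). off_slits (w 0) (w (Suc 0)) \<and> transverse 2 w \<in> V i}"
| "piece (Inr k) = {w \<in> topspace (\<R> (Suc (Suc n))). near_slit k (w 0) (w (Suc 0)) \<and> transverse 2 w \<in> A k}"

text \<open>The coordinates of a handle point as seen from the target sheet: the plane coordinates
  stay, the holonomy acts on the transverse part.\<close>

definition straighten :: "nat \<Rightarrow> (nat \<Rightarrow> real) \<Rightarrow> nat \<Rightarrow> real" where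
  "straighten k w = leaf_point (w 0) (w (Suc 0)) (h k (transverse 2 w))"

text \<open>
  A point of the manifold is a point of \<open>\<R> (Suc (Suc n))\<close> preceded by the number of its sheet; the
  points on a slit are assigned to the sheet on its left.
\<close>

fun glue :: "nat + nat \<Rightarrow> (nat \<Rightarrow> real) \<Rightarrow> nat \<Rightarrow> real" where
  "glue (Inl i) w = case_nat (real i) w"
| "glue (Inr k) w = (if w 0 \<le> real k then case_nat (real (src k)) w else case_nat (real (dst k)) (straighten k w))"

lemma case_nat_eq_iff: "case_nat a u = case_nat b w \<longleftrightarrow> a = b \<and> u = w" for a b :: 'c
proof
  assume eq: "case_nat a u = case_nat b w"
  have "u i = w i" for i using fun_cong[OF eq, of "Suc i"] by simp
  then show "a = b \<and> u = w" using fun_cong[OF eq, of 0] by auto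
qed simp

lemma straighten_simps [simp]:
  "straighten k w 0 = w 0" "straighten k w (Suc 0) = w (Suc 0)" "transverse 2 (straighten k w) = h k (transverse 2 w)"
  by (simp_all add: straighten_def)

lemma glue_coords: "glue c w (Suc 0) = w 0" "glue c w (Suc (Suc 0)) = w (Suc 0)"
  by (cases c; simp add: straighten_def)+

lemma piece_open: "openin (\<R> (Suc (Suc n))) (piece c)"
proof (cases c)
  case (Inl i)
  let ?T = "topspace (\<R> (Suc (Suc n)))"
  \<comment> \<open>Infinitely many slits are removed at once; openness survives because
    \<open>\<nat>\<close> is closed in the reals.\<close>
  have "openin (\<R> (Suc (Suc n))) {w\<in>?T. w 0 \<in> - \<nat>}"
    by (rule openin_continuous_on[OF openin_topspace continuous_on_coord]) (simp add: closed_Nats open_Compl)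
  then have "openin (\<R> (Suc (Suc n))) ({w\<in>?T. w 0 \<in> - \<nat>} \<union> {w\<in>?T. w (Suc 0) < 0})"
    using openin_coord_less(1) by blast
  then have "openin (\<R> (Suc (Suc n))) {w\<in>{w\<in>?T. w 0 \<in> - \<nat>} \<union> {w\<in>?T. w (Suc 0) < 0}. transverse 2 w \<in> V i}"
    using openin_transverse V_open by blast
  moreover have "{w\<in>{w\<in>?T. w 0 \<in> - \<nat>} \<union> {w\<in>?T. w (Suc 0) < 0}. transverse 2 w \<in> V i} = piece c"
    by (auto simp: Inl off_slits_def)
  ultimately show ?thesis by simp
next
  case (Inr k)
  let ?T = "topspace (\<R> (Suc (Suc n)))"
  have "openin (\<R> (Suc (Suc n))) {w\<in>{w\<in>{w\<in>{w\<in>?T. w 0 < real k + 1 / 2}. real k - 1 / 2 < w 0}. 0 < w (Suc 0)}. transverse 2 w \<in> A k}"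
    by (intro openin_transverse openin_coord_less openin_topspace A_open)
  moreover have "{w\<in>{w\<in>{w\<in>{w\<in>?T. w 0 < real k + 1 / 2}. real k - 1 / 2 < w 0}. 0 < w (Suc 0)}. transverse 2 w \<in> A k} = piece c"
    by (auto simp: Inr near_slit_def)
  ultimately show ?thesis by simp
qed

text \<open>The plane coordinates survive gluing, so points from different halves of a handle cannot
  collide; on the right half \<open>g k\<close> undoes \<open>h k\<close>.\<close>

lemma glue_inj: "inj_on (glue c) (piece c)"
proof (rule inj_onI)
  fix u w assume uw: "u \<in> piece c" "w \<in> piece c" "glue c u = glue c w"
  then have 0: "u 0 = w 0" "u (Suc 0) = w (Suc 0)" by (metis glue_coords)+
  show "u = w"
  proof (cases c)
    case (Inl i)
    then show ?thesis using uw by (simp add: case_nat_eq_iff)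
  next
    case (Inr k)
    show ?thesis
    proof (cases "u 0 \<le> real k")
      case True
      then show ?thesis using uw 0 Inr by (simp add: case_nat_eq_iff)
    next
      case False
      then have "straighten k u = straighten k w" using uw 0 Inr by (simp add: case_nat_eq_iff)
      then have "h k (transverse 2 u) = h k (transverse 2 w)" by (metis straighten_simps(3))
      moreover have "transverse 2 u \<in> A k" "transverse 2 w \<in> A k" using uw Inr by auto
      ultimately have "transverse 2 u = transverse 2 w" by (metis g_h)
      then show ?thesis using 0 by (metis leaf_point_eta)
    qed
  qed
qed

lemma glue_left:
  assumes "w \<in> piece (Inr k)" "w 0 < real k"
  shows "w \<in> piece (Inl (src k))" "glue (Inl (src k)) w = glue (Inr k) w"
  using assms A_V near_slit_off[of k "w 0" "w (Suc 0)"] by auto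

lemma glue_right:
  assumes "w \<in> piece (Inr k)" "real k < w 0"
  shows "straighten k w \<in> piece (Inl (dst k))" "glue (Inl (dst k)) (straighten k w) = glue (Inr k) w"
proof -
  have "h k (transverse 2 w) \<in> V (dst k)" using assms(1) h_V by simp
  then show "straighten k w \<in> piece (Inl (dst k))"
    using assms near_slit_off[of k "w 0" "w (Suc 0)"] V_top by (auto simp: straighten_def)
qed (use assms in simp)

text \<open>Points with equal image have equal plane coordinates. Hence two sheets can meet only if
  they are the same sheet, and two handles only if their strips are the same. Between a sheet and a
  handle the common point is off the slit: left of it the change is the identity, right of it
  \<open>h k\<close> or its inverse acts on the transverse part.\<close>

lemma glue_change:
  assumes z: "z \<in> piece c" "glue c z \<in> glue c' ` piece c'"
  shows "\<exists>N f k. openin (\<R> (Suc (Suc n))) N \<and> z \<in> N \<and> N \<subseteq> piece c \<and> smooth_map (Suc (Suc n)) N (Suc (Suc n)) f \<and>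
        (\<forall>w\<in>N. f w \<in> piece c' \<and> glue c' (f w) = glue c w \<and> transverse 2 (f w) = k (transverse 2 w))"
proof -
  have same: ?thesis if "c = c'"
    using that z piece_open[of c] smooth_map_id[OF piece_open[of c]]
    by (intro exI[of _ "piece c"] exI[of _ "\<lambda>w. w"]) auto
  obtain u where u: "u \<in> piece c'" "glue c z = glue c' u" using z(2) by blast
  then have 0: "u 0 = z 0" "u (Suc 0) = z (Suc 0)" by (metis glue_coords)+
  consider (ll) i j where "c = Inl i" "c' = Inl j" | (lr) i k where "c = Inl i" "c' = Inr k"
    | (rl) k i where "c = Inr k" "c' = Inl i" | (rr) k l where "c = Inr k" "c' = Inr l"
    by (metis sumE)
  then show ?thesis
  proof cases
    case ll
    then show ?thesis using same u(2) by (simp add: case_nat_eq_iff)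
  next
    case rr
    then have "near_slit k (z 0) (z (Suc 0))" "near_slit l (z 0) (z (Suc 0))" using z u 0 by auto
    then show ?thesis using same rr near_slit_unique by blast
  next
    case lr
    have near: "near_slit k (z 0) (z (Suc 0))" "off_slits (z 0) (z (Suc 0))" using lr u z(1) 0 by auto
    then have zk: "z 0 \<noteq> real k" using near_slit_off by blast
    show ?thesis
    proof (cases "z 0 < real k")
      case True
      then have ui: "i = src k" "u = z" using u(2) 0 lr by (simp_all add: case_nat_eq_iff)
      let ?N = "{w\<in>piece (Inr k). w 0 < real k}"
      have "openin (\<R> (Suc (Suc n))) ?N" by (rule openin_coord_less[OF piece_open])
      moreover have "z \<in> ?N" using True u(1) ui lr by simp
      ultimately show ?thesis
        using glue_left[of _ k] smooth_map_id[of "Suc (Suc n)" ?N] unfolding lr ui(1)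
        by (intro exI[of _ ?N] exI[of _ "\<lambda>w. w"] exI[of _ "\<lambda>v. v"]) auto
    next
      case False
      then have zgt: "real k < z 0" using zk by simp
      then have ui: "i = dst k" "z = straighten k u" using u(2) 0 lr by (simp_all add: case_nat_eq_iff)
      \<comment> \<open>From the target sheet back to the handle: only points with transverse part
        in the image of \<open>h k\<close> belong to the handle, and \<open>g k\<close> returns them
        to its coordinates.\<close>
      let ?N0 = "{w\<in>topspace (\<R> (Suc (Suc n))). transverse 2 w \<in> h k ` A k}"
      let ?N = "{w\<in>{w\<in>{w\<in>?N0. 0 < w (Suc 0)}. w 0 < real k + 1 / 2}. real k < w 0}"
      let ?f = "\<lambda>w. leaf_point (w 0) (w (Suc 0)) (g k (transverse 2 w))"
      have N: "openin (\<R> (Suc (Suc n))) ?N"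
        by (intro openin_transverse openin_coord_less openin_topspace hA_open)
      have zN: "z \<in> ?N"
        using z(1) u(1) zgt near(1) lr unfolding ui(2) by (auto simp: near_slit_def)
      have f: "?f w \<in> piece (Inr k) \<and> straighten k (?f w) = w" if w: "w \<in> ?N" for w
      proof -
        obtain a where a: "a \<in> A k" "transverse 2 w = h k a" using w by auto
        then have "a \<in> topspace (\<R> n)" using A_open openin_subset by blast
        moreover have "straighten k (?f w) = leaf_point (w 0) (w (Suc 0)) (transverse 2 w)"
          using a g_h by (simp add: straighten_def)
        moreover have "leaf_point (w 0) (w (Suc 0)) (h k a) = w" using leaf_point_eta[of w] a(2) by simp
        ultimately show ?thesis using a g_h w by (auto simp: near_slit_def)
      qed
      have "?N \<subseteq> piece (Inl i)"
      proof
        fix w assume w: "w \<in> ?N"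
        have "?f w \<in> piece (Inr k)" "real k < ?f w 0" using f[OF w] w by simp_all
        then have "straighten k (?f w) \<in> piece (Inl (dst k))" by (rule glue_right(1))
        then show "w \<in> piece (Inl i)" using f[OF w] ui(1) by metis
      qed
      moreover have "smooth_map (Suc (Suc n)) ?N (Suc (Suc n)) ?f"
        by (rule smooth_map_on_transverse[OF N g_smooth]) auto
      moreover have "glue (Inr k) (?f w) = glue (Inl i) w" if "w \<in> ?N" for w
        using f[OF that] that ui(1) by simp
      ultimately show ?thesis
        unfolding lr using N zN f
        by (intro exI[of _ ?N] exI[of _ ?f] exI[of _ "g k"] conjI ballI) auto
    qed
  next
    case rl
    have near: "near_slit k (z 0) (z (Suc 0))" "off_slits (z 0) (z (Suc 0))" using rl u z(1) 0 by auto
    then have zk: "z 0 \<noteq> real k" using near_slit_off by blast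
    show ?thesis
    proof (cases "z 0 < real k")
      case True
      then have i: "i = src k" using u(2) rl by (simp add: case_nat_eq_iff)
      let ?N = "{w\<in>piece (Inr k). w 0 < real k}"
      have "openin (\<R> (Suc (Suc n))) ?N" by (rule openin_coord_less[OF piece_open])
      moreover have "z \<in> ?N" using True z rl by simp
      ultimately show ?thesis
        using glue_left[of _ k] smooth_map_id[of "Suc (Suc n)" ?N] unfolding rl i
        by (intro exI[of _ ?N] exI[of _ "\<lambda>w. w"] exI[of _ "\<lambda>v. v"]) auto
    next
      case False
      then have zgt: "real k < z 0" using zk by simp
      then have i: "i = dst k" using u(2) rl by (simp add: case_nat_eq_iff)
      let ?N = "{w\<in>piece (Inr k). real k < w 0}"
      have N: "openin (\<R> (Suc (Suc n))) ?N" by (rule openin_coord_less[OF piece_open])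
      have "smooth_map (Suc (Suc n)) ?N (Suc (Suc n)) (straighten k)"
        unfolding straighten_def[abs_def] by (rule smooth_map_on_transverse[OF N h_smooth]) auto
      moreover have "z \<in> ?N" using zgt z rl by simp
      ultimately show ?thesis
        using N glue_right[of _ k] unfolding rl i
        by (intro exI[of _ ?N] exI[of _ "straighten k"] exI[of _ "h k"]) auto
    qed
  qed
qed

sublocale foliated_gluing "Suc (Suc n)" 2 piece glue
  by (unfold_locales; (rule piece_open glue_inj glue_change)?) simp_all

lemma Hausdorff_glued: "Hausdorff_space glued_topology"
  unfolding Hausdorff_space_def topspace_glued
proof (intro allI impI, elim conjE)
  fix x y assume xy: "x \<in> carrier_set" "y \<in> carrier_set" "x \<noteq> y"
  let ?thesis = "\<exists>U V. openin glued_topology U \<and> openin glued_topology V \<and> x \<in> U \<and> y \<in> V \<and> disjnt U V"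
  \<comment> \<open>Position 0 of a glued point holds the sheet number, so the plane coordinates sit
    at positions 1 and 2. Half spaces in them are open because every parametrization preserves
    them.\<close>
  have coord_open: "openin glued_topology {x\<in>carrier_set. x (Suc i) < a}"
      "openin glued_topology {x\<in>carrier_set. a < x (Suc i)}" if "i = 0 \<or> i = Suc 0" for i a
  proof -
    have "{w\<in>piece c. glue c w \<in> {x\<in>carrier_set. x (Suc i) < a}} = {w\<in>piece c. w i < a}"
      "{w\<in>piece c. glue c w \<in> {x\<in>carrier_set. a < x (Suc i)}} = {w\<in>piece c. a < w i}" for c
      using that by (auto simp: carrier_set_def) (metis glue_coords)+
    then show "openin glued_topology {x\<in>carrier_set. x (Suc i) < a}"
      "openin glued_topology {x\<in>carrier_set. a < x (Suc i)}"
      using openin_coord_less[OF piece_open] by (auto simp: openin_glued)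
  qed
  have apart: ?thesis if i: "i = 0 \<or> i = Suc 0" and ne: "x (Suc i) \<noteq> y (Suc i)" for i
  proof -
    define a where "a = (x (Suc i) + y (Suc i)) / 2"
    let ?L = "{x\<in>carrier_set. x (Suc i) < a}" and ?R = "{x\<in>carrier_set. a < x (Suc i)}"
    have d: "disjnt ?L ?R" "disjnt ?R ?L" by (auto simp: disjnt_iff)
    show ?thesis
    proof (cases "x (Suc i) < y (Suc i)")
      case True
      then have "x \<in> ?L" "y \<in> ?R" using xy by (auto simp: a_def)
      then show ?thesis using coord_open[OF i] d by blast
    next
      case False
      then have "x \<in> ?R" "y \<in> ?L" using xy ne by (auto simp: a_def)
      then show ?thesis using coord_open[OF i] d by blast
    qed
  qed
  \<comment> \<open>A handle point off the slit already lies on the sheet to its left or to its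
    right.\<close>
  have sheet: "\<exists>i. x \<in> glue (Inl i) ` piece (Inl i)"
    if x: "x \<in> carrier_set" and off: "off_slits (x (Suc 0)) (x (Suc (Suc 0)))" for x
  proof -
    obtain c w where w: "w \<in> piece c" "x = glue c w" using x by (auto simp: carrier_set_def)
    show ?thesis
    proof (cases c)
      case (Inl i)
      then show ?thesis using w by blast
    next
      case (Inr k)
      then have "w 0 \<noteq> real k"
        using w off near_slit_off[of k "w 0" "w (Suc 0)"] by (simp add: glue_coords del: glue.simps)
      then consider "w 0 < real k" | "real k < w 0" by linarith
      then show ?thesis
        using w Inr glue_left[of w k] glue_right[of w k] by cases (metis imageI)+
    qed
  qed
  \<comment> \<open>Sheets have no points here, so the point comes from a handle, and its abscissa
    determines which one.\<close>
  have slit: "\<exists>k. x \<in> glue (Inr k) ` piece (Inr k) \<and> near_slit k (x (Suc 0)) (x (Suc (Suc 0)))"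
    if x: "x \<in> carrier_set" and off: "\<not> off_slits (x (Suc 0)) (x (Suc (Suc 0)))" for x
  proof -
    obtain c w where w: "w \<in> piece c" "x = glue c w" using x by (auto simp: carrier_set_def)
    then show ?thesis
      using off by (cases c) (auto simp: glue_coords simp del: glue.simps)
  qed
  show ?thesis
  proof (cases "x (Suc 0) = y (Suc 0) \<and> x (Suc (Suc 0)) = y (Suc (Suc 0))")
    case False
    then show ?thesis using apart by blast
  next
    case eq: True
    show ?thesis
    proof (cases "off_slits (x (Suc 0)) (x (Suc (Suc 0)))")
      case True
      then obtain i j where ij: "x \<in> glue (Inl i) ` piece (Inl i)" "y \<in> glue (Inl j) ` piece (Inl j)"
        using sheet xy eq by metis
      show ?thesis
      proof (cases "i = j")
        case True
        then show ?thesis using separated_in_chart ij xy by blast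
      next
        case False
        \<comment> \<open>The recorded sheet numbers differ. Handles join sheets into one leaf but
          never make their images overlap.\<close>
        then have "disjnt (glue (Inl i) ` piece (Inl i)) (glue (Inl j) ` piece (Inl j))"
          by (auto simp: disjnt_iff case_nat_eq_iff)
        then show ?thesis using ij openin_glued_image[OF piece_open order_refl] by blast
      qed
    next
      case False
      then obtain k l where "x \<in> glue (Inr k) ` piece (Inr k)" "y \<in> glue (Inr l) ` piece (Inr l)"
        "near_slit k (x (Suc 0)) (x (Suc (Suc 0)))" "near_slit l (y (Suc 0)) (y (Suc (Suc 0)))"
        using slit xy eq by metis
      then show ?thesis using separated_in_chart xy eq near_slit_unique by metis
    qed
  qed
qed

lemma manifold_glued: "manifold (Suc (Suc n)) glued_topology glued_atlas"
  by (simp add: manifold_def Hausdorff_glued second_countable_glued smooth_atlas_glued)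

subsection \<open>The leaves\<close>

text \<open>The floor decodes the sheet number, and \<open>transverse 3\<close> drops it together
  with the two plane coordinates. Points right of a slit are stored in coordinates of the target
  sheet, so one formula covers all points.\<close>

definition to_X :: "(nat \<Rightarrow> real) \<Rightarrow> 'a" where
  "to_X x = \<pi> (nat \<lfloor>x 0\<rfloor>) (transverse 3 x)"

text \<open>On a handle the transverse coordinate lies in \<open>A k\<close>, a subset of the source
  chart, also for points right of the slit.\<close>

fun sheet_of :: "nat + nat \<Rightarrow> nat" where
  "sheet_of (Inl i) = i"
| "sheet_of (Inr k) = src k"

lemma piece_transverse: "w \<in> piece c \<Longrightarrow> transverse 2 w \<in> V (sheet_of c)"
  using A_V by (cases c) auto

text \<open>Both halves of a handle give the same formula because \<open>h k\<close> is a map over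
  \<open>X\<close>.\<close>

lemma to_X_glue:
  assumes "w \<in> piece c"
  shows "to_X (glue c w) = \<pi> (sheet_of c) (transverse 2 w)"
proof -
  have "to_X (case_nat (real i) u) = \<pi> i (transverse 2 u)" for i u
  proof -
    have "transverse 3 (case_nat (real i) u) = transverse 2 u"
      by (simp add: transverse_def fun_eq_iff numeral_3_eq_3 numeral_2_eq_2)
    then show ?thesis by (simp add: to_X_def)
  qed
  then show ?thesis using assms \<pi>_h by (cases c) auto
qed

lemma to_X_in: "x \<in> carrier_set \<Longrightarrow> to_X x \<in> X"
proof -
  assume "x \<in> carrier_set"
  then obtain c w where w: "w \<in> piece c" "x = glue c w" unfolding carrier_set_def by blast
  then have "to_X x = \<pi> (sheet_of c) (transverse 2 w)" by (simp only: to_X_glue)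
  then show "to_X x \<in> X" using piece_transverse[OF w(1)] cover by blast
qed

abbreviation plaque where
  "plaque \<equiv> same_plaque 2 glued_topology glued_atlas"

text \<open>A smooth section of the sheet over its chart. The constant \<open>(0, -1)\<close> is a
  point below the slit over 0 and so belongs to the slit plane.\<close>

definition base :: "nat \<Rightarrow> (nat \<Rightarrow> real) \<Rightarrow> nat \<Rightarrow> real" where
  "base i v = glue (Inl i) (leaf_point 0 (-1) v)"

lemma base_piece:
  assumes "v \<in> V i"
  shows "leaf_point 0 (-1) v \<in> piece (Inl i)"
  using assms V_top[OF assms] by (simp add: off_slits_def)

lemma base_in:
  assumes "v \<in> V i"
  shows "base i v \<in> carrier_set"
proof -
  have "base i v \<in> glue (Inl i) ` piece (Inl i)" unfolding base_def by (rule imageI[OF base_piece[OF assms]])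
  then show ?thesis unfolding carrier_set_def by blast
qed

lemma to_X_base:
  assumes "v \<in> V i"
  shows "to_X (base i v) = \<pi> i v"
  using to_X_glue[OF base_piece[OF assms]] by (simp only: base_def sheet_of.simps leaf_point_simps)

text \<open>In a sheet a level set of the transverse coordinates is a copy of the slit plane, which
  is connected.\<close>

lemma plaque_sheet:
  assumes "w \<in> piece (Inl i)" "u \<in> piece (Inl i)" "transverse 2 w = transverse 2 u"
  shows "plaque (glue (Inl i) w) (glue (Inl i) u)"
proof (rule same_plaque_glued)
  let ?C = "(\<lambda>(s, t). leaf_point s t (transverse 2 w)) ` {(s, t). off_slits s t}"
  show "connected ?C"
    by (rule connected_continuous_image[OF continuous_on_leaf_point connected_off_slits])
  show "?C \<subseteq> piece (Inl i)" using assms(1) transverse_in_topspace by auto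
  have C: "v \<in> ?C" if "off_slits (v 0) (v (Suc 0))" "transverse 2 v = transverse 2 w" for v
    using that leaf_point_eta[of v] by (intro image_eqI[of _ _ "(v 0, v (Suc 0))"]) auto
  show "glue (Inl i) w \<in> glue (Inl i) ` ?C" "glue (Inl i) u \<in> glue (Inl i) ` ?C"
    using assms by (intro imageI C; simp)+
  show "transverse 2 v = transverse 2 w" if "v \<in> ?C" for v using that by auto
qed

lemma plaque_handle:
  assumes "w \<in> piece (Inr k)" "u \<in> piece (Inr k)" "transverse 2 w = transverse 2 u"
  shows "plaque (glue (Inr k) w) (glue (Inr k) u)"
proof (rule same_plaque_glued)
  let ?C = "(\<lambda>(s, t). leaf_point s t (transverse 2 w)) ` {(s, t). near_slit k s t}"
  show "connected ?C"
    by (rule connected_continuous_image[OF continuous_on_leaf_point connected_near_slit])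
  show "?C \<subseteq> piece (Inr k)" using assms(1) transverse_in_topspace by auto
  have C: "v \<in> ?C" if "near_slit k (v 0) (v (Suc 0))" "transverse 2 v = transverse 2 w" for v
    using that leaf_point_eta[of v] by (intro image_eqI[of _ _ "(v 0, v (Suc 0))"]) auto
  show "glue (Inr k) w \<in> glue (Inr k) ` ?C" "glue (Inr k) u \<in> glue (Inr k) ` ?C"
    using assms by (intro imageI C; simp)+
  show "transverse 2 v = transverse 2 w" if "v \<in> ?C" for v using that by auto
qed

lemma plaques_sym: "plaque\<^sup>*\<^sup>* x y \<Longrightarrow> plaque\<^sup>*\<^sup>* y x"
  using symp_rtranclp[of plaque] same_plaque_glued_sym by (auto simp: symp_def)

lemma plaque_sheet_base:
  assumes "w \<in> piece (Inl i)"
  shows "plaque (glue (Inl i) w) (base i (transverse 2 w))"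
  unfolding base_def using plaque_sheet[OF assms base_piece] assms by simp

lemma plaques_left:
  assumes w: "w \<in> piece (Inr k)"
  shows "plaque\<^sup>*\<^sup>* (glue (Inr k) w) (base (src k) (transverse 2 w))"
proof -
  \<comment> \<open>An offset of 1/4 stays within the strip and strictly left of the slit; height 1
    is positive.\<close>
  let ?u = "leaf_point (real k - 1 / 4) 1 (transverse 2 w)"
  have u: "?u \<in> piece (Inr k)"
    using w transverse_in_topspace by (auto simp: near_slit_def)
  have 1: "plaque (glue (Inr k) w) (glue (Inr k) ?u)" using plaque_handle[OF w u] by simp
  have "plaque (glue (Inl (src k)) ?u) (base (src k) (transverse 2 ?u))"
    by (rule plaque_sheet_base[OF glue_left(1)[OF u]]) simp
  moreover have "glue (Inl (src k)) ?u = glue (Inr k) ?u" by (rule glue_left(2)[OF u]) simp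
  ultimately have 2: "plaque (glue (Inr k) ?u) (base (src k) (transverse 2 w))"
    by (simp only: leaf_point_simps)
  from 1 2 show ?thesis by (meson converse_rtranclp_into_rtranclp r_into_rtranclp)
qed

text \<open>Crossing the handle inside one plaque, from the source sheet on the left to the target
  sheet on the right, turns the transverse coordinate \<open>a\<close> into
  \<open>h k a\<close>.\<close>

lemma plaques_handle:
  assumes a: "a \<in> A k"
  shows "plaque\<^sup>*\<^sup>* (base (src k) a) (base (dst k) (h k a))"
proof -
  let ?u = "leaf_point (real k + 1 / 4) 1 a"
  have "a \<in> topspace (\<R> n)" using a A_open openin_subset by blast
  then have u: "?u \<in> piece (Inr k)" using a by (auto simp: near_slit_def)
  have "plaque (glue (Inl (dst k)) (straighten k ?u)) (base (dst k) (transverse 2 (straighten k ?u)))"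
    by (rule plaque_sheet_base[OF glue_right(1)[OF u]]) simp
  moreover have "glue (Inl (dst k)) (straighten k ?u) = glue (Inr k) ?u" by (rule glue_right(2)[OF u]) simp
  ultimately have 1: "plaque (glue (Inr k) ?u) (base (dst k) (h k a))"
    by (simp only: straighten_simps leaf_point_simps)
  have 2: "plaque\<^sup>*\<^sup>* (base (src k) a) (glue (Inr k) ?u)"
    using plaques_sym[OF plaques_left[OF u]] by (simp only: leaf_point_simps)
  from 2 1 show ?thesis by simp
qed

text \<open>Two handles in succession: one for the change of chart, one for the group element that
  corrects it.\<close>

lemma plaques_base:
  assumes "v \<in> V i" "w \<in> V j" "\<pi> i v = \<pi> j w"
  shows "plaque\<^sup>*\<^sup>* (base i v) (base j w)"
proof -
  obtain k l where kl: "src k = i" "dst k = j" "v \<in> A k" "src l = j" "dst l = j" "h k v \<in> A l" "h l (h k v) = w"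
    using generate[OF assms] by blast
  have "plaque\<^sup>*\<^sup>* (base i v) (base j (h k v))" "plaque\<^sup>*\<^sup>* (base j (h k v)) (base j w)"
    using plaques_handle[OF kl(3)] plaques_handle[OF kl(6)] kl by simp_all
  then show ?thesis by (rule rtranclp_trans)
qed

lemma plaques_to_base:
  assumes "x \<in> carrier_set"
  obtains i v where "v \<in> V i" "to_X x = \<pi> i v" "plaque\<^sup>*\<^sup>* x (base i v)"
proof -
  obtain c w where w: "w \<in> piece c" "x = glue c w" using assms unfolding carrier_set_def by blast
  have "plaque\<^sup>*\<^sup>* x (base (sheet_of c) (transverse 2 w))"
  proof (cases c)
    case (Inl i)
    then show ?thesis using plaque_sheet_base[of w i] w by (simp del: glue.simps piece.simps add: r_into_rtranclp)
  next
    case (Inr k)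
    then show ?thesis using plaques_left[of w k] w by (simp del: glue.simps piece.simps)
  qed
  moreover have "to_X x = \<pi> (sheet_of c) (transverse 2 w)" using to_X_glue[OF w(1)] w(2) by blast
  ultimately show thesis using that piece_transverse[OF w(1)] by blast
qed

lemma plaque_to_X:
  assumes "plaque x y"
  shows "x \<in> carrier_set \<and> y \<in> carrier_set \<and> to_X x = to_X y"
proof -
  obtain c w u where "w \<in> piece c" "u \<in> piece c" "x = glue c w" "y = glue c u" "transverse 2 w = transverse 2 u"
    using same_plaque_gluedD[OF assms] by metis
  then show ?thesis using to_X_glue unfolding carrier_set_def by auto
qed

text \<open>Leaves are the fibres of \<open>to_X\<close>. It is constant on plaques, and conversely
  each point can be moved along plaques to a base point, where \<open>plaques_base\<close> connects
  those with equal image.\<close>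

lemma leaf_relation_glued:
  "leaf_relation 2 glued_topology glued_atlas = {(x, y). x \<in> carrier_set \<and> y \<in> carrier_set \<and> to_X x = to_X y}"
proof -
  have "y \<in> carrier_set \<and> to_X x = to_X y" if "plaque\<^sup>*\<^sup>* x y" "x \<in> carrier_set" for x y
    using that by (induction rule: rtranclp_induct) (auto dest: plaque_to_X)
  moreover have "plaque\<^sup>*\<^sup>* x y" if x: "x \<in> carrier_set" and y: "y \<in> carrier_set" and eq: "to_X x = to_X y" for x y
  proof -
    obtain i v where i: "v \<in> V i" "to_X x = \<pi> i v" "plaque\<^sup>*\<^sup>* x (base i v)" using plaques_to_base[OF x] by blast
    obtain j w where j: "w \<in> V j" "to_X y = \<pi> j w" "plaque\<^sup>*\<^sup>* y (base j w)" using plaques_to_base[OF y] by blast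
    have "plaque\<^sup>*\<^sup>* (base i v) (base j w)" using plaques_base i j eq by simp
    then show ?thesis using rtranclp_trans[OF rtranclp_trans[OF i(3)] plaques_sym[OF j(3)]] by blast
  qed
  ultimately show ?thesis unfolding leaf_relation_def topspace_glued by blast
qed

section \<open>The leaf space as a diffeological space\<close>

definition leaf_over :: "'a \<Rightarrow> (nat \<Rightarrow> real) set" where
  "leaf_over x = {y \<in> carrier_set. to_X y = x}"

lemma leaf_of: "x \<in> carrier_set \<Longrightarrow> leaf_relation 2 glued_topology glued_atlas `` {x} = leaf_over (to_X x)"
  unfolding leaf_relation_glued by (auto simp: leaf_over_def)

lemma bij_leaf_over: "bij_betw leaf_over X (leaf_space 2 glued_topology glued_atlas)"
proof -
  have onto: "\<exists>y\<in>carrier_set. to_X y = x" if x: "x \<in> X" for x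
  proof -
    obtain i v where v: "v \<in> V i" "x = \<pi> i v" using x cover by blast
    then show ?thesis using base_in[OF v(1)] to_X_base[OF v(1)] by blast
  qed
  have "inj_on leaf_over X"
  proof (rule inj_onI)
    fix x x' assume "x \<in> X" "leaf_over x = leaf_over x'"
    then show "x = x'" using onto[of x] by (auto simp: leaf_over_def)
  qed
  moreover have "leaf_over ` X = leaf_space 2 glued_topology glued_atlas"
  proof -
    have "leaf_space 2 glued_topology glued_atlas = (\<lambda>x. leaf_over (to_X x)) ` carrier_set"
      unfolding leaf_space_def quotient_def topspace_glued using leaf_of by auto
    also have "\<dots> = leaf_over ` X" using onto to_X_in by force
    finally show ?thesis by simp
  qed
  ultimately show ?thesis by (simp add: bij_betw_def)
qed

abbreviation leaf_diffeology where
  "leaf_diffeology \<equiv> leaf_space_diffeology 2 (Suc (Suc n)) glued_topology glued_atlas glued_atlas"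

text \<open>A plot of \<open>X\<close> lifts locally through some \<open>\<pi> i\<close>; followed
  by the smooth section \<open>base i\<close>, the lift becomes a plot of the manifold.\<close>

lemma dsmooth_leaf_over: "dsmooth D leaf_diffeology leaf_over"
  unfolding dsmooth_def leaf_space_diffeology_def quotient_diffeology_def
proof (intro allI impI conjI ballI)
  fix k U p assume p: "D k U p"
  then show "openin (\<R> k) U" by (rule plot_openin)
  fix x assume x: "x \<in> U"
  then have "p x \<in> X" using plot_range[OF p] by auto
  then obtain i where "p x \<in> \<pi> i ` V i" using cover by blast
  then obtain W q where W: "openin (\<R> k) W" "x \<in> W" "W \<subseteq> U" "smooth_map k W n q" "q \<in> W \<rightarrow> V i"
    "\<And>y. y \<in> W \<Longrightarrow> p y = \<pi> i (q y)"
    using plot_lift[OF p x] by blast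
  have "smooth_map k W (Suc (Suc n)) (\<lambda>y. leaf_point 0 (-1) (q y))"
    by (rule smooth_map_leaf_point[OF Ck_const[OF W(1)] Ck_const[OF W(1)] W(4)])
  moreover have "(\<lambda>y. leaf_point 0 (-1) (q y)) \<in> W \<rightarrow> piece (Inl i)" using W(5) base_piece by blast
  ultimately have "manifold_diffeology (Suc (Suc n)) glued_topology glued_atlas k W (\<lambda>y. base i (q y))"
    unfolding base_def by (rule manifold_plot)
  moreover have "(leaf_over \<circ> p) y = leaf_relation 2 glued_topology glued_atlas `` {base i (q y)}" if "y \<in> W" for y
  proof -
    have "q y \<in> V i" using W(5) that by blast
    then show ?thesis using W(6)[OF that] leaf_of[OF base_in] to_X_base by simp
  qed
  ultimately show "\<exists>W q. openin (\<R> k) W \<and> x \<in> W \<and> W \<subseteq> U \<and>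
      manifold_diffeology (Suc (Suc n)) glued_topology glued_atlas k W q \<and>
      (\<forall>y\<in>W. (leaf_over \<circ> p) y = leaf_relation 2 glued_topology glued_atlas `` {q y})"
    using W(1-3) by blast
qed

text \<open>Locally a plot of the leaf space comes from a smooth map into one piece. Its transverse
  part is smooth, and composing that with the chart \<open>\<pi> (sheet_of c)\<close> gives the plot
  of \<open>X\<close>, on handles also across the slit.\<close>

lemma dsmooth_inv_leaf_over: "dsmooth leaf_diffeology D (inv_into X leaf_over)"
  unfolding dsmooth_def
proof (intro allI impI)
  fix k U P assume "leaf_diffeology k U P"
  then have U: "openin (\<R> k) U" and P: "\<And>x. x \<in> U \<Longrightarrow> \<exists>W q. openin (\<R> k) W \<and> x \<in> W \<and> W \<subseteq> U \<and>
      manifold_diffeology (Suc (Suc n)) glued_topology glued_atlas k W q \<and>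
      (\<forall>y\<in>W. P y = leaf_relation 2 glued_topology glued_atlas `` {q y})"
    unfolding leaf_space_diffeology_def quotient_diffeology_def by blast+
  show "D k U (inv_into X leaf_over \<circ> P)"
  proof (rule plot_local[OF U], rule ballI)
    fix x assume "x \<in> U"
    then obtain W0 q where W0: "openin (\<R> k) W0" "x \<in> W0" "W0 \<subseteq> U"
      "manifold_diffeology (Suc (Suc n)) glued_topology glued_atlas k W0 q"
      "\<And>y. y \<in> W0 \<Longrightarrow> P y = leaf_relation 2 glued_topology glued_atlas `` {q y}"
      using P by metis
    obtain W c r where W: "openin (\<R> k) W" "x \<in> W" "W \<subseteq> W0" "smooth_map k W (Suc (Suc n)) r" "r \<in> W \<rightarrow> piece c"
      "\<And>y. y \<in> W \<Longrightarrow> q y = glue c (r y)"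
      using manifold_plot_lift[OF W0(4,2)] by metis
    have "smooth_map k W n (\<lambda>y. transverse 2 (r y))"
      by (rule smooth_map_comp[OF W(4) smooth_map_transverse[OF piece_open] W(5)])
    moreover have "(\<lambda>y. transverse 2 (r y)) \<in> W \<rightarrow> V (sheet_of c)" using W(5) piece_transverse by blast
    ultimately have "D k W (\<pi> (sheet_of c) \<circ> (\<lambda>y. transverse 2 (r y)))"
      by (rule plot_compose[OF \<pi>_plot])
    moreover have "(inv_into X leaf_over \<circ> P) y = (\<pi> (sheet_of c) \<circ> (\<lambda>y. transverse 2 (r y))) y" if y: "y \<in> W" for y
    proof -
      have r: "r y \<in> piece c" using W(5) y by blast
      then have qy: "q y \<in> carrier_set" "to_X (q y) = \<pi> (sheet_of c) (transverse 2 (r y))"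
        using W(6)[OF y] to_X_glue by (auto simp: carrier_set_def simp del: glue.simps)
      have "P y = leaf_over (to_X (q y))" using W0(5) y W(3) leaf_of[OF qy(1)] by blast
      then have "inv_into X leaf_over (P y) = to_X (q y)"
        using bij_leaf_over to_X_in[OF qy(1)] by (simp add: bij_betw_def)
      then show ?thesis using qy(2) by simp
    qed
    ultimately have "D k W (inv_into X leaf_over \<circ> P)" using plot_cong by blast
    then show "\<exists>V. openin (\<R> k) V \<and> x \<in> V \<and> V \<subseteq> U \<and> D k V (inv_into X leaf_over \<circ> P)"
      using W(1-3) W0(3) by blast
  qed
qed

lemma diffeomorphic_leaf_space:
  "diffeomorphic X D (leaf_space 2 glued_topology glued_atlas) leaf_diffeology"
  unfolding diffeomorphic_def diffeomorphism_def
  using bij_leaf_over dsmooth_leaf_over dsmooth_inv_leaf_over by blast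

end

theorem corollary7p2:
  fixes X :: "'a set" and D :: "'a diffeology" and n :: nat
  assumes "diffeological_quasifold n X D"
  shows "\<exists>(m::nat) (T :: (nat \<Rightarrow> real) topology) A (p::nat) \<F>.
    manifold m T A \<and> foliation p m T A \<F> \<and>
    diffeomorphic X D (leaf_space p T \<F>) (leaf_space_diffeology p m T A \<F>)"
proof -
  obtain V \<Gamma> \<pi> where "charted_quasifold X D n V \<Gamma> \<pi>"
    using quasifold_imp_charted[OF assms] by (elim exE)
  then interpret charted_quasifold X D n V \<Gamma> \<pi> .
  obtain src dst A h g where *:
    "\<And>k :: nat. local_diffeo (src k) (dst k) (A k) (h k) (g k)"
    "\<And>i j v w. v \<in> V i \<Longrightarrow> w \<in> V j \<Longrightarrow> \<pi> i v = \<pi> j w \<Longrightarrow>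
      \<exists>k l. src k = i \<and> dst k = j \<and> v \<in> A k \<and> src l = j \<and> dst l = j \<and> h k v \<in> A l \<and> h l (h k v) = w"
    by (rule countable_local_diffeos) (rule that)
  interpret holonomy_handles X D n V \<Gamma> \<pi> src dst A h g
    by unfold_locales (fact *)+
  \<comment> \<open>The dimensions are \<open>m = n + 2\<close> and \<open>p = 2\<close>; one atlas
    serves for the smooth structure and for the foliation.\<close>
  show ?thesis
    using manifold_glued foliation_glued diffeomorphic_leaf_space by blast
qed

end
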